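(* Let $\Omega\neq0$, let $\Phi_g=(\phi_1^g,\phi_2^g)^\top$ be a real-valued ground state, and let $\mathcal H_\pm$ and $\mathcal H=\begin{bmatrix}\mathcal O&\mathcal H_-\\ \mathcal H_+&\mathcal O\end{bmatrix}$ be the associated operators (see context). Assume that $\mathcal H_+$ is positive definite and $\operatorname{null}(\mathcal H_-)=\operatorname{span}\{\Phi_g\}$. Then $$\operatorname{null}(\mathcal H^3)=\operatorname{null}(\mathcal H^2)=\operatorname{null}(\mathcal H)\oplus\operatorname{span}\left\{\begin{bmatrix}\widehat\Phi_1\\ \mathbf 0\end{bmatrix}\right\},$$ where $\widehat\Phi_1=\mathcal H_+^{-1}\Phi_g$ and $\operatorname{null}(\mathcal H)=\operatorname{span}\left\{\begin{bmatrix}\mathbf 0\\ \Phi_g\end{bmatrix}\right\}$.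
   Context: Let $d\in\{1,2,3\}$, $V:\mathbb R^d\to[0,\infty)$ locally integrable with $\lim_{|\boldsymbol x|\to\infty}V(\boldsymbol x)=\infty$, $\delta,\Omega\in\mathbb R$, $\beta_{jl}\in\mathbb R$ ($j,l=1,2$) with $\beta_{12}=\beta_{21}$. Let $X=\{\boldsymbol f\in H^1(\mathbb R^d;\mathbb C^2):\int V|\boldsymbol f|^2<\infty\}$. A ground state is a minimizer $\Phi_g$, over $\Phi=(\phi_1,\phi_2)^\top\in X$ with $\int(|\phi_1|^2+|\phi_2|^2)=1$, of $$\mathcal E_\Omega(\Phi)=\int_{\mathbb R^d}\sum_j\Big(\tfrac12|\nabla\phi_j|^2+V|\phi_j|^2\Big)+\sum_{j,l}\tfrac{\beta_{jl}}2|\phi_j|^2|\phi_l|^2+\tfrac\delta2(|\phi_1|^2-|\phi_2|^2)+\Omega\,\mathrm{Re}(\phi_1\overline{\phi_2})\,d\boldsymbol x .$$ Its chemical potential $\mu_g\in\mathbb R$ is the Lagrange multiplier in the Euler–Lagrange equations $$\mu_g\phi_1^g=[-\tfrac12\nabla^2+V+\tfrac\delta2+\beta_{11}|\phi_1^g|^2+\beta_{12}|\phi_2^g|^2]\phi_1^g+\tfrac\Omega2\phi_2^g,$$ $$\mu_g\phi_2^g=[-\tfrac12\nabla^2+V-\tfrac\delta2+\beta_{21}|\phi_1^g|^2+\beta_{22}|\phi_2^g|^2]\phi_2^g+\tfrac\Omega2\phi_1^g.$$ Put $$\mathcal A=\begin{bmatrix}L_1&\beta_{12}\phi_1^g\phi_2^g+\frac\Omega2\\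 \beta_{21}\phi_1^g\phi_2^g+\frac\Omega2&L_2\end{bmatrix},\qquad \mathcal B=\begin{bmatrix}\beta_{11}(\phi_1^g)^2&\beta_{12}\phi_1^g\phi_2^g\\ \beta_{21}\phi_1^g\phi_2^g&\beta_{22}(\phi_2^g)^2\end{bmatrix},$$ $$L_1=-\tfrac12\nabla^2+V+\tfrac\delta2+2\beta_{11}(\phi_1^g)^2+\beta_{12}(\phi_2^g)^2-\mu_g,\qquad L_2=-\tfrac12\nabla^2+V-\tfrac\delta2+\beta_{21}(\phi_1^g)^2+2\beta_{22}(\phi_2^g)^2-\mu_g,$$ $\mathcal H_+=\mathcal A+\mathcal B$, $\mathcal H_-=\mathcal A-\mathcal B$. These are understood as the self-adjoint operators on $L^2(\mathbb R^d;\mathbb C^2)$ associated with the corresponding Hermitian forms on $X$ (closed and bounded below, with compact resolvent since $V\to\infty$). Positive definite means $\langle\mathcal H_+\boldsymbol f,\boldsymbol f\rangle>0$ (as a form) for all $0\ne\boldsymbol f\in X$; then $\mathcal H_+$ is invertible. The operator $\mathcal H$ acts on pairs $(\boldsymbol f,\boldsymbol g)$ with $\boldsymbol f\in\operatorname{dom}(\mathcal H_+)$, $\boldsymbol g\in\operatorname{dom}(\mathcal H_-)$ by $\mathcal H(\boldsymbol f,\boldsymbol g)=(\mathcal H_-\boldsymbol g,\mathcal H_+\boldsymbol f)$, and its powers have their natural domains. *)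

theory Defs
  imports "HOL-Analysis.Analysis"
begin

text \<open>
  Elements of \<open>L\<^sup>2\<close> are represented by Lebesgue measurable functions; all sets and relations
  of functions below are closed under modification on Lebesgue null sets, and equality in
  \<open>L\<^sup>2\<close> is equality almost everywhere.
\<close>

definition locally_integrable :: "(real^'n \<Rightarrow> real) \<Rightarrow> bool" where
  "locally_integrable V \<longleftrightarrow>
     V \<in> borel_measurable lebesgue \<and> (\<forall>K. compact K \<longrightarrow> set_integrable lebesgue K V)"

definition square_integrable :: "(real^'n \<Rightarrow> 'b::euclidean_space) \<Rightarrow> bool" where
  "square_integrable f \<longleftrightarrow>
     f \<in> borel_measurable lebesgue \<and> integrable lebesgue (\<lambda>x. (norm (f x))\<^sup>2)"

primrec Ck :: "nat \<Rightarrow> (real^'n \<Rightarrow> real) \<Rightarrow> bool" where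
  "Ck 0 f \<longleftrightarrow> continuous_on UNIV f"
| "Ck (Suc k) f \<longleftrightarrow> (\<forall>x. f differentiable (at x)) \<and>
                  (\<forall>v. Ck k (\<lambda>x. frechet_derivative f (at x) v))"

definition test_function :: "(real^'n \<Rightarrow> real) \<Rightarrow> bool" where
  "test_function \<eta> \<longleftrightarrow> (\<forall>k. Ck k \<eta>) \<and> compact (closure {x. \<eta> x \<noteq> 0})"

definition weak_partial :: "'n \<Rightarrow> (real^'n \<Rightarrow> complex) \<Rightarrow> (real^'n \<Rightarrow> complex) \<Rightarrow> bool" where
  "weak_partial i f g \<longleftrightarrow>
     (\<forall>\<eta>. test_function \<eta> \<longrightarrow>
        (LINT x|lebesgue. f x * of_real (frechet_derivative \<eta> (at x) (axis i 1)))
          = - (LINT x|lebesgue. g x * of_real (\<eta> x)))"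

definition H1 :: "(real^'n \<Rightarrow> complex) set" where
  "H1 = {f. square_integrable f \<and> (\<forall>i. \<exists>g. square_integrable g \<and> weak_partial i f g)}"

text \<open>A weak derivative is unique only up to null sets, so a representative is chosen.\<close>

definition wderiv :: "'n \<Rightarrow> (real^'n \<Rightarrow> complex) \<Rightarrow> real^'n \<Rightarrow> complex" where
  "wderiv i f = (SOME g. square_integrable g \<and> weak_partial i f g)"

definition form_domain :: "(real^'n \<Rightarrow> real) \<Rightarrow> (real^'n \<Rightarrow> complex^2) set" where
  "form_domain V = {f. (\<forall>j. (\<lambda>x. f x $ j) \<in> H1) \<and> integrable lebesgue (\<lambda>x. V x * (norm (f x))\<^sup>2)}"

definition L2_inner :: "(real^'n \<Rightarrow> complex^2) \<Rightarrow> (real^'n \<Rightarrow> complex^2) \<Rightarrow> complex" where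
  "L2_inner f h = (LINT x|lebesgue. (\<Sum>j\<in>UNIV. f x $ j * cnj (h x $ j)))"

text \<open>
  The sesquilinear form on \<^term>\<open>form_domain V\<close> of \<open>-\<nabla>\<^sup>2/2 + V + W\<close>, where the potential \<open>W\<close> is
  matrix valued.
\<close>

definition schroedinger_form ::
  "(real^'n \<Rightarrow> real) \<Rightarrow> (real^'n \<Rightarrow> complex^2^2) \<Rightarrow>
   (real^'n \<Rightarrow> complex^2) \<Rightarrow> (real^'n \<Rightarrow> complex^2) \<Rightarrow> complex" where
  "schroedinger_form V W f h =
     (LINT x|lebesgue. (\<Sum>j\<in>UNIV.
        1/2 * (\<Sum>i\<in>UNIV. wderiv i (\<lambda>y. f y $ j) x * cnj (wderiv i (\<lambda>y. h y $ j) x))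
        + of_real (V x) * f x $ j * cnj (h x $ j)
        + (W x *v f x) $ j * cnj (h x $ j)))"

text \<open>
  The graph of the operator associated with that form: its domain consists of those \<open>f\<close> in the
  form domain for which some square integrable \<open>u\<close> (unique up to null sets, the form domain
  being dense) represents the form at \<open>f\<close>, and \<open>u\<close> is then the value at \<open>f\<close>.
\<close>

definition schroedinger_op ::
  "(real^'n \<Rightarrow> real) \<Rightarrow> (real^'n \<Rightarrow> complex^2^2) \<Rightarrow>
   ((real^'n \<Rightarrow> complex^2) \<times> (real^'n \<Rightarrow> complex^2)) set" where
  "schroedinger_op V W = {(f, u). f \<in> form_domain V \<and> square_integrable u \<and>
     (\<forall>h \<in> form_domain V. schroedinger_form V W f h = L2_inner u h)}"

definition energy ::
  "(real^'n \<Rightarrow> real) \<Rightarrow> real^2^2 \<Rightarrow> real \<Rightarrow> real \<Rightarrow> (real^'n \<Rightarrow> complex^2) \<Rightarrow> real" where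
  "energy V \<beta> \<delta> \<Omega> \<Phi> = (LINT x|lebesgue.
     (\<Sum>j\<in>UNIV. 1/2 * (\<Sum>i\<in>UNIV. (cmod (wderiv i (\<lambda>y. \<Phi> y $ j) x))\<^sup>2) + V x * (cmod (\<Phi> x $ j))\<^sup>2)
     + (\<Sum>j\<in>UNIV. \<Sum>l\<in>UNIV. \<beta> $ j $ l / 2 * (cmod (\<Phi> x $ j))\<^sup>2 * (cmod (\<Phi> x $ l))\<^sup>2)
     + \<delta>/2 * ((cmod (\<Phi> x $ 1))\<^sup>2 - (cmod (\<Phi> x $ 2))\<^sup>2)
     + \<Omega> * Re (\<Phi> x $ 1 * cnj (\<Phi> x $ 2)))"

definition admissible :: "(real^'n \<Rightarrow> real) \<Rightarrow> (real^'n \<Rightarrow> complex^2) set" where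
  "admissible V = {\<Phi> \<in> form_domain V.
     (LINT x|lebesgue. (cmod (\<Phi> x $ 1))\<^sup>2 + (cmod (\<Phi> x $ 2))\<^sup>2) = 1}"

definition ground_state ::
  "(real^'n \<Rightarrow> real) \<Rightarrow> real^2^2 \<Rightarrow> real \<Rightarrow> real \<Rightarrow> (real^'n \<Rightarrow> complex^2) \<Rightarrow> bool" where
  "ground_state V \<beta> \<delta> \<Omega> \<Phi> \<longleftrightarrow>
     \<Phi> \<in> admissible V \<and> (\<forall>\<Psi> \<in> admissible V. energy V \<beta> \<delta> \<Omega> \<Phi> \<le> energy V \<beta> \<delta> \<Omega> \<Psi>)"

definition gp_matrix ::
  "real^2^2 \<Rightarrow> real \<Rightarrow> real \<Rightarrow> (real^'n \<Rightarrow> complex^2) \<Rightarrow> real^'n \<Rightarrow> complex^2^2" where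
  "gp_matrix \<beta> \<delta> \<Omega> \<Phi> x = vector
     [vector [of_real (\<delta>/2 + \<beta>$1$1 * (cmod (\<Phi> x $ 1))\<^sup>2 + \<beta>$1$2 * (cmod (\<Phi> x $ 2))\<^sup>2),
              of_real (\<Omega>/2)],
      vector [of_real (\<Omega>/2),
              of_real (- \<delta>/2 + \<beta>$2$1 * (cmod (\<Phi> x $ 1))\<^sup>2 + \<beta>$2$2 * (cmod (\<Phi> x $ 2))\<^sup>2)]]"

text \<open>The Euler--Lagrange equations with multiplier \<open>\<mu>\<close>, in weak form.\<close>

definition chemical_potential ::
  "(real^'n \<Rightarrow> real) \<Rightarrow> real^2^2 \<Rightarrow> real \<Rightarrow> real \<Rightarrow> (real^'n \<Rightarrow> complex^2) \<Rightarrow> real \<Rightarrow> bool" where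
  "chemical_potential V \<beta> \<delta> \<Omega> \<Phi> \<mu> \<longleftrightarrow>
     (\<Phi>, \<lambda>x. of_real \<mu> *s \<Phi> x) \<in> schroedinger_op V (gp_matrix \<beta> \<delta> \<Omega> \<Phi>)"

text \<open>
  \<open>A_matrix\<close> is the potential part of \<open>\<A>\<close>, that is, without \<open>-\<nabla>\<^sup>2/2 + V\<close> on the diagonal.
\<close>

definition A_matrix ::
  "real^2^2 \<Rightarrow> real \<Rightarrow> real \<Rightarrow> (real^'n \<Rightarrow> complex^2) \<Rightarrow> real \<Rightarrow> real^'n \<Rightarrow> complex^2^2" where
  "A_matrix \<beta> \<delta> \<Omega> \<Phi> \<mu> x = vector
     [vector [of_real (\<delta>/2) + 2 * of_real (\<beta>$1$1) * (\<Phi> x $ 1)\<^sup>2 + of_real (\<beta>$1$2) * (\<Phi> x $ 2)\<^sup>2 - of_real \<mu>,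
              of_real (\<beta>$1$2) * \<Phi> x $ 1 * \<Phi> x $ 2 + of_real (\<Omega>/2)],
      vector [of_real (\<beta>$2$1) * \<Phi> x $ 1 * \<Phi> x $ 2 + of_real (\<Omega>/2),
              of_real (- \<delta>/2) + of_real (\<beta>$2$1) * (\<Phi> x $ 1)\<^sup>2 + 2 * of_real (\<beta>$2$2) * (\<Phi> x $ 2)\<^sup>2 - of_real \<mu>]]"

definition B_matrix :: "real^2^2 \<Rightarrow> (real^'n \<Rightarrow> complex^2) \<Rightarrow> real^'n \<Rightarrow> complex^2^2" where
  "B_matrix \<beta> \<Phi> x = vector
     [vector [of_real (\<beta>$1$1) * (\<Phi> x $ 1)\<^sup>2, of_real (\<beta>$1$2) * \<Phi> x $ 1 * \<Phi> x $ 2],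
      vector [of_real (\<beta>$2$1) * \<Phi> x $ 1 * \<Phi> x $ 2, of_real (\<beta>$2$2) * (\<Phi> x $ 2)\<^sup>2]]"

definition plus_matrix ::
  "real^2^2 \<Rightarrow> real \<Rightarrow> real \<Rightarrow> (real^'n \<Rightarrow> complex^2) \<Rightarrow> real \<Rightarrow> real^'n \<Rightarrow> complex^2^2" where
  "plus_matrix \<beta> \<delta> \<Omega> \<Phi> \<mu> x = A_matrix \<beta> \<delta> \<Omega> \<Phi> \<mu> x + B_matrix \<beta> \<Phi> x"

definition minus_matrix ::
  "real^2^2 \<Rightarrow> real \<Rightarrow> real \<Rightarrow> (real^'n \<Rightarrow> complex^2) \<Rightarrow> real \<Rightarrow> real^'n \<Rightarrow> complex^2^2" where
  "minus_matrix \<beta> \<delta> \<Omega> \<Phi> \<mu> x = A_matrix \<beta> \<delta> \<Omega> \<Phi> \<mu> x - B_matrix \<beta> \<Phi> x"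

definition H_plus ::
  "(real^'n \<Rightarrow> real) \<Rightarrow> real^2^2 \<Rightarrow> real \<Rightarrow> real \<Rightarrow> (real^'n \<Rightarrow> complex^2) \<Rightarrow> real \<Rightarrow>
   ((real^'n \<Rightarrow> complex^2) \<times> (real^'n \<Rightarrow> complex^2)) set" where
  "H_plus V \<beta> \<delta> \<Omega> \<Phi> \<mu> = schroedinger_op V (plus_matrix \<beta> \<delta> \<Omega> \<Phi> \<mu>)"

definition H_minus ::
  "(real^'n \<Rightarrow> real) \<Rightarrow> real^2^2 \<Rightarrow> real \<Rightarrow> real \<Rightarrow> (real^'n \<Rightarrow> complex^2) \<Rightarrow> real \<Rightarrow>
   ((real^'n \<Rightarrow> complex^2) \<times> (real^'n \<Rightarrow> complex^2)) set" where
  "H_minus V \<beta> \<delta> \<Omega> \<Phi> \<mu> = schroedinger_op V (minus_matrix \<beta> \<delta> \<Omega> \<Phi> \<mu>)"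

text \<open>The form is Hermitian, so its diagonal values are real and taking \<^const>\<open>Re\<close> loses nothing.\<close>

definition positive_definite_form ::
  "(real^'n \<Rightarrow> real) \<Rightarrow> (real^'n \<Rightarrow> complex^2^2) \<Rightarrow> bool" where
  "positive_definite_form V W \<longleftrightarrow>
     (\<forall>f \<in> form_domain V. \<not> (AE x in lebesgue. f x = 0) \<longrightarrow> 0 < Re (schroedinger_form V W f f))"

text \<open>
  The block operator \<open>(f, g) \<mapsto> (H\<^sub>- g, H\<^sub>+ f)\<close> as a graph. Its relational powers \<open>H ^^ n\<close> are the
  graphs of the operator powers on their natural domains.
\<close>

definition H_block ::
  "(real^'n \<Rightarrow> real) \<Rightarrow> real^2^2 \<Rightarrow> real \<Rightarrow> real \<Rightarrow> (real^'n \<Rightarrow> complex^2) \<Rightarrow> real \<Rightarrow>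
   (((real^'n \<Rightarrow> complex^2) \<times> (real^'n \<Rightarrow> complex^2)) \<times>
    ((real^'n \<Rightarrow> complex^2) \<times> (real^'n \<Rightarrow> complex^2))) set" where
  "H_block V \<beta> \<delta> \<Omega> \<Phi> \<mu> =
     {((f, g), (u, w)). (g, u) \<in> H_minus V \<beta> \<delta> \<Omega> \<Phi> \<mu> \<and> (f, w) \<in> H_plus V \<beta> \<delta> \<Omega> \<Phi> \<mu>}"

definition null_space :: "(('a \<Rightarrow> 'b::zero) \<times> ('a \<Rightarrow> 'b)) set \<Rightarrow> ('a \<Rightarrow> 'b) set" where
  "null_space R = {f. (f, \<lambda>x. 0) \<in> R}"

definition null_space2 ::
  "((('a \<Rightarrow> 'b::zero) \<times> ('a \<Rightarrow> 'b)) \<times> (('a \<Rightarrow> 'b) \<times> ('a \<Rightarrow> 'b))) set \<Rightarrow> (('a \<Rightarrow> 'b) \<times> ('a \<Rightarrow> 'b)) set" where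
  "null_space2 R = {p. (p, (\<lambda>x. 0, \<lambda>x. 0)) \<in> R}"

text \<open>The complex span of a single element of \<open>L\<^sup>2\<close> and of a single pair of such elements.\<close>

definition span1 :: "(real^'n \<Rightarrow> complex^2) \<Rightarrow> (real^'n \<Rightarrow> complex^2) set" where
  "span1 v = {f. \<exists>c. AE x in lebesgue. f x = c *s v x}"

definition span2 ::
  "(real^'n \<Rightarrow> complex^2) \<times> (real^'n \<Rightarrow> complex^2) \<Rightarrow>
   ((real^'n \<Rightarrow> complex^2) \<times> (real^'n \<Rightarrow> complex^2)) set" where
  "span2 p = {(f, g). \<exists>c. (AE x in lebesgue. f x = c *s fst p x) \<and>
                          (AE x in lebesgue. g x = c *s snd p x)}"

definition is_direct_sum ::
  "((real^'n \<Rightarrow> complex^2) \<times> (real^'n \<Rightarrow> complex^2)) set \<Rightarrow>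
   ((real^'n \<Rightarrow> complex^2) \<times> (real^'n \<Rightarrow> complex^2)) set \<Rightarrow>
   ((real^'n \<Rightarrow> complex^2) \<times> (real^'n \<Rightarrow> complex^2)) set \<Rightarrow> bool" where
  "is_direct_sum S M N \<longleftrightarrow>
     S = {(\<lambda>x. f x + f' x, \<lambda>x. g x + g' x) | f g f' g'. (f, g) \<in> M \<and> (f', g') \<in> N} \<and>
     M \<inter> N = {(f, g). (AE x in lebesgue. f x = 0) \<and> (AE x in lebesgue. g x = 0)}"

end

theory Submission
  imports Defs
begin

text \<open>
  Positivity of \<open>H\<^sub>+\<close> with compact resolvent makes it invertible, so a vector killed by \<open>H\<^sup>2\<close> is
  \<open>(f, g)\<close> with \<open>H\<^sub>+ f\<close> and \<open>g\<close> both in \<open>ker H\<^sub>- = span \<Phi>\<close>. A strictly longer chain would need some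
  \<open>g\<close> with \<open>H\<^sub>- g = H\<^sub>+\<^sup>-\<^sup>1 \<Phi>\<close>, which is impossible: \<open>H\<^sub>-\<close> is symmetric and kills \<open>\<Phi>\<close>, but
  \<open>\<langle>H\<^sub>+\<^sup>-\<^sup>1 \<Phi>, \<Phi>\<rangle> > 0\<close>.

  The analytic part is the solvability of \<open>H\<^sub>+ f = \<Phi>\<close>. Everything is derived from the estimate
  \<open>\<parallel>f(\<cdot> + v) - f\<parallel> \<le> |v| \<parallel>\<nabla>f\<parallel>\<close> in \<open>L\<^sup>2\<close>. It bounds the distance from \<open>f\<close> to its averages over the
  cells of a grid of mesh \<open>h\<close> by a multiple of \<open>h \<parallel>\<nabla>f\<parallel>\<close>, which replaces the compact embedding into \<open>L\<^sup>2\<close>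
  on balls by finitely many functionals; telescoping over the meshes \<open>h/16\<^sup>k\<close> gives the embedding into
  \<open>L\<^sup>4\<close>, where dimension at most three is used. Hence the potential part is infinitesimally form bounded,
  the form of \<open>H\<^sub>+\<close> is coercive, and the equation is solved by minimisation.
\<close>

section \<open>Smooth test functions\<close>

text \<open>Strict positivity of the form provides no gap by itself. Coercivity comes from a Garding
  inequality whose error consists of finitely many cell integrals: a normalised sequence with
  vanishing form would converge to a nonzero vector on which the form vanishes. The ratio 16 and the
  dimension bound belong to one computation. With \<open>T\<close> the Dirichlet integral,
  consecutive cell averages differ by order h^(2-d) T in the squared supremum and by order h^2 T in
  the squared \<open>L^2\<close> norm, hence by h^(4-d) T^2 \<le> h T^2 in the integral of the
  fourth power when d \<le> 3 and h \<le> 1. Splitting the fourth power of a telescoping sum costs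
  weights 8^k, and meshes h/16^k turn these into the ratio 1/2. The mesh stays a free parameter: a
  small \<open>h\<close> makes the coefficient of the gradient small at the expense of the mass
  term, which is what makes the potential infinitesimally bounded. The minimisation is real; testing
  with \<open>\<i>\<close> times a vector recovers the imaginary part of the equation.\<close>

lemma Ck_SucI:
  assumes "\<And>x. (f has_derivative D x) (at x)" and "\<And>v. Ck k (\<lambda>x. D x v)"
  shows "Ck (Suc k) f"
proof -
  have "frechet_derivative f (at x) = D x" for x
    using frechet_derivative_at[OF assms(1)] by metis
  then show ?thesis
    using assms by (auto simp: differentiable_def)
qed

lemma Ck_SucE:
  assumes "Ck (Suc k) f"
  obtains D where "\<And>x. (f has_derivative D x) (at x)" and "\<And>v. Ck k (\<lambda>x. D x v)"
  using assms that[of "\<lambda>x. frechet_derivative f (at x)"]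
  by (auto simp: frechet_derivative_works)

lemma Ck_Suc_imp_Ck: "Ck (Suc k) f \<Longrightarrow> Ck k f"
proof (induction k arbitrary: f)
  case 0
  then have "f differentiable (at x)" for x
    by simp
  then show ?case
    using differentiable_imp_continuous_within
    by (metis Ck.simps(1) continuous_at_imp_continuous_on)
next
  case (Suc k)
  then show ?case
    by (metis Ck.simps(2))
qed

lemma Ck_imp_continuous: "Ck k f \<Longrightarrow> continuous_on UNIV f"
  by (induction k) (auto dest: Ck_Suc_imp_Ck simp del: Ck.simps(2))

lemma Ck_const: "Ck k (\<lambda>x. c)"
proof (induction k arbitrary: c)
  case (Suc k)
  show ?case
    by (rule Ck_SucI[where D="\<lambda>x v. 0"]) (auto intro: Suc)
qed simp

lemma Ck_add: "Ck k f \<Longrightarrow> Ck k g \<Longrightarrow> Ck k (\<lambda>x. f x + g x)"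
proof (induction k arbitrary: f g)
  case 0
  then show ?case by (auto intro: continuous_intros)
next
  case (Suc k)
  from Suc.prems(1) obtain D
    where D: "\<And>x. (f has_derivative D x) (at x)" "\<And>v. Ck k (\<lambda>x. D x v)"
    by (rule Ck_SucE) blast
  from Suc.prems(2) obtain E
    where E: "\<And>x. (g has_derivative E x) (at x)" "\<And>v. Ck k (\<lambda>x. E x v)"
    by (rule Ck_SucE) blast
  show ?case
    by (rule Ck_SucI[OF has_derivative_add[OF D(1) E(1)]]) (intro Suc.IH D E)
qed

lemma Ck_mult: "Ck k f \<Longrightarrow> Ck k g \<Longrightarrow> Ck k (\<lambda>x. f x * g x)"
proof (induction k arbitrary: f g)
  case 0
  then show ?case by (auto intro: continuous_intros)
next
  case (Suc k)
  from Suc.prems(1) obtain D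
    where D: "\<And>x. (f has_derivative D x) (at x)" "\<And>v. Ck k (\<lambda>x. D x v)"
    by (rule Ck_SucE) blast
  from Suc.prems(2) obtain E
    where E: "\<And>x. (g has_derivative E x) (at x)" "\<And>v. Ck k (\<lambda>x. E x v)"
    by (rule Ck_SucE) blast
  show ?case
    by (rule Ck_SucI[OF has_derivative_mult[OF D(1) E(1)]])
      (intro Ck_add Suc.IH D E Ck_Suc_imp_Ck[OF Suc.prems(1)] Ck_Suc_imp_Ck[OF Suc.prems(2)])
qed

lemma Ck_prod: "(\<And>i. i \<in> I \<Longrightarrow> Ck k (f i)) \<Longrightarrow> Ck k (\<lambda>x. \<Prod>i\<in>I. f i x)"
  by (induction I rule: infinite_finite_induct) (auto intro: Ck_const Ck_mult)

lemma has_derivative_translate: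
  assumes "(f has_derivative D (x - w)) (at (x - w :: 'a::real_normed_vector))"
  shows "((\<lambda>x. f (x - w)) has_derivative D (x - w)) (at x)"
  by (rule has_derivative_compose[where f="\<lambda>x. x - w" and f'="\<lambda>x. x", simplified, OF _ assms])
     (auto intro!: derivative_eq_intros)

lemma Ck_translate: "Ck k f \<Longrightarrow> Ck k (\<lambda>x. f (x - w))"
proof (induction k arbitrary: f)
  case 0
  then show ?case
    by (auto intro!: continuous_on_compose2[of UNIV f] continuous_intros)
next
  case (Suc k)
  from Suc.prems obtain D
    where D: "\<And>x. (f has_derivative D x) (at x)" "\<And>v. Ck k (\<lambda>x. D x v)"
    by (rule Ck_SucE) blast
  show ?case
    by (rule Ck_SucI[OF has_derivative_translate[where D=D, OF D(1)]]) (rule Suc.IH[OF D(2)])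
qed

section \<open>Bump functions built from the flat exponential\<close>

definition flat_exp :: "nat \<Rightarrow> real \<Rightarrow> real" where
  "flat_exp m t = (if t > 0 then exp (- 1 / t) / t ^ m else 0)"

text \<open>The substitution u = 1/t turns the right limit into u^m / exp u at infinity; to the left
  of 0 the function is constantly 0.\<close>

lemma flat_exp_tendsto_0: "(flat_exp m \<longlongrightarrow> 0) (at 0)"
proof -
  have "((\<lambda>u::real. u ^ m / exp u) \<longlongrightarrow> 0) at_top"
    by (rule tendsto_power_div_exp_0)
  then have "((\<lambda>t::real. (inverse t) ^ m / exp (inverse t)) \<longlongrightarrow> 0) (at_right 0)"
    by (rule filterlim_compose) (rule filterlim_inverse_at_top_right)
  then have "(flat_exp m \<longlongrightarrow> 0) (at_right 0)"
    by (rule Lim_transform_eventually)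
      (use eventually_at_right_less[of "0::real"] in \<open>eventually_elim,
        simp add: flat_exp_def exp_minus divide_inverse power_inverse mult.commute\<close>)
  moreover have "(flat_exp m \<longlongrightarrow> 0) (at_left 0)"
    by (rule tendsto_eventually) (auto simp: eventually_at_filter flat_exp_def)
  ultimately show ?thesis
    by (simp add: filterlim_split_at)
qed

text \<open>The powers in the denominator make the family closed under differentiation, so that
  smoothness of every member is a single induction with \<open>m\<close> arbitrary. At t = 0 the
  difference quotient of \<open>flat_exp m\<close> is \<open>flat_exp (m + 1)\<close>, which tends
  to 0.\<close>

lemma flat_exp_has_derivative:
  "(flat_exp m has_real_derivative flat_exp (m + 2) t - m * flat_exp (m + 1) t) (at t)"
proof -
  consider "t > 0" | "t < 0" | "t = 0" by linarith
  then show ?thesis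
  proof cases
    case 1
    have "((\<lambda>t. exp (- 1 / t) / t ^ m) has_real_derivative
        exp (- 1 / t) / t ^ (m + 2) - m * (exp (- 1 / t) / t ^ (m + 1))) (at t)"
    proof -
      have pow: "((\<lambda>t. t ^ m) has_real_derivative m * t ^ m / t) (at t)"
        using DERIV_pow[of m t] 1 by (cases m) auto
      have exp: "((\<lambda>t. exp (- 1 / t)) has_real_derivative exp (- 1 / t) / t ^ 2) (at t)"
        using 1 by (auto intro!: derivative_eq_intros simp: power2_eq_square)
      show ?thesis
        by (rule DERIV_cong[OF DERIV_divide[OF exp pow]])
          (use 1 in \<open>auto simp: field_simps power_add power2_eq_square\<close>)
    qed
    then have "((\<lambda>t. exp (- 1 / t) / t ^ m) has_real_derivative
        flat_exp (m + 2) t - m * flat_exp (m + 1) t) (at t)"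
      using 1 by (simp add: flat_exp_def)
    then show ?thesis
      by (rule has_field_derivative_transform_within_open[where S="{0<..}"])
        (use 1 in \<open>auto simp: flat_exp_def\<close>)
  next
    case 2
    have "((\<lambda>t. 0) has_real_derivative flat_exp (m + 2) t - m * flat_exp (m + 1) t) (at t)"
      using 2 by (simp add: flat_exp_def)
    then show ?thesis
      by (rule has_field_derivative_transform_within_open[where S="{..<0}"])
        (use 2 in \<open>auto simp: flat_exp_def\<close>)
  next
    case 3
    have "((\<lambda>h. (flat_exp m (0 + h) - flat_exp m 0) / h) \<longlongrightarrow> 0) (at 0)"
      by (rule Lim_transform_eventually[OF flat_exp_tendsto_0[of "m + 1"]])
        (auto simp: eventually_at_filter flat_exp_def)
    then show ?thesis
      using 3 by (simp add: DERIV_def flat_exp_def)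
  qed
qed

lemma flat_exp_bounds: "0 \<le> flat_exp 0 t" "flat_exp 0 t \<le> 1"
  by (auto simp: flat_exp_def)

lemma Ck_flat_exp: "Ck k (\<lambda>x::real^'n. flat_exp m (c * x $ i + e))"
proof (induction k arbitrary: m)
  case 0
  have "continuous_on UNIV (flat_exp m)"
    using flat_exp_has_derivative
    by (metis DERIV_isCont continuous_at_imp_continuous_on)
  then show ?case
    by (auto intro!: continuous_on_compose2[of UNIV "flat_exp m"] continuous_intros)
next
  case (Suc k)
  have affine: "((\<lambda>x::real^'n. c * x $ i + e) has_derivative (\<lambda>v. c * v $ i)) (at x)" for x
    by (rule has_derivative_eq_rhs[OF has_derivative_add[OF has_derivative_mult_right[OF
          bounded_linear_imp_has_derivative[OF bounded_linear_vec_nth]] has_derivative_const]]) simp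
  have "((\<lambda>x::real^'n. flat_exp m (c * x $ i + e)) has_derivative
      (\<lambda>v. (flat_exp (m + 2) (c * x $ i + e) + - m * flat_exp (m + 1) (c * x $ i + e)) * (c * v $ i))) (at x)" for x
    using has_derivative_compose[OF affine flat_exp_has_derivative[unfolded has_field_derivative_def]]
    by simp
  then show ?case
    by (rule Ck_SucI) (intro Ck_add Ck_mult Ck_const Suc.IH)
qed

text \<open>Scaling the arguments by \<open>n\<close> drives each factor to 1 inside the box while
  the product vanishes outside. The result is a sequence of test functions with values in [0,1] that
  converges pointwise to the indicator of the open box, as dominated convergence requires.\<close>

definition box_bump :: "real^'n \<Rightarrow> real^'n \<Rightarrow> nat \<Rightarrow> real^'n \<Rightarrow> real" where
  "box_bump a b n x = (\<Prod>i\<in>UNIV. flat_exp 0 (real n * (x $ i - a $ i)) * flat_exp 0 (real n * (b $ i - x $ i)))"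

lemma box_bump_eq_0: "x \<notin> box a b \<Longrightarrow> box_bump a b n x = 0"
proof -
  assume "x \<notin> box a b"
  then obtain i where "x $ i \<le> a $ i \<or> b $ i \<le> x $ i"
    by (auto simp: mem_box_cart not_less)
  then have "real n * (x $ i - a $ i) \<le> 0 \<or> real n * (b $ i - x $ i) \<le> 0"
    by (auto simp: mult_nonneg_nonpos)
  then have "flat_exp 0 (real n * (x $ i - a $ i)) * flat_exp 0 (real n * (b $ i - x $ i)) = 0"
    by (auto simp: flat_exp_def)
  then show ?thesis
    unfolding box_bump_def by (intro prod_zero) auto
qed

lemma box_bump_bounds: "0 \<le> box_bump a b n x" "box_bump a b n x \<le> 1"
  unfolding box_bump_def
  by (intro prod_nonneg prod_le_1 conjI mult_le_one mult_nonneg_nonneg flat_exp_bounds)+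

lemma box_bump_tendsto_indicator:
  fixes x :: "real^'n"
  shows "(\<lambda>n. box_bump a b n x) \<longlonglongrightarrow> indicator (box a b) x"
proof (cases "x \<in> box a b")
  case True
  have lim: "(\<lambda>n. flat_exp 0 (real n * s)) \<longlonglongrightarrow> 1" if "s > 0" for s
  proof -
    have "(\<lambda>n. exp (- (1 / s) * inverse (real n))) \<longlonglongrightarrow> exp (- (1 / s) * 0)"
      by (intro tendsto_intros lim_inverse_n)
    then have "(\<lambda>n. exp (- (1 / s) * inverse (real n))) \<longlonglongrightarrow> 1"
      by simp
    moreover have "\<forall>\<^sub>F n in sequentially. exp (- (1 / s) * inverse (real n)) = flat_exp 0 (real n * s)"
      using eventually_gt_at_top[of 0]
      by eventually_elim (use that in \<open>simp add: flat_exp_def divide_inverse mult.commute\<close>)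
    ultimately show ?thesis
      by (rule Lim_transform_eventually)
  qed
  have "(\<lambda>n. box_bump a b n x) \<longlonglongrightarrow> (\<Prod>i\<in>(UNIV::'n set). 1 * 1)"
    unfolding box_bump_def
    using True by (intro tendsto_prod tendsto_mult lim) (auto simp: mem_box_cart)
  then show ?thesis using True by simp
qed (simp add: box_bump_eq_0)

lemma test_function_box_bump: "test_function (box_bump a b n :: real^'n \<Rightarrow> real)"
proof -
  have 1: "Ck k (\<lambda>x::real^'n. flat_exp 0 (real n * (x $ i - a $ i)))" for k i
    using Ck_flat_exp[of k 0 "real n" i "- (real n * a $ i)"] by (simp add: algebra_simps)
  have 2: "Ck k (\<lambda>x::real^'n. flat_exp 0 (real n * (b $ i - x $ i)))" for k i
    using Ck_flat_exp[of k 0 "- real n" i "real n * b $ i"] by (simp add: algebra_simps)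
  have "Ck k (box_bump a b n)" for k
    unfolding box_bump_def by (intro Ck_prod Ck_mult 1 2)
  moreover have "{x. box_bump a b n x \<noteq> 0} \<subseteq> box a b"
    using box_bump_eq_0[of _ a b n] by blast
  then have "bounded {x. box_bump a b n x \<noteq> 0}"
    by (rule bounded_subset[OF bounded_box])
  ultimately show ?thesis
    by (simp add: test_function_def)
qed

lemma test_function_translate:
  assumes "test_function \<eta>"
  shows "test_function (\<lambda>x. \<eta> (x - w))"
proof -
  have "bounded {x. \<eta> x \<noteq> 0}"
    using assms unfolding test_function_def
    by (metis bounded_subset closure_subset compact_imp_bounded)
  then have "bounded ((\<lambda>x. w + x) ` {x. \<eta> x \<noteq> 0})"
    by (rule bounded_translation)
  moreover have "{x. \<eta> (x - w) \<noteq> 0} \<subseteq> (\<lambda>x. w + x) ` {x. \<eta> x \<noteq> 0}"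
    by (force intro: image_eqI[where x="_ - w"])
  ultimately have "bounded {x. \<eta> (x - w) \<noteq> 0}"
    by (rule bounded_subset)
  then show ?thesis
    using assms by (auto simp: test_function_def Ck_translate)
qed

section \<open>Square integrable functions\<close>

text \<open>The definitions speak of \<open>lebesgue\<close>, while shifts and double integrals are
  carried out for Borel functions under \<open>lborel\<close>. The representative is found for each
  coordinate and reassembled in the basis.\<close>

lemma borel_representative:
  fixes f :: "'a::euclidean_space \<Rightarrow> 'b::euclidean_space"
  assumes "f \<in> borel_measurable lebesgue"
  obtains f' where "f' \<in> borel_measurable borel" and "AE x in lborel. f x = f' x"
proof -
  have "\<exists>g\<in>borel_measurable lborel. AE x in lborel. f x \<bullet> b = g x" for b
    by (rule completion_ex_borel_measurable_real) (use assms in measurable)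
  then have "\<forall>b. \<exists>g. g \<in> borel_measurable lborel \<and> (AE x in lborel. f x \<bullet> b = g x)"
    by blast
  then have "\<exists>g. \<forall>b. g b \<in> borel_measurable lborel \<and> (AE x in lborel. f x \<bullet> b = g b x)"
    by (rule choice)
  then obtain g where g: "\<And>b. g b \<in> borel_measurable lborel" "\<And>b. AE x in lborel. f x \<bullet> b = g b x"
    by blast
  have "AE x in lborel. \<forall>b\<in>Basis. f x \<bullet> b = g b x"
    by (rule AE_finite_allI) (use g(2) in auto)
  then have "AE x in lborel. f x = (\<Sum>b\<in>Basis. g b x *\<^sub>R b)"
  proof eventually_elim
    case (elim x)
    then have "(\<Sum>b\<in>Basis. g b x *\<^sub>R b) = (\<Sum>b\<in>Basis. (f x \<bullet> b) *\<^sub>R b)"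
      by simp
    then show ?case
      by (simp only: euclidean_representation)
  qed
  moreover have "(\<lambda>x. \<Sum>b\<in>Basis. g b x *\<^sub>R b) \<in> borel_measurable lborel"
    by (intro borel_measurable_sum borel_measurable_scaleR g(1) borel_measurable_const)
  ultimately show ?thesis
    using that by simp
qed

lemma square_integrable_cong:
  assumes "square_integrable f" and "AE x in lebesgue. f x = g x"
  shows "square_integrable g"
proof -
  have g: "g \<in> borel_measurable lebesgue"
    using assms borel_measurable_AE by (auto simp: square_integrable_def)
  show ?thesis
    unfolding square_integrable_def
  proof (intro conjI g)
    show "integrable lebesgue (\<lambda>x. (norm (g x))\<^sup>2)"
    proof (rule integrable_cong_AE_imp)
      show "integrable lebesgue (\<lambda>x. (norm (f x))\<^sup>2)"
        using assms(1) by (simp add: square_integrable_def)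
      show "(\<lambda>x. (norm (g x))\<^sup>2) \<in> borel_measurable lebesgue"
        using g by measurable
      show "AE x in lebesgue. (norm (f x))\<^sup>2 = (norm (g x))\<^sup>2"
        using assms(2) by eventually_elim simp
    qed
  qed
qed

lemma square_integrable_scaleR:
  "square_integrable f \<Longrightarrow> square_integrable (\<lambda>x. c *\<^sub>R f x)"
  by (auto simp: square_integrable_def power_mult_distrib)

lemma norm_add_squared_le: "(norm (a + b))\<^sup>2 \<le> 2 * (norm a)\<^sup>2 + 2 * (norm b)\<^sup>2"
proof -
  have "(norm (a + b))\<^sup>2 \<le> (norm a + norm b)\<^sup>2"
    by (intro power_mono norm_triangle_ineq) auto
  also have "\<dots> \<le> 2 * (norm a)\<^sup>2 + 2 * (norm b)\<^sup>2"
    using sum_squares_bound[of "norm a" "norm b"] by (simp add: power2_sum)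
  finally show ?thesis .
qed

lemma square_integrable_add:
  assumes "square_integrable f" and "square_integrable g"
  shows "square_integrable (\<lambda>x. f x + g x)"
  unfolding square_integrable_def
proof
  show m: "(\<lambda>x. f x + g x) \<in> borel_measurable lebesgue"
    using assms by (auto simp: square_integrable_def)
  show "integrable lebesgue (\<lambda>x. (norm (f x + g x))\<^sup>2)"
    by (rule Bochner_Integration.integrable_bound[of _ "\<lambda>x. 2 * (norm (f x))\<^sup>2 + 2 * (norm (g x))\<^sup>2"])
      (use assms m norm_add_squared_le in \<open>auto simp: square_integrable_def\<close>)
qed

lemma square_integrable_diff:
  assumes "square_integrable f" and "square_integrable g"
  shows "square_integrable (\<lambda>x. f x - g x)"
  using square_integrable_add[OF assms(1) square_integrable_scaleR[OF assms(2), of "-1"]] by simp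

lemma square_integrable_0: "square_integrable (\<lambda>x. 0)"
  by (simp add: square_integrable_def)

lemma square_integrable_bilinear:
  fixes pr :: "'a::euclidean_space \<Rightarrow> 'b::euclidean_space \<Rightarrow> 'c::{banach, second_countable_topology}"
  assumes "bounded_bilinear pr" and "square_integrable f" and "square_integrable g"
  shows "integrable lebesgue (\<lambda>x. pr (f x) (g x))"
proof -
  obtain K where K: "K \<ge> 0" "\<And>a b. norm (pr a b) \<le> norm a * norm b * K"
    using bounded_bilinear.nonneg_bounded[OF assms(1)] by blast
  have "norm (pr (f x) (g x)) \<le> K * (norm (f x))\<^sup>2 + K * (norm (g x))\<^sup>2" for x
  proof -
    have "norm (f x) * norm (g x) \<le> (norm (f x))\<^sup>2 + (norm (g x))\<^sup>2"
      using sum_squares_bound[of "norm (f x)" "norm (g x)"] mult_nonneg_nonneg[of "norm (f x)" "norm (g x)"]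
      by (simp del: mult_nonneg_nonneg)
    then have "K * (norm (f x) * norm (g x)) \<le> K * ((norm (f x))\<^sup>2 + (norm (g x))\<^sup>2)"
      using K(1) by (rule mult_left_mono)
    then show ?thesis
      using K(2)[of "f x" "g x"] by (simp add: algebra_simps)
  qed
  moreover have "(\<lambda>x. pr (f x) (g x)) \<in> borel_measurable lebesgue"
    using assms(2,3)
    by (intro borel_measurable_continuous_Pair[where H=pr] bounded_bilinear.continuous_on[OF assms(1)]
        continuous_on_fst continuous_on_snd continuous_on_id) (auto simp: square_integrable_def)
  moreover have "integrable lebesgue (\<lambda>x. K * (norm (f x))\<^sup>2 + K * (norm (g x))\<^sup>2)"
    using assms(2,3) by (simp add: square_integrable_def)
  moreover have "norm (pr (f x) (g x)) \<le> norm (K * (norm (f x))\<^sup>2 + K * (norm (g x))\<^sup>2)" for x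
    using calculation(1)[of x] by simp
  ultimately show ?thesis
    by (intro Bochner_Integration.integrable_bound[where g="\<lambda>x. pr (f x) (g x)"] AE_I2)
qed

lemma square_integrable_indicator:
  assumes "A \<in> sets lebesgue" and "emeasure lebesgue A < \<infinity>"
  shows "square_integrable (indicator A :: _ \<Rightarrow> real)"
proof -
  have "(\<lambda>x. (norm (indicator A x :: real))\<^sup>2) = indicator A"
    by (auto simp: indicator_def)
  then show ?thesis
    using assms by (simp add: square_integrable_def)
qed

lemma square_integrable_integrable_indicator:
  assumes "square_integrable f" and "bounded A" and "A \<in> sets lebesgue"
  shows "integrable lebesgue (\<lambda>x. indicator A x *\<^sub>R f x)"
proof (intro square_integrable_bilinear[OF bounded_bilinear_scaleR] square_integrable_indicator assms)
  show "emeasure lebesgue A < \<infinity>"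
    using fmeasurableD2[OF bounded_set_imp_lmeasurable[OF assms(2,3)]]
    by (simp add: less_top del: emeasure_completion)
qed

lemma square_integrable_borel:
  fixes f :: "real^'n \<Rightarrow> 'b::euclidean_space"
  assumes "f \<in> borel_measurable borel"
  shows "square_integrable f \<longleftrightarrow> integrable lborel (\<lambda>x. (norm (f x))\<^sup>2)"
proof -
  have "f \<in> borel_measurable lebesgue"
    by (rule measurable_completion) (simp add: assms)
  moreover have "integrable lebesgue (\<lambda>x. (norm (f x))\<^sup>2) \<longleftrightarrow> integrable lborel (\<lambda>x. (norm (f x))\<^sup>2)"
    by (rule integrable_completion) (use assms in measurable)
  ultimately show ?thesis
    by (simp add: square_integrable_def)
qed

section \<open>The fundamental lemma of the calculus of variations\<close>

lemma AE_zero_if_box_integrals_zero: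
  fixes h :: "'a::euclidean_space \<Rightarrow> 'b::euclidean_space"
  assumes int: "integrable lborel h" and zero: "integral\<^sup>L lborel h = 0"
    and box: "\<And>a b. (LINT x:box a b|lborel. h x) = 0"
  shows "AE x in lborel. h x = 0"
proof -
  have "(LINT x:A|lborel. h x) = 0" if "A \<in> sets borel" for A
  proof -
    \<comment> \<open>Dynkin argument: the open boxes form an intersection stable generator of the
      Borel sets, and the sets with vanishing integral are closed under disjoint unions and, because
      the total integral is 0, under complements.\<close>
    have "Int_stable (range (\<lambda>(a, b). box a b :: 'a set))"
      by (auto simp: Int_stable_def box_Int_box)
    moreover have "range (\<lambda>(a, b). box a b :: 'a set) \<subseteq> Pow UNIV" by simp
    moreover have "A \<in> sigma_sets UNIV (range (\<lambda>(a, b). box a b))"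
      using that by (simp add: borel_eq_box)
    ultimately show ?thesis
    proof (induction rule: sigma_sets_induct_disjoint)
      case (basic A)
      then show ?case using box by auto
    next
      case empty
      show ?case by (simp add: set_lebesgue_integral_def)
    next
      case (compl A)
      then have A: "A \<in> sets borel" by (simp add: borel_eq_box)
      have "(LINT x:UNIV - A|lborel. h x) = (\<integral>x. h x - indicator A x *\<^sub>R h x \<partial>lborel)"
        unfolding set_lebesgue_integral_def
        by (intro Bochner_Integration.integral_cong) (auto simp: indicator_def)
      also have "\<dots> = 0"
        using int integrable_mult_indicator[OF _ int, of A] A compl(2) zero
        by (simp add: set_lebesgue_integral_def)
      finally show ?case .
    next
      case (union A)
      have m: "A i \<in> sets borel" for i
        using union(2) by (auto simp: borel_eq_box)
      have "(LINT x:(\<Union>i. A i)|lborel. h x) = (\<Sum>i. LINT x:A i|lborel. h x)"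
        using union(1) m int
        by (intro lebesgue_integral_countable_add)
          (auto simp: disjoint_family_on_def set_integrable_def intro!: integrable_mult_indicator)
      then show ?case using union(3) by simp
    qed
  qed
  then show ?thesis
    using int by (intro sigma_finite_measure.density_zero[OF sigma_finite_lborel]) auto
qed

text \<open>Along \<open>box_bump\<close> dominated convergence turns testing with smooth functions
  into integration over boxes. A square integrable function is integrable on bounded sets but
  perhaps not on the whole space, so the density argument is applied to its restriction to each box;
  countably many centred boxes then exhaust the space.\<close>

lemma du_bois_reymond:
  fixes u :: "real^'n \<Rightarrow> complex"
  assumes u: "square_integrable u"
    and zero: "\<And>\<eta>. test_function \<eta> \<Longrightarrow> (LINT x|lebesgue. u x * of_real (\<eta> x)) = 0"
  shows "AE x in lebesgue. u x = 0"
proof -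
  obtain u' where u': "u' \<in> borel_measurable borel" "AE x in lborel. u x = u' x"
    using u borel_representative by (auto simp: square_integrable_def)
  have si: "square_integrable u'"
    using u u' by (auto intro: square_integrable_cong simp: AE_completion_iff)
  have int: "integrable lborel (\<lambda>x. indicator (box a b) x *\<^sub>R u' x)" for a b
  proof -
    have "integrable lebesgue (\<lambda>x. indicator (box a b) x *\<^sub>R u' x)"
      by (rule square_integrable_integrable_indicator[OF si bounded_box]) simp
    then show ?thesis
      by (subst (asm) integrable_completion) (use u'(1) in measurable)
  qed
  have zero_box: "(LINT x:box a b|lborel. u' x) = 0" for a b
  proof -
    have zero': "(LINT x|lborel. u' x * of_real (box_bump a b n x)) = 0" for n
    proof -
      have c: "continuous_on UNIV (box_bump a b n)"
        using test_function_box_bump Ck_imp_continuous[of 0] unfolding test_function_def by blast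
      have m: "box_bump a b n \<in> borel_measurable borel"
        using c by (rule borel_measurable_continuous_onI)
      have um: "u \<in> borel_measurable lebesgue" "u' \<in> borel_measurable lebesgue"
        using u si by (simp_all add: square_integrable_def)
      have bm: "box_bump a b n \<in> borel_measurable lebesgue"
        by (rule measurable_completion) (simp add: m)
      have "(LINT x|lborel. u' x * of_real (box_bump a b n x)) = (LINT x|lebesgue. u' x * of_real (box_bump a b n x))"
        by (rule integral_completion[symmetric]) (use m u'(1) in measurable)
      also have "\<dots> = (LINT x|lebesgue. u x * of_real (box_bump a b n x))"
      proof (rule integral_cong_AE)
        show "AE x in lebesgue. u' x * of_real (box_bump a b n x) = u x * of_real (box_bump a b n x)"
          using u'(2) unfolding AE_completion_iff by eventually_elim simp
      qed (use um bm in measurable)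
      finally show ?thesis
        using zero[OF test_function_box_bump] by simp
    qed
    have "(\<lambda>n. LINT x|lborel. u' x * of_real (box_bump a b n x)) \<longlonglongrightarrow> (LINT x|lborel. indicator (box a b) x *\<^sub>R u' x)"
    proof (rule integral_dominated_convergence[where w="\<lambda>x. norm (indicator (box a b) x *\<^sub>R u' x)"])
      have m: "box_bump a b n \<in> borel_measurable borel" for n
        using test_function_box_bump Ck_imp_continuous[of 0] unfolding test_function_def
        by (intro borel_measurable_continuous_onI) blast
      show "(\<lambda>x. u' x * of_real (box_bump a b n x)) \<in> borel_measurable lborel" for n
        using u'(1) m by simp
      have "(\<lambda>n. u' x * of_real (box_bump a b n x)) \<longlonglongrightarrow> u' x * of_real (indicator (box a b) x)" for x
        by (intro tendsto_intros tendsto_of_real box_bump_tendsto_indicator)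
      then show "AE x in lborel. (\<lambda>n. u' x * of_real (box_bump a b n x)) \<longlonglongrightarrow> indicator (box a b) x *\<^sub>R u' x"
        by (simp add: scaleR_conv_of_real mult.commute)
      show "AE x in lborel. norm (u' x * of_real (box_bump a b n x)) \<le> norm (indicator (box a b) x *\<^sub>R u' x)" for n
      proof (intro AE_I2)
        fix x
        show "norm (u' x * of_real (box_bump a b n x)) \<le> norm (indicator (box a b) x *\<^sub>R u' x)"
          using box_bump_bounds[of a b n x] box_bump_eq_0[of x a b n]
          by (cases "x \<in> box a b") (auto simp: norm_mult mult_left_le)
      qed
      show "integrable lborel (\<lambda>x. norm (indicator (box a b) x *\<^sub>R u' x))"
        using int by (rule integrable_norm)
    qed (use u'(1) in measurable)
    then show ?thesis
      using zero' by (simp add: set_lebesgue_integral_def LIMSEQ_const_iff)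
  qed
  have "AE x in lborel. indicator (box a b) x *\<^sub>R u' x = 0" for a b
  proof (rule AE_zero_if_box_integrals_zero[OF int])
    show "(LINT x|lborel. indicator (box a b) x *\<^sub>R u' x) = 0"
      using zero_box[of a b] by (simp add: set_lebesgue_integral_def)
    fix c d :: "real^'n"
    obtain e f where "box c d \<inter> box a b = box e f"
      using box_Int_box by blast
    then show "(LINT x:box c d|lborel. indicator (box a b) x *\<^sub>R u' x) = 0"
      using zero_box[of e f] by (simp add: set_lebesgue_integral_def flip: indicator_inter_arith)
  qed
  then have "AE x in lborel. \<forall>n::nat. indicator (box (- (real n *\<^sub>R One)) (real n *\<^sub>R One)) x *\<^sub>R u' x = 0"
    by (intro AE_all_countable[THEN iffD2] allI)
  then have "AE x in lborel. u' x = 0"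
  proof eventually_elim
    case (elim x)
    have "x \<in> (\<Union>n::nat. box (- (real n *\<^sub>R One)) (real n *\<^sub>R One))"
      unfolding UN_box_eq_UNIV by (rule UNIV_I)
    then obtain n :: nat where "x \<in> box (- (real n *\<^sub>R One)) (real n *\<^sub>R One)"
      by (rule UN_E)
    then show ?case
      using elim[rule_format, of n] by (simp only: indicator_simps scaleR_one)
  qed
  then show ?thesis
    using u'(2) by (auto simp: AE_completion_iff)
qed

section \<open>Squared norms, Cauchy-Schwarz and completeness of \<open>L^2\<close>\<close>

lemma square_integrable_measurable [measurable_dest]:
  "square_integrable f \<Longrightarrow> f \<in> borel_measurable lebesgue"
  by (simp add: square_integrable_def)

lemma square_integrable_norm: "square_integrable f \<Longrightarrow> square_integrable (\<lambda>x. norm (f x))"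
  by (auto simp: square_integrable_def)

definition L2sq :: "(real^'n \<Rightarrow> 'b::real_normed_vector) \<Rightarrow> real" where
  "L2sq f = (LINT x|lebesgue. (norm (f x))\<^sup>2)"

lemma L2sq_nonneg [simp]: "0 \<le> L2sq f"
  by (simp add: L2sq_def)

lemma L2sq_eq_0_iff:
  assumes "square_integrable f"
  shows "L2sq f = 0 \<longleftrightarrow> (AE x in lebesgue. f x = 0)"
  unfolding L2sq_def
  by (subst integral_nonneg_eq_0_iff_AE) (use assms in \<open>simp_all add: square_integrable_def\<close>)

lemma L2sq_cong_AE:
  assumes "square_integrable f" and "AE x in lebesgue. f x = g x"
  shows "L2sq f = L2sq g"
  unfolding L2sq_def
proof (rule integral_cong_AE)
  show "AE x in lebesgue. (norm (f x))\<^sup>2 = (norm (g x))\<^sup>2"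
    using assms(2) by eventually_elim simp
qed (use assms(1) square_integrable_cong[OF assms] in \<open>simp_all add: square_integrable_def borel_measurable_integrable\<close>)

lemma nn_integral_norm_squared:
  assumes "square_integrable f"
  shows "(\<integral>\<^sup>+x. ennreal ((norm (f x))\<^sup>2) \<partial>lebesgue) = ennreal (L2sq f)"
  using assms unfolding square_integrable_def L2sq_def
  by (intro nn_integral_eq_integral) simp_all

lemma square_integrable_norm_mult:
  assumes "square_integrable f" and "square_integrable g"
  shows "integrable lebesgue (\<lambda>x. norm (f x) * norm (g x))"
proof -
  show ?thesis
    by (rule square_integrable_bilinear[OF bounded_bilinear_mult assms[THEN square_integrable_norm]])
qed

lemma Cauchy_Schwarz_L2:
  assumes "square_integrable f" and "square_integrable g"
  shows "(LINT x|lebesgue. norm (f x) * norm (g x))\<^sup>2 \<le> L2sq f * L2sq g"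
proof -
  let ?f = "\<lambda>x. ennreal (norm (f x))" and ?g = "\<lambda>x. ennreal (norm (g x))"
  note [measurable] = assms[THEN square_integrable_measurable]
  have m: "?f \<in> borel_measurable lebesgue" "?g \<in> borel_measurable lebesgue"
    by measurable
  have "ennreal ((LINT x|lebesgue. norm (f x) * norm (g x))\<^sup>2) = (\<integral>\<^sup>+x. ?f x * ?g x \<partial>lebesgue)\<^sup>2"
  proof -
    have "(\<integral>\<^sup>+x. ?f x * ?g x \<partial>lebesgue) = (\<integral>\<^sup>+x. ennreal (norm (f x) * norm (g x)) \<partial>lebesgue)"
      by (simp add: ennreal_mult)
    also have "\<dots> = ennreal (LINT x|lebesgue. norm (f x) * norm (g x))"
      by (rule nn_integral_eq_integral[OF square_integrable_norm_mult[OF assms]]) simp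
    finally show ?thesis
      by (simp add: ennreal_power)
  qed
  also have "\<dots> \<le> (\<integral>\<^sup>+x. ?f x ^ 2 \<partial>lebesgue) * (\<integral>\<^sup>+x. ?g x ^ 2 \<partial>lebesgue)"
    by (rule Cauchy_Schwarz_nn_integral[OF m])
  also have "\<dots> = ennreal (L2sq f * L2sq g)"
    using nn_integral_norm_squared[OF assms(1)] nn_integral_norm_squared[OF assms(2)]
    by (simp add: ennreal_power ennreal_mult)
  finally show ?thesis
    by (simp add: ennreal_le_iff)
qed

lemma norm_integral_mult_le:
  fixes f g :: "real^'n \<Rightarrow> complex"
  assumes "square_integrable f" and "square_integrable g"
  shows "(norm (LINT x|lebesgue. f x * g x))\<^sup>2 \<le> L2sq f * L2sq g"
proof -
  have "norm (LINT x|lebesgue. f x * g x) \<le> (LINT x|lebesgue. norm (f x * g x))"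
    by (rule integral_norm_bound)
  then have "(norm (LINT x|lebesgue. f x * g x))\<^sup>2 \<le> (LINT x|lebesgue. norm (f x) * norm (g x))\<^sup>2"
    by (intro power_mono) (simp_all add: norm_mult)
  then show ?thesis
    using Cauchy_Schwarz_L2[OF assms] by linarith
qed

text \<open>Both completeness proofs below know the limit only pointwise along a subsequence. This
  form of Fatou's lemma transfers a uniform bound on the integrals to such a limit and yields its
  integrability at the same time.\<close>

lemma fatou_bounded:
  fixes g :: "nat \<Rightarrow> 'a \<Rightarrow> real"
  assumes g: "\<And>k. integrable M (g k)" "\<And>k x. 0 \<le> g k x"
    and C: "\<And>k. integral\<^sup>L M (g k) \<le> C"
    and lim: "AE x in M. (\<lambda>k. g k x) \<longlonglongrightarrow> h x"
    and h: "h \<in> borel_measurable M"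
  shows "integrable M h" and "integral\<^sup>L M h \<le> C"
proof -
  have C0: "0 \<le> C"
    by (rule order_trans[OF _ C[of 0]]) (simp add: g(2))
  have h0: "AE x in M. 0 \<le> h x"
    using lim by eventually_elim (rule LIMSEQ_le_const, assumption, use g(2) in blast)
  have "(\<integral>\<^sup>+x. ennreal (h x) \<partial>M) = (\<integral>\<^sup>+x. liminf (\<lambda>k. ennreal (g k x)) \<partial>M)"
  proof (rule nn_integral_cong_AE)
    show "AE x in M. ennreal (h x) = liminf (\<lambda>k. ennreal (g k x))"
      using lim
    proof eventually_elim
      case (elim x)
      then have "(\<lambda>k. ennreal (g k x)) \<longlonglongrightarrow> ennreal (h x)"
        by (rule tendsto_ennrealI)
      then show ?case
        by (simp add: lim_imp_Liminf)
    qed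
  qed
  also have "\<dots> \<le> liminf (\<lambda>k. \<integral>\<^sup>+x. ennreal (g k x) \<partial>M)"
    using g(1) by (intro nn_integral_liminf) simp
  also have "\<dots> \<le> ennreal C"
  proof (rule Liminf_le)
    show "\<forall>\<^sub>F k in sequentially. (\<integral>\<^sup>+x. ennreal (g k x) \<partial>M) \<le> ennreal C"
    proof (rule always_eventually, rule allI)
      fix k
      have "(\<integral>\<^sup>+x. ennreal (g k x) \<partial>M) = ennreal (integral\<^sup>L M (g k))"
        by (rule nn_integral_eq_integral) (simp_all add: g)
      then show "(\<integral>\<^sup>+x. ennreal (g k x) \<partial>M) \<le> ennreal C"
        using C[of k] by (simp add: ennreal_leI)
    qed
  qed simp
  finally have le: "(\<integral>\<^sup>+x. ennreal (h x) \<partial>M) \<le> ennreal C" .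
  then have "(\<integral>\<^sup>+x. ennreal (h x) \<partial>M) < \<infinity>"
    by (rule le_less_trans) simp
  then show int: "integrable M h"
    by (intro integrableI_nonneg h h0) simp_all
  show "integral\<^sup>L M h \<le> C"
    using le nn_integral_eq_integral[OF int h0] C0 by (simp add: ennreal_le_iff)
qed

text \<open>The subsequence is so sparse that the squared norm of its k-th increment is below 8^-k.
  Weighted with 4^k, the squared increments still have a finite total integral, so at almost every
  point 4^k times the squared increment is bounded, and the increments themselves decay like
  2^-k.\<close>

lemma L2_Cauchy_subseq_converges:
  fixes F :: "nat \<Rightarrow> real^'n \<Rightarrow> 'b::euclidean_space"
  assumes F: "\<And>n. square_integrable (F n)"
    and cauchy: "\<And>e. e > 0 \<Longrightarrow> \<exists>N. \<forall>m\<ge>N. \<forall>n\<ge>N. L2sq (\<lambda>x. F m x - F n x) < e"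
  obtains r where "strict_mono (r :: nat \<Rightarrow> nat)" and "AE x in lebesgue. convergent (\<lambda>k. F (r k) x)"
proof -
  have "\<exists>r. \<forall>k. (\<forall>m\<ge>r k. \<forall>n\<ge>r k. L2sq (\<lambda>x. F m x - F n x) < (1/8)^k) \<and> r k < r (Suc k)"
  proof (rule dependent_nat_choice)
    show "\<exists>x. \<forall>m\<ge>x. \<forall>n\<ge>x. L2sq (\<lambda>y. F m y - F n y) < (1/8)^0"
      using cauchy[of 1] by simp
  next
    fix x k
    obtain N where "\<forall>m\<ge>N. \<forall>n\<ge>N. L2sq (\<lambda>x. F m x - F n x) < (1/8)^Suc k"
      using cauchy[of "(1/8)^Suc k"] by auto
    then show "\<exists>y. (\<forall>m\<ge>y. \<forall>n\<ge>y. L2sq (\<lambda>x. F m x - F n x) < (1/8)^Suc k) \<and> x < y"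
      by (intro exI[of _ "max N (Suc x)"]) simp
  qed
  then obtain r where r: "\<And>k m n. m \<ge> r k \<Longrightarrow> n \<ge> r k \<Longrightarrow> L2sq (\<lambda>x. F m x - F n x) < (1/8)^k"
    and step: "\<And>k. r k < r (Suc k)"
    by blast
  have mono: "strict_mono r"
    using step by (rule strict_mono_Suc_iff[THEN iffD2, rule_format])
  define d where "d k x = F (r (Suc k)) x - F (r k) x" for k x
  have d: "square_integrable (d k)" for k
    unfolding d_def by (intro square_integrable_diff F)
  have dm: "(\<lambda>x. ennreal (4^k * (norm (d k x))\<^sup>2)) \<in> borel_measurable lebesgue" for k
    using d[of k] by (simp add: square_integrable_def borel_measurable_integrable)
  have dk: "(\<integral>\<^sup>+x. ennreal (4^k * (norm (d k x))\<^sup>2) \<partial>lebesgue) \<le> ennreal ((1/2)^k)" for k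
  proof -
    have "(\<integral>\<^sup>+x. ennreal (4^k * (norm (d k x))\<^sup>2) \<partial>lebesgue) = (\<integral>\<^sup>+x. ennreal (4^k) * ennreal ((norm (d k x))\<^sup>2) \<partial>lebesgue)"
      by (simp add: ennreal_mult)
    also have "\<dots> = ennreal (4^k) * ennreal (L2sq (d k))"
      using d[of k] by (subst nn_integral_cmult) (simp_all add: nn_integral_norm_squared square_integrable_def borel_measurable_integrable)
    also have "\<dots> \<le> ennreal (4^k) * ennreal ((1/8)^k)"
      using r[of k "r (Suc k)" "r k"] step[of k] unfolding d_def
      by (intro mult_left_mono ennreal_leI) simp_all
    also have "\<dots> = ennreal ((1/2)^k)"
      by (simp add: ennreal_mult[symmetric] power_mult_distrib[symmetric])
    finally show ?thesis .
  qed
  have "(\<integral>\<^sup>+x. (\<Sum>k. ennreal (4^k * (norm (d k x))\<^sup>2)) \<partial>lebesgue) = (\<Sum>k. \<integral>\<^sup>+x. ennreal (4^k * (norm (d k x))\<^sup>2) \<partial>lebesgue)"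
    by (rule nn_integral_suminf[OF dm])
  also have "\<dots> \<le> (\<Sum>k. ennreal ((1/2)^k))"
    by (intro suminf_le dk) simp_all
  also have "\<dots> = ennreal (\<Sum>k. (1/2)^k)"
    by (rule suminf_ennreal2) (simp_all add: summable_geometric)
  also have "\<dots> < \<infinity>"
    by (simp only: infinity_ennreal_def ennreal_less_top)
  finally have fin: "(\<integral>\<^sup>+x. (\<Sum>k. ennreal (4^k * (norm (d k x))\<^sup>2)) \<partial>lebesgue) \<noteq> \<infinity>"
    by simp
  have "AE x in lebesgue. (\<Sum>k. ennreal (4^k * (norm (d k x))\<^sup>2)) \<noteq> \<infinity>"
    by (rule nn_integral_noteq_infinite[OF _ fin]) (use dm in measurable)
  then have "AE x in lebesgue. convergent (\<lambda>k. F (r k) x)"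
  proof eventually_elim
    case (elim x)
    have "summable (\<lambda>k. 4^k * (norm (d k x))\<^sup>2)"
      by (rule summable_suminf_not_top) (use elim in simp_all)
    then have "Bseq (\<lambda>k. 4^k * (norm (d k x))\<^sup>2)"
      by (intro convergent_imp_Bseq convergentI[of _ 0] summable_LIMSEQ_zero)
    then obtain C where C: "C > 0" "\<And>k. 4^k * (norm (d k x))\<^sup>2 \<le> C"
      unfolding Bseq_def by (auto simp: abs_mult)
    have d_le: "norm (d k x) \<le> sqrt C * (1/2)^k" for k
    proof -
      have "(2^k * norm (d k x))\<^sup>2 \<le> C"
        using C(2)[of k] power_mult[of "2::real" 2 k] power_mult[of "2::real" k 2]
        by (simp add: power_mult_distrib mult.commute)
      then have "2^k * norm (d k x) \<le> sqrt C"
        by (rule real_le_rsqrt)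
      then show ?thesis
        by (simp add: power_divide field_simps)
    qed
    have "summable (\<lambda>k. sqrt C * (1/2)^k)"
      by (intro summable_mult summable_geometric) simp
    then have "summable (\<lambda>k. d k x)"
      by (rule summable_comparison_test'[where N=0]) (rule d_le)
    then have "convergent (\<lambda>n. F (r 0) x + (\<Sum>k<n. d k x))"
      by (intro convergent_add convergent_const) (simp add: summable_iff_convergent)
    moreover have "F (r 0) x + (\<Sum>k<n. d k x) = F (r n) x" for n
      unfolding d_def sum_lessThan_telescope[of "\<lambda>k. F (r k) x" n] by simp
    ultimately show ?case by simp
  qed
  with mono show ?thesis
    by (rule that)
qed

text \<open>Besides the norm limit, an almost everywhere convergent subsequence is returned, because
  the integral weighted with \<open>V\<close> is later passed to the limit pointwise.\<close>

lemma L2_complete: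
  fixes F :: "nat \<Rightarrow> real^'n \<Rightarrow> 'b::euclidean_space"
  assumes F: "\<And>n. square_integrable (F n)"
    and cauchy: "\<And>e. e > 0 \<Longrightarrow> \<exists>N. \<forall>m\<ge>N. \<forall>n\<ge>N. L2sq (\<lambda>x. F m x - F n x) < e"
  obtains f r where "square_integrable f" and "(\<lambda>n. L2sq (\<lambda>x. F n x - f x)) \<longlonglongrightarrow> 0"
    and "strict_mono (r :: nat \<Rightarrow> nat)" and "AE x in lebesgue. (\<lambda>k. F (r k) x) \<longlonglongrightarrow> f x"
proof -
  obtain r where r: "strict_mono (r :: nat \<Rightarrow> nat)" and conv: "AE x in lebesgue. convergent (\<lambda>k. F (r k) x)"
    using L2_Cauchy_subseq_converges[OF F cauchy] by blast
  define f where "f x = lim (\<lambda>k. F (r k) x)" for x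
  have lim: "AE x in lebesgue. (\<lambda>k. F (r k) x) \<longlonglongrightarrow> f x"
    using conv unfolding f_def by eventually_elim (simp add: convergent_LIMSEQ_iff)
  have Fm: "F n \<in> borel_measurable lebesgue" for n
    using F[of n] by (simp add: square_integrable_def)
  have fm: "f \<in> borel_measurable lebesgue"
    unfolding f_def by (rule borel_measurable_lim_metric[OF Fm])
  have bound: "square_integrable (\<lambda>x. F n x - f x) \<and> L2sq (\<lambda>x. F n x - f x) \<le> e"
    if N: "\<forall>m\<ge>N. \<forall>n\<ge>N. L2sq (\<lambda>x. F m x - F n x) < e" and n: "n \<ge> N" for N n e
  proof -
    \<comment> \<open>The index is shifted by \<open>N\<close> so that the bound holds for every
      \<open>k\<close>: a strictly increasing \<open>r\<close> satisfies
      \<open>k + N \<le> r (k + N)\<close>.\<close>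
    let ?g = "\<lambda>k x. (norm (F n x - F (r (k + N)) x))\<^sup>2"
    have int: "integrable lebesgue (?g k)" for k
      using square_integrable_diff[OF F F] by (simp add: square_integrable_def)
    have le: "integral\<^sup>L lebesgue (?g k) \<le> e" for k
    proof -
      have "k + N \<le> r (k + N)"
        using r by (rule seq_suble)
      then have "N \<le> r (k + N)" by linarith
      with N n have "L2sq (\<lambda>x. F n x - F (r (k + N)) x) < e"
        by blast
      then show ?thesis by (simp add: L2sq_def)
    qed
    have lim': "AE x in lebesgue. (\<lambda>k. ?g k x) \<longlonglongrightarrow> (norm (F n x - f x))\<^sup>2"
      using lim
    proof eventually_elim
      case (elim x)
      then show ?case
        by (intro tendsto_intros LIMSEQ_ignore_initial_segment[where f="\<lambda>k. F (r k) x"])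
    qed
    have m: "(\<lambda>x. F n x - f x) \<in> borel_measurable lebesgue"
      using fm Fm by measurable
    have m2: "(\<lambda>x. (norm (F n x - f x))\<^sup>2) \<in> borel_measurable lebesgue"
      using m by measurable
    show ?thesis
      unfolding square_integrable_def L2sq_def
      using fatou_bounded[of lebesgue ?g e, OF int _ le lim' m2] m by simp
  qed
  obtain N where N: "\<forall>m\<ge>N. \<forall>n\<ge>N. L2sq (\<lambda>x. F m x - F n x) < 1"
    using cauchy[of 1] by auto
  have f: "square_integrable f"
    using square_integrable_diff[OF F[of N] bound[OF N order_refl, THEN conjunct1]] by simp
  have "(\<lambda>n. L2sq (\<lambda>x. F n x - f x)) \<longlonglongrightarrow> 0"
  proof (rule LIMSEQ_I)
    fix e :: real
    assume "e > 0"
    then obtain N where N: "\<forall>m\<ge>N. \<forall>n\<ge>N. L2sq (\<lambda>x. F m x - F n x) < e / 2"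
      using cauchy[of "e/2"] by auto
    have "norm (L2sq (\<lambda>x. F n x - f x) - 0) < e" if "n \<ge> N" for n
    proof -
      have "L2sq (\<lambda>x. F n x - f x) \<le> e / 2"
        using bound[OF N that] by blast
      then show ?thesis
        using \<open>e > 0\<close> by simp
    qed
    then show "\<exists>N. \<forall>n\<ge>N. norm (L2sq (\<lambda>x. F n x - f x) - 0) < e"
      by blast
  qed
  with f r lim show ?thesis
    by (intro that)
qed

section \<open>Weak derivatives\<close>

lemma test_function_continuous: "test_function \<eta> \<Longrightarrow> continuous_on UNIV \<eta>"
  unfolding test_function_def by (metis Ck.simps(1))

lemma test_function_has_derivative:
  assumes "test_function \<eta>"
  shows "(\<eta> has_derivative frechet_derivative \<eta> (at x)) (at x)"
proof -
  have "Ck (Suc 0) \<eta>"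
    using assms by (simp only: test_function_def)
  then show ?thesis
    by (simp add: frechet_derivative_works)
qed

lemma continuous_test_function_derivative:
  assumes "test_function \<eta>"
  shows "continuous_on UNIV (\<lambda>x. frechet_derivative \<eta> (at x) v)"
proof -
  have "Ck (Suc 0) \<eta>"
    using assms by (simp only: test_function_def)
  then show ?thesis
    by simp
qed

lemma test_function_support:
  fixes \<eta> :: "real^'n \<Rightarrow> real"
  assumes "test_function \<eta>"
  obtains R where "\<And>x. R < norm x \<Longrightarrow> \<eta> x = 0"
    and "\<And>x v. R < norm x \<Longrightarrow> frechet_derivative \<eta> (at x) v = 0"
proof -
  have "bounded (closure {x. \<eta> x \<noteq> 0})"
    using assms compact_imp_bounded unfolding test_function_def by blast
  then obtain R where R: "\<And>x. x \<in> closure {x. \<eta> x \<noteq> 0} \<Longrightarrow> norm x \<le> R"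
    unfolding bounded_iff by blast
  have zero: "\<eta> x = 0" if "R < norm x" for x
    using R[of x] that closure_subset[of "{x. \<eta> x \<noteq> 0}"] by force
  have "frechet_derivative \<eta> (at x) v = 0" if x: "R < norm x" for x v
  proof -
    have "open {x :: real^'n. R < norm x}"
      by (intro open_Collect_less continuous_intros)
    moreover have "x \<in> {x. R < norm x}"
      using x by (rule CollectI)
    moreover have "0 = \<eta> y" if "y \<in> {x. R < norm x}" for y
      using zero[of y] CollectD[OF that] by metis
    ultimately have "(\<eta> has_derivative (\<lambda>v. 0)) (at x)"
      by (rule has_derivative_transform_within_open[OF has_derivative_const])
    then have "(\<lambda>v. 0) = frechet_derivative \<eta> (at x)"
      by (rule frechet_derivative_at)
    then show ?thesis by metis
  qed
  with zero show ?thesis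
    by (rule that)
qed

lemma compact_support_square_integrable:
  fixes \<psi> :: "real^'n \<Rightarrow> real"
  assumes "continuous_on UNIV \<psi>" and "\<And>x. R < norm x \<Longrightarrow> \<psi> x = 0"
  shows "square_integrable \<psi>"
proof -
  have m: "\<psi> \<in> borel_measurable borel"
    using assms(1) by (rule borel_measurable_continuous_onI)
  have "integrable lborel (\<lambda>x. indicator (cball 0 R) x *\<^sub>R (norm (\<psi> x))\<^sup>2)"
    by (intro borel_integrable_compact continuous_intros continuous_on_subset[OF assms(1)]) simp_all
  also have "(\<lambda>x. indicator (cball 0 R) x *\<^sub>R (norm (\<psi> x))\<^sup>2) = (\<lambda>x. (norm (\<psi> x))\<^sup>2)"
    using assms(2) by (auto simp: indicator_def fun_eq_iff not_le)
  finally show ?thesis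
    using square_integrable_borel[OF m] by blast
qed

lemma square_integrable_of_real:
  "square_integrable \<psi> \<Longrightarrow> square_integrable (\<lambda>x. of_real (\<psi> x) :: complex)"
  by (auto simp: square_integrable_def)

lemma square_integrable_cmult:
  fixes f :: "real^'n \<Rightarrow> complex"
  shows "square_integrable f \<Longrightarrow> square_integrable (\<lambda>x. c * f x)"
  by (auto simp: square_integrable_def norm_mult power_mult_distrib)

lemma test_function_square_integrable:
  fixes \<eta> :: "real^'n \<Rightarrow> real"
  assumes "test_function \<eta>"
  shows "square_integrable \<eta>" and "square_integrable (\<lambda>x. frechet_derivative \<eta> (at x) v)"
proof -
  obtain R where R: "\<And>x. R < norm x \<Longrightarrow> \<eta> x = 0"
    "\<And>x v. R < norm x \<Longrightarrow> frechet_derivative \<eta> (at x) v = 0"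
    using assms by (rule test_function_support) blast
  show "square_integrable \<eta>"
    using test_function_continuous[OF assms] R(1) by (rule compact_support_square_integrable)
  show "square_integrable (\<lambda>x. frechet_derivative \<eta> (at x) v)"
    using continuous_test_function_derivative[OF assms] R(2) by (rule compact_support_square_integrable)
qed

lemma integrable_mult_test_function:
  assumes "square_integrable f" and "test_function \<eta>"
  shows "integrable lebesgue (\<lambda>x. f x * complex_of_real (\<eta> x))"
    and "integrable lebesgue (\<lambda>x. f x * complex_of_real (frechet_derivative \<eta> (at x) v))"
  by (intro square_integrable_bilinear[OF bounded_bilinear_mult] assms square_integrable_of_real
      test_function_square_integrable)+

lemma weak_partial_lincomb:
  fixes f :: "real^'n \<Rightarrow> complex"
  assumes "square_integrable f" "square_integrable f'" "square_integrable g" "square_integrable g'"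
    and "weak_partial i f g" and "weak_partial i f' g'"
  shows "weak_partial i (\<lambda>x. c * f x + d * f' x) (\<lambda>x. c * g x + d * g' x)"
  unfolding weak_partial_def
proof (intro allI impI)
  fix \<eta> :: "real^'n \<Rightarrow> real"
  assume \<eta>: "test_function \<eta>"
  let ?D = "\<lambda>x. complex_of_real (frechet_derivative \<eta> (at x) (axis i 1))"
  have "(LINT x|lebesgue. (c * f x + d * f' x) * ?D x)
      = c * (LINT x|lebesgue. f x * ?D x) + d * (LINT x|lebesgue. f' x * ?D x)"
    using assms \<eta> by (simp add: distrib_right mult.assoc integrable_mult_test_function)
  also have "\<dots> = - (c * (LINT x|lebesgue. g x * of_real (\<eta> x)) + d * (LINT x|lebesgue. g' x * of_real (\<eta> x)))"
    using assms(5,6) \<eta> by (simp add: weak_partial_def)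
  also have "\<dots> = - (LINT x|lebesgue. (c * g x + d * g' x) * of_real (\<eta> x))"
    using assms \<eta> by (simp add: distrib_right mult.assoc integrable_mult_test_function)
  finally show "(LINT x|lebesgue. (c * f x + d * f' x) * ?D x)
      = - (LINT x|lebesgue. (c * g x + d * g' x) * of_real (\<eta> x))" .
qed

lemma weak_partial_unique:
  fixes f :: "real^'n \<Rightarrow> complex"
  assumes "square_integrable g" "square_integrable g'"
    and "weak_partial i f g" and "weak_partial i f g'"
  shows "AE x in lebesgue. g x = g' x"
proof -
  have "AE x in lebesgue. g x - g' x = 0"
  proof (rule du_bois_reymond)
    show "square_integrable (\<lambda>x. g x - g' x)"
      by (intro square_integrable_diff assms)
    fix \<eta> :: "real^'n \<Rightarrow> real"
    assume \<eta>: "test_function \<eta>"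
    then have "(LINT x|lebesgue. g x * of_real (\<eta> x)) = (LINT x|lebesgue. g' x * of_real (\<eta> x))"
      using assms(3,4) by (simp add: weak_partial_def)
    then show "(LINT x|lebesgue. (g x - g' x) * of_real (\<eta> x)) = 0"
      using assms \<eta> by (simp add: left_diff_distrib integrable_mult_test_function)
  qed
  then show ?thesis
    by eventually_elim simp
qed

lemma weak_partial_cong:
  assumes "square_integrable f" and "AE x in lebesgue. f x = f' x"
  shows "weak_partial i f g \<longleftrightarrow> weak_partial i f' g"
proof -
  have f': "square_integrable f'"
    using assms by (rule square_integrable_cong)
  have "(LINT x|lebesgue. f x * of_real (frechet_derivative \<eta> (at x) (axis i 1)))
      = (LINT x|lebesgue. f' x * of_real (frechet_derivative \<eta> (at x) (axis i 1)))"
    if \<eta>: "test_function \<eta>" for \<eta>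
  proof (rule integral_cong_AE)
    show "AE x in lebesgue. f x * of_real (frechet_derivative \<eta> (at x) (axis i 1))
        = f' x * of_real (frechet_derivative \<eta> (at x) (axis i 1))"
      using assms(2) by eventually_elim simp
  qed (intro borel_measurable_integrable integrable_mult_test_function assms(1) f' \<eta>)+
  then show ?thesis
    by (simp add: weak_partial_def)
qed

lemma H1_square_integrable: "f \<in> H1 \<Longrightarrow> square_integrable f"
  by (simp add: H1_def)

lemma wderiv:
  assumes "f \<in> H1"
  shows square_integrable_wderiv: "square_integrable (wderiv i f)"
    and weak_partial_wderiv: "weak_partial i f (wderiv i f)"
proof -
  have "\<exists>g. square_integrable g \<and> weak_partial i f g"
    using assms by (simp add: H1_def)
  then have "square_integrable (wderiv i f) \<and> weak_partial i f (wderiv i f)"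
    unfolding wderiv_def by (rule someI_ex)
  then show "square_integrable (wderiv i f)" "weak_partial i f (wderiv i f)"
    by blast+
qed

lemma wderiv_eqI:
  assumes "f \<in> H1" "square_integrable g" "weak_partial i f g"
  shows "AE x in lebesgue. wderiv i f x = g x"
  using assms wderiv[OF assms(1)] by (intro weak_partial_unique[where f=f and i=i])

lemma H1_cong:
  assumes "f \<in> H1" and "AE x in lebesgue. f x = f' x"
  shows "f' \<in> H1"
  using assms weak_partial_cong[OF H1_square_integrable[OF assms(1)] assms(2)]
    square_integrable_cong[OF H1_square_integrable[OF assms(1)] assms(2)]
  by (simp add: H1_def)

text \<open>This is equality of functions, not merely almost everywhere: the predicate from which
  the representative is chosen depends on \<open>f\<close> only up to null sets, so the same
  predicate yields the same choice.\<close>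

lemma wderiv_cong:
  assumes "f \<in> H1" and "AE x in lebesgue. f x = f' x"
  shows "wderiv i f = wderiv i f'"
  using weak_partial_cong[OF H1_square_integrable[OF assms(1)] assms(2)]
  by (simp add: wderiv_def)

lemma H1_lincomb:
  assumes "f \<in> H1" "g \<in> H1"
  shows "(\<lambda>x. c * f x + d * g x) \<in> H1"
    and "AE x in lebesgue. wderiv i (\<lambda>x. c * f x + d * g x) x = c * wderiv i f x + d * wderiv i g x"
proof -
  have wp: "weak_partial i (\<lambda>x. c * f x + d * g x) (\<lambda>x. c * wderiv i f x + d * wderiv i g x)" for i
    by (intro weak_partial_lincomb H1_square_integrable wderiv assms)
  have si: "square_integrable (\<lambda>x. c * wderiv i f x + d * wderiv i g x)" for i
    by (intro square_integrable_add square_integrable_cmult wderiv assms)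
  have "square_integrable (\<lambda>x. c * f x + d * g x)"
    by (intro square_integrable_add square_integrable_cmult H1_square_integrable assms)
  then show 1: "(\<lambda>x. c * f x + d * g x) \<in> H1"
    unfolding H1_def using wp si by blast
  show "AE x in lebesgue. wderiv i (\<lambda>x. c * f x + d * g x) x = c * wderiv i f x + d * wderiv i g x"
    by (rule wderiv_eqI[OF 1 si wp])
qed

lemma L2_limit_integral_mult:
  fixes F :: "nat \<Rightarrow> real^'n \<Rightarrow> complex"
  assumes "\<And>n. square_integrable (F n)" "square_integrable f" "square_integrable \<psi>"
    and "(\<lambda>n. L2sq (\<lambda>x. F n x - f x)) \<longlonglongrightarrow> 0"
  shows "(\<lambda>n. LINT x|lebesgue. F n x * \<psi> x) \<longlonglongrightarrow> (LINT x|lebesgue. f x * \<psi> x)"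
proof -
  note int = square_integrable_bilinear[OF bounded_bilinear_mult]
  have eq: "(LINT x|lebesgue. F n x * \<psi> x) - (LINT x|lebesgue. f x * \<psi> x) = (LINT x|lebesgue. (F n x - f x) * \<psi> x)" for n
    using int[OF assms(1,3)] int[OF assms(2,3)] by (simp add: left_diff_distrib)
  have "(\<lambda>n. (norm ((LINT x|lebesgue. F n x * \<psi> x) - (LINT x|lebesgue. f x * \<psi> x)))\<^sup>2) \<longlonglongrightarrow> 0"
  proof (rule real_tendsto_sandwich[where f="\<lambda>n. 0" and h="\<lambda>n. L2sq (\<lambda>x. F n x - f x) * L2sq \<psi>"])
    show "\<forall>\<^sub>F n in sequentially. (norm ((LINT x|lebesgue. F n x * \<psi> x) - (LINT x|lebesgue. f x * \<psi> x)))\<^sup>2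
        \<le> L2sq (\<lambda>x. F n x - f x) * L2sq \<psi>"
      unfolding eq
      by (intro always_eventually allI norm_integral_mult_le square_integrable_diff assms)
    show "(\<lambda>n. L2sq (\<lambda>x. F n x - f x) * L2sq \<psi>) \<longlonglongrightarrow> 0"
      using assms(4) by (rule tendsto_mult_left_zero)
  qed simp_all
  from tendsto_real_sqrt[OF this]
  have "(\<lambda>n. norm ((LINT x|lebesgue. F n x * \<psi> x) - (LINT x|lebesgue. f x * \<psi> x))) \<longlonglongrightarrow> 0"
    by simp
  then show ?thesis
    by (simp add: tendsto_norm_zero_iff LIM_zero_iff)
qed

text \<open>Each side of the defining identity is a pairing with a fixed square integrable function
  and therefore continuous in \<open>L^2\<close>. This closedness of the weak derivative is what
  makes the form domain complete.\<close>

lemma weak_partial_limit: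
  fixes F G :: "nat \<Rightarrow> real^'n \<Rightarrow> complex"
  assumes "\<And>n. square_integrable (F n)" "square_integrable f" "\<And>n. square_integrable (G n)" "square_integrable g"
    and "\<And>n. weak_partial i (F n) (G n)"
    and "(\<lambda>n. L2sq (\<lambda>x. F n x - f x)) \<longlonglongrightarrow> 0" "(\<lambda>n. L2sq (\<lambda>x. G n x - g x)) \<longlonglongrightarrow> 0"
  shows "weak_partial i f g"
  unfolding weak_partial_def
proof (intro allI impI)
  fix \<eta> :: "real^'n \<Rightarrow> real"
  assume \<eta>: "test_function \<eta>"
  note si = square_integrable_of_real[OF test_function_square_integrable(1)[OF \<eta>]]
    square_integrable_of_real[OF test_function_square_integrable(2)[OF \<eta>, of "axis i 1"]]
  have "(\<lambda>n. LINT x|lebesgue. F n x * of_real (frechet_derivative \<eta> (at x) (axis i 1)))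
      \<longlonglongrightarrow> (LINT x|lebesgue. f x * of_real (frechet_derivative \<eta> (at x) (axis i 1)))"
    by (rule L2_limit_integral_mult[OF assms(1,2) si(2) assms(6)])
  moreover have "(\<lambda>n. - (LINT x|lebesgue. G n x * of_real (\<eta> x))) \<longlonglongrightarrow> - (LINT x|lebesgue. g x * of_real (\<eta> x))"
    by (intro tendsto_minus L2_limit_integral_mult[OF assms(3,4) si(1) assms(7)])
  ultimately show "(LINT x|lebesgue. f x * of_real (frechet_derivative \<eta> (at x) (axis i 1)))
      = - (LINT x|lebesgue. g x * of_real (\<eta> x))"
    using assms(5) \<eta> LIMSEQ_unique by (simp add: weak_partial_def)
qed

section \<open>Translations of Sobolev functions\<close>

text \<open>Cauchy-Schwarz against the indicator of \<open>A\<close>. When the integrand is not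
  integrable the Bochner integral is 0 by convention and the bound is trivial. With \<open>A\<close>
  the unit interval or a grid cell this is Jensen's inequality for averages.\<close>

lemma norm_set_integral_squared_le:
  fixes f :: "'a \<Rightarrow> 'b::{banach, second_countable_topology}"
  assumes A [measurable]: "A \<in> sets M" and f [measurable]: "f \<in> borel_measurable M"
  shows "ennreal ((norm (\<integral>x. indicator A x *\<^sub>R f x \<partial>M))\<^sup>2)
    \<le> emeasure M A * (\<integral>\<^sup>+x. indicator A x * ennreal ((norm (f x))\<^sup>2) \<partial>M)"
proof (cases "integrable M (\<lambda>x. indicator A x *\<^sub>R f x)")
  case True
  let ?i = "\<lambda>x. indicator A x :: ennreal" and ?g = "\<lambda>x. indicator A x * ennreal (norm (f x))"
  have "ennreal (norm (\<integral>x. indicator A x *\<^sub>R f x \<partial>M)) \<le> (\<integral>\<^sup>+x. ennreal (norm (indicator A x *\<^sub>R f x)) \<partial>M)"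
    using True by (rule integral_norm_bound_ennreal)
  also have "\<dots> = (\<integral>\<^sup>+x. ?i x * ?g x \<partial>M)"
    by (intro nn_integral_cong) (simp split: split_indicator)
  finally have "(ennreal (norm (\<integral>x. indicator A x *\<^sub>R f x \<partial>M)))\<^sup>2 \<le> (\<integral>\<^sup>+x. ?i x * ?g x \<partial>M)\<^sup>2"
    by (rule power_mono) simp
  also have "\<dots> \<le> (\<integral>\<^sup>+x. ?i x ^ 2 \<partial>M) * (\<integral>\<^sup>+x. ?g x ^ 2 \<partial>M)"
    by (rule Cauchy_Schwarz_nn_integral) measurable
  also have "(\<integral>\<^sup>+x. ?i x ^ 2 \<partial>M) = emeasure M A"
  proof -
    have "(\<lambda>x. ?i x ^ 2) = indicator A"
      by (auto split: split_indicator)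
    then show ?thesis
      by simp
  qed
  also have "(\<integral>\<^sup>+x. ?g x ^ 2 \<partial>M) = (\<integral>\<^sup>+x. indicator A x * ennreal ((norm (f x))\<^sup>2) \<partial>M)"
    by (intro nn_integral_cong) (simp add: ennreal_power split: split_indicator)
  finally show ?thesis
    by (simp add: ennreal_power)
qed (simp add: not_integrable_integral_eq)

lemma lborel_shift:
  fixes f :: "'a::euclidean_space \<Rightarrow> 'b::{banach, second_countable_topology}" and w :: 'a
  assumes [measurable]: "f \<in> borel_measurable borel"
  shows lborel_integral_shift: "(\<integral>x. f (x + w) \<partial>lborel) = (\<integral>x. f x \<partial>lborel)"
    and lborel_integrable_shift: "integrable lborel (\<lambda>x. f (x + w)) \<longleftrightarrow> integrable lborel f"
proof -
  have "(\<integral>x. f (x + w) \<partial>lborel) = integral\<^sup>L (distr lborel borel ((+) w)) f"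
    by (subst integral_distr) (simp_all add: add.commute)
  then show "(\<integral>x. f (x + w) \<partial>lborel) = (\<integral>x. f x \<partial>lborel)"
    by (simp only: lborel_distr_plus)
  have "integrable lborel (\<lambda>x. f (x + w)) \<longleftrightarrow> integrable (distr lborel borel ((+) w)) f"
    by (subst integrable_distr_eq) (simp_all add: add.commute)
  then show "integrable lborel (\<lambda>x. f (x + w)) \<longleftrightarrow> integrable lborel f"
    by (simp only: lborel_distr_plus)
qed

lemma lborel_nn_integral_shift:
  fixes f :: "'a::euclidean_space \<Rightarrow> ennreal"
  assumes [measurable]: "f \<in> borel_measurable borel"
  shows "(\<integral>\<^sup>+x. f (x + w) \<partial>lborel) = (\<integral>\<^sup>+x. f x \<partial>lborel)"
proof -
  have "(\<integral>\<^sup>+x. f (x + w) \<partial>lborel) = nn_integral (distr lborel borel ((+) w)) f"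
    by (subst nn_integral_distr) (simp_all add: add.commute)
  then show ?thesis
    by (simp only: lborel_distr_plus)
qed

lemma L2sq_lborel: "f \<in> borel_measurable borel \<Longrightarrow> L2sq f = (LINT x|lborel. (norm (f x))\<^sup>2)"
  unfolding L2sq_def by (rule integral_completion) measurable

lemma square_integrable_shift:
  fixes f :: "real^'n \<Rightarrow> 'b::euclidean_space"
  assumes f [measurable]: "f \<in> borel_measurable borel" and si: "square_integrable f"
  shows "square_integrable (\<lambda>x. f (x + w))" and "L2sq (\<lambda>x. f (x + w)) = L2sq f"
proof -
  have m: "(\<lambda>x. f (x + w)) \<in> borel_measurable borel"
    by measurable
  show "square_integrable (\<lambda>x. f (x + w))"
    using si lborel_integrable_shift[of "\<lambda>x. (norm (f x))\<^sup>2" w]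
    unfolding square_integrable_borel[OF f] square_integrable_borel[OF m] by simp
  show "L2sq (\<lambda>x. f (x + w)) = L2sq f"
    using lborel_integral_shift[of "\<lambda>x. (norm (f x))\<^sup>2" w] unfolding L2sq_lborel[OF f] L2sq_lborel[OF m] by simp
qed

lemma nn_integral_norm_squared_lborel:
  assumes "f \<in> borel_measurable borel" "square_integrable f"
  shows "(\<integral>\<^sup>+x. ennreal ((norm (f x))\<^sup>2) \<partial>lborel) = ennreal (L2sq f)"
  using nn_integral_norm_squared[OF assms(2)] by (simp add: nn_integral_completion)

text \<open>This justifies exchanging the integrals over \<open>s\<close> and \<open>x\<close>: for
  each \<open>s\<close> the inner integral is at most \<open>sqrt (L2sq a * L2sq b)\<close>, a bound
  independent of the shift, and \<open>s\<close> ranges over the unit interval.\<close>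

lemma integrable_pair_shift:
  fixes a b :: "real^'n \<Rightarrow> complex"
  assumes a [measurable]: "a \<in> borel_measurable borel" and sa: "square_integrable a"
    and b [measurable]: "b \<in> borel_measurable borel" and sb: "square_integrable b"
  shows "integrable (lborel \<Otimes>\<^sub>M lborel) (\<lambda>(s, x). indicator {0..1::real} s *\<^sub>R (a x * b (x + s *\<^sub>R v)))"
proof (rule lborel_pair.Fubini_integrable)
  have [measurable]: "(\<lambda>z::real \<times> (real^'n). snd z + fst z *\<^sub>R v) \<in> borel_measurable (lborel \<Otimes>\<^sub>M lborel)"
    unfolding lborel_prod by (simp, intro borel_measurable_continuous_onI continuous_intros)
  show m: "(\<lambda>(s, x). indicator {0..1::real} s *\<^sub>R (a x * b (x + s *\<^sub>R v))) \<in> borel_measurable (lborel \<Otimes>\<^sub>M lborel)"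
    unfolding case_prod_beta by measurable
  have int: "integrable lborel (\<lambda>x. a x * b (x + s *\<^sub>R v))" for s
  proof -
    have "integrable lebesgue (\<lambda>x. a x * b (x + s *\<^sub>R v))"
      by (intro square_integrable_bilinear[OF bounded_bilinear_mult] sa square_integrable_shift b sb)
    then show ?thesis
      by (subst (asm) integrable_completion) measurable
  qed
  have le: "(LINT x|lborel. norm (a x * b (x + s *\<^sub>R v))) \<le> sqrt (L2sq a * L2sq b)" for s
  proof -
    have "(LINT x|lborel. norm (a x * b (x + s *\<^sub>R v))) = (LINT x|lebesgue. norm (a x) * norm (b (x + s *\<^sub>R v)))"
      unfolding norm_mult by (rule integral_completion[symmetric]) measurable
    also have "(LINT x|lebesgue. norm (a x) * norm (b (x + s *\<^sub>R v)))\<^sup>2 \<le> L2sq a * L2sq (\<lambda>x. b (x + s *\<^sub>R v))"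
      by (intro Cauchy_Schwarz_L2 sa square_integrable_shift b sb)
    ultimately show ?thesis
      by (simp add: square_integrable_shift(2)[OF b sb] real_le_rsqrt)
  qed
  show "AE s in lborel. integrable lborel (\<lambda>x. case (s, x) of (s, x) \<Rightarrow> indicator {0..1::real} s *\<^sub>R (a x * b (x + s *\<^sub>R v)))"
    using int by simp
  show "integrable lborel (\<lambda>s. LINT x|lborel. norm (case (s, x) of (s, x) \<Rightarrow> indicator {0..1::real} s *\<^sub>R (a x * b (x + s *\<^sub>R v))))"
  proof (rule Bochner_Integration.integrable_bound[where f="\<lambda>s. indicator {0..1} s *\<^sub>R sqrt (L2sq a * L2sq b)"])
    show "integrable lborel (\<lambda>s::real. indicator {0..1} s *\<^sub>R sqrt (L2sq a * L2sq b))"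
      by (intro integrable_scaleR_left) simp
    show "(\<lambda>s. LINT x|lborel. norm (case (s, x) of (s, x) \<Rightarrow> indicator {0..1::real} s *\<^sub>R (a x * b (x + s *\<^sub>R v)))) \<in> borel_measurable lborel"
      using m by (intro lborel.borel_measurable_lebesgue_integral) measurable
    show "AE s in lborel. norm (LINT x|lborel. norm (case (s, x) of (s, x) \<Rightarrow> indicator {0..1::real} s *\<^sub>R (a x * b (x + s *\<^sub>R v))))
        \<le> norm (indicator {0..1} s *\<^sub>R sqrt (L2sq a * L2sq b))"
    proof (rule AE_I2)
      fix s :: real
      have "0 \<le> (LINT x|lborel. norm (a x * b (x + s *\<^sub>R v)))"
        by (rule integral_nonneg_AE) simp
      then show "norm (LINT x|lborel. norm (case (s, x) of (s, x) \<Rightarrow> indicator {0..1::real} s *\<^sub>R (a x * b (x + s *\<^sub>R v))))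
        \<le> norm (indicator {0..1} s *\<^sub>R sqrt (L2sq a * L2sq b))"
        using le[of s] by (cases "s \<in> {0..1}") simp_all
    qed
  qed
qed

lemma directional_derivative_axis:
  fixes \<eta> :: "real^'n \<Rightarrow> real"
  assumes "test_function \<eta>"
  shows "frechet_derivative \<eta> (at x) v = (\<Sum>i\<in>UNIV. v $ i * frechet_derivative \<eta> (at x) (axis i 1))"
proof -
  have "bounded_linear (frechet_derivative \<eta> (at x))"
    using test_function_has_derivative[OF assms] by (rule has_derivative_bounded_linear)
  then interpret bounded_linear "frechet_derivative \<eta> (at x)" .
  have "frechet_derivative \<eta> (at x) v = frechet_derivative \<eta> (at x) (\<Sum>i\<in>UNIV. v $ i *\<^sub>R axis i 1)"
    by (simp only: basis_expansion scalar_mult_eq_scaleR[symmetric])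
  then show ?thesis
    by (simp add: sum scaleR)
qed

lemma test_function_increment:
  fixes \<eta> :: "real^'n \<Rightarrow> real"
  assumes "test_function \<eta>"
  shows "\<eta> (x - v) - \<eta> x = - (\<integral>s. indicator {0..1} s *\<^sub>R frechet_derivative \<eta> (at (x - s *\<^sub>R v)) v \<partial>lborel)"
proof -
  have "(\<integral>s. indicator {0..1} s *\<^sub>R - frechet_derivative \<eta> (at (x - s *\<^sub>R v)) v \<partial>lborel)
      = \<eta> (x - 1 *\<^sub>R v) - \<eta> (x - 0 *\<^sub>R v)"
  proof (rule integral_FTC_Icc)
    fix s :: real
    have "((\<lambda>s. \<eta> (x - s *\<^sub>R v)) has_derivative (\<lambda>t. frechet_derivative \<eta> (at (x - s *\<^sub>R v)) (- (t *\<^sub>R v)))) (at s within {0..1})"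
      by (rule has_derivative_compose[OF _ test_function_has_derivative[OF assms]])
        (auto intro!: derivative_eq_intros)
    moreover have "frechet_derivative \<eta> (at (x - s *\<^sub>R v)) (- (t *\<^sub>R v)) = t *\<^sub>R - frechet_derivative \<eta> (at (x - s *\<^sub>R v)) v" for t
      using linear_scale[OF has_derivative_linear[OF test_function_has_derivative[OF assms]], of "x - s *\<^sub>R v" "- t" v]
      by simp
    ultimately show "((\<lambda>s. \<eta> (x - s *\<^sub>R v)) has_vector_derivative - frechet_derivative \<eta> (at (x - s *\<^sub>R v)) v) (at s within {0..1})"
      unfolding has_vector_derivative_def by simp
  next
    show "continuous_on {0..1} (\<lambda>s. - frechet_derivative \<eta> (at (x - s *\<^sub>R v)) v)"
      by (intro continuous_on_minus continuous_on_compose2[OF continuous_test_function_derivative[OF assms]] continuous_intros) simp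
  qed simp
  then show ?thesis
    by simp
qed

lemma frechet_derivative_translate:
  fixes \<eta> :: "real^'n \<Rightarrow> real"
  assumes "test_function \<eta>"
  shows "frechet_derivative (\<lambda>x. \<eta> (x - w)) (at x) = frechet_derivative \<eta> (at (x - w))"
  by (rule frechet_derivative_at[OF has_derivative_translate[where D="\<lambda>x. frechet_derivative \<eta> (at x)", OF
          test_function_has_derivative[OF assms]], symmetric])

lemma weak_directional_derivative:
  fixes f :: "real^'n \<Rightarrow> complex"
  assumes f: "square_integrable f"
    and g: "\<And>i. square_integrable (g i)" "\<And>i. weak_partial i f (g i)"
    and \<eta>: "test_function \<eta>"
  shows "(LINT x|lebesgue. f x * of_real (frechet_derivative \<eta> (at x) v))
    = - (LINT x|lebesgue. (\<Sum>i\<in>UNIV. of_real (v $ i) * g i x) * of_real (\<eta> x))"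
proof -
  have "(LINT x|lebesgue. f x * of_real (frechet_derivative \<eta> (at x) v))
      = (LINT x|lebesgue. (\<Sum>i\<in>UNIV. of_real (v $ i) * (f x * of_real (frechet_derivative \<eta> (at x) (axis i 1)))))"
    unfolding directional_derivative_axis[OF \<eta>, of _ v] by (simp add: sum_distrib_left ac_simps)
  also have "\<dots> = (\<Sum>i\<in>UNIV. of_real (v $ i) * (LINT x|lebesgue. f x * of_real (frechet_derivative \<eta> (at x) (axis i 1))))"
    by (subst Bochner_Integration.integral_sum) (simp_all add: integrable_mult_test_function f \<eta>)
  also have "\<dots> = (\<Sum>i\<in>UNIV. of_real (v $ i) * - (LINT x|lebesgue. g i x * of_real (\<eta> x)))"
    using g(2) \<eta> by (simp add: weak_partial_def)
  also have "\<dots> = - (\<Sum>i\<in>UNIV. (LINT x|lebesgue. of_real (v $ i) * (g i x * of_real (\<eta> x))))"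
    by (simp add: sum_negf)
  also have "(\<Sum>i\<in>UNIV. (LINT x|lebesgue. of_real (v $ i) * (g i x * of_real (\<eta> x))))
      = (LINT x|lebesgue. (\<Sum>i\<in>UNIV. of_real (v $ i) * (g i x * of_real (\<eta> x))))"
    by (subst Bochner_Integration.integral_sum) (simp_all add: integrable_mult_test_function g(1) \<eta>)
  finally show ?thesis
    by (simp add: sum_distrib_right mult.assoc)
qed

section \<open>Increments as segment averages of the weak gradient\<close>

lemma borel_measurable_pair_shift [measurable]:
  fixes v :: "'a::euclidean_space"
  shows "(\<lambda>z::real \<times> 'a. snd z + fst z *\<^sub>R v) \<in> borel_measurable (lborel \<Otimes>\<^sub>M lborel)"
    and "(\<lambda>z::'a \<times> real. fst z + snd z *\<^sub>R v) \<in> borel_measurable (lborel \<Otimes>\<^sub>M lborel)"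
  unfolding lborel_prod by (simp_all, (intro borel_measurable_continuous_onI continuous_intros)+)

text \<open>Jensen's inequality over the unit interval, Tonelli, and translation invariance:
  averaging translates of a function along a segment does not increase its \<open>L^2\<close>
  norm.\<close>

lemma square_integrable_segment_average:
  fixes G :: "real^'n \<Rightarrow> complex" and v :: "real^'n"
  assumes m [measurable]: "G \<in> borel_measurable borel" and si: "square_integrable G"
  defines "F \<equiv> \<lambda>x. \<integral>s. indicator {0..1::real} s *\<^sub>R G (x + s *\<^sub>R v) \<partial>lborel"
  shows "F \<in> borel_measurable borel" and "square_integrable F" and "L2sq F \<le> L2sq G"
proof -
  have "(\<lambda>(x, s). indicator {0..1::real} s *\<^sub>R G (x + s *\<^sub>R v)) \<in> borel_measurable (lborel \<Otimes>\<^sub>M lborel)"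
    unfolding case_prod_beta by measurable
  then have "F \<in> borel_measurable lborel"
    unfolding F_def by (rule lborel.borel_measurable_lebesgue_integral)
  then show mF: "F \<in> borel_measurable borel"
    by simp
  have "(\<integral>\<^sup>+x. ennreal ((norm (F x))\<^sup>2) \<partial>lborel)
      \<le> (\<integral>\<^sup>+x. \<integral>\<^sup>+s. indicator {0..1::real} s * ennreal ((norm (G (x + s *\<^sub>R v)))\<^sup>2) \<partial>lborel \<partial>lborel)"
  proof (rule nn_integral_mono)
    fix x
    show "ennreal ((norm (F x))\<^sup>2) \<le> (\<integral>\<^sup>+s. indicator {0..1::real} s * ennreal ((norm (G (x + s *\<^sub>R v)))\<^sup>2) \<partial>lborel)"
      using norm_set_integral_squared_le[of "{0..1::real}" lborel "\<lambda>s. G (x + s *\<^sub>R v)"] unfolding F_def by simp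
  qed
  also have "\<dots> = (\<integral>\<^sup>+s. \<integral>\<^sup>+x. indicator {0..1::real} s * ennreal ((norm (G (x + s *\<^sub>R v)))\<^sup>2) \<partial>lborel \<partial>lborel)"
    by (rule lborel_pair.Fubini'[symmetric]) (unfold case_prod_beta, measurable)
  also have "\<dots> = (\<integral>\<^sup>+s. indicator {0..1::real} s * ennreal (L2sq G) \<partial>lborel)"
  proof (rule nn_integral_cong)
    fix s :: real
    have "(\<integral>\<^sup>+x. ennreal ((norm (G (x + s *\<^sub>R v)))\<^sup>2) \<partial>lborel) = ennreal (L2sq G)"
      using lborel_nn_integral_shift[of "\<lambda>x. ennreal ((norm (G x))\<^sup>2)" "s *\<^sub>R v"]
      by (simp add: nn_integral_norm_squared_lborel[OF m si])
    then show "(\<integral>\<^sup>+x. indicator {0..1::real} s * ennreal ((norm (G (x + s *\<^sub>R v)))\<^sup>2) \<partial>lborel) = indicator {0..1} s * ennreal (L2sq G)"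
      by (subst nn_integral_cmult) simp_all
  qed
  also have "\<dots> = ennreal (L2sq G)"
    by (subst nn_integral_multc) simp_all
  finally have le: "(\<integral>\<^sup>+x. ennreal ((norm (F x))\<^sup>2) \<partial>lborel) \<le> ennreal (L2sq G)" .
  have "integrable lborel (\<lambda>x. (norm (F x))\<^sup>2)"
  proof (rule integrableI_nonneg)
    show "(\<integral>\<^sup>+x. ennreal ((norm (F x))\<^sup>2) \<partial>lborel) < \<infinity>"
      using le by (rule le_less_trans) simp
  qed (use mF in \<open>simp_all, measurable\<close>)
  then show sF: "square_integrable F"
    by (simp add: square_integrable_borel[OF mF])
  show "L2sq F \<le> L2sq G"
    using le nn_integral_norm_squared_lborel[OF mF sF] by simp
qed

text \<open>The fundamental theorem of calculus is applied to the smooth \<open>\<eta>\<close>,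
  where it is classical. After exchanging the integrals, the weak identity for the translated test
  function moves the derivative onto \<open>f\<close>, and a change of variables returns the shift
  from \<open>\<eta>\<close> to \<open>G\<close>.\<close>

lemma translation_increment_tested:
  fixes f :: "real^'n \<Rightarrow> complex" and v :: "real^'n"
  assumes f [measurable]: "f \<in> borel_measurable borel" and sf: "square_integrable f"
    and G [measurable]: "G \<in> borel_measurable borel" and sG: "square_integrable G"
    and weak: "\<And>\<eta>. test_function \<eta> \<Longrightarrow>
      (LINT x|lebesgue. f x * of_real (frechet_derivative \<eta> (at x) v)) = - (LINT x|lebesgue. G x * of_real (\<eta> x))"
    and \<eta>: "test_function \<eta>"
  defines "F \<equiv> \<lambda>x. \<integral>s. indicator {0..1::real} s *\<^sub>R G (x + s *\<^sub>R v) \<partial>lborel"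
  shows "(LINT x|lborel. f x * of_real (\<eta> (x - v) - \<eta> x)) = (LINT x|lborel. F x * of_real (\<eta> x))"
proof -
  let ?D = "\<lambda>x. complex_of_real (frechet_derivative \<eta> (at x) v)" and ?e = "\<lambda>x. complex_of_real (\<eta> x)"
  have [measurable]: "\<eta> \<in> borel_measurable borel" "(\<lambda>x. frechet_derivative \<eta> (at x) v) \<in> borel_measurable borel"
    by (intro borel_measurable_continuous_onI test_function_continuous continuous_test_function_derivative \<eta>)+
  have mD: "?D \<in> borel_measurable borel" and me: "?e \<in> borel_measurable borel"
    by measurable
  have sD: "square_integrable ?D" and se: "square_integrable ?e"
    by (intro square_integrable_of_real test_function_square_integrable \<eta>)+
  have "(LINT x|lborel. f x * of_real (\<eta> (x - v) - \<eta> x))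
      = - (LINT x|lborel. LINT s|lborel. indicator {0..1::real} s *\<^sub>R (f x * ?D (x + s *\<^sub>R (- v))))"
  proof -
    have "f x * of_real (\<eta> (x - v) - \<eta> x) = - (LINT s|lborel. indicator {0..1::real} s *\<^sub>R (f x * ?D (x + s *\<^sub>R (- v))))" for x
    proof -
      have "complex_of_real (\<integral>s. indicator {0..1} s *\<^sub>R frechet_derivative \<eta> (at (x - s *\<^sub>R v)) v \<partial>lborel)
          = (\<integral>s. indicator {0..1} s *\<^sub>R ?D (x - s *\<^sub>R v) \<partial>lborel)"
        by (simp add: integral_complex_of_real[symmetric] scaleR_conv_of_real del: integral_complex_of_real)
      then show ?thesis
        unfolding test_function_increment[OF \<eta>]
        by (simp add: integral_mult_right_zero[symmetric] del: integral_mult_right_zero integral_mult_right)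
    qed
    then show ?thesis
      by simp
  qed
  also have "(LINT x|lborel. LINT s|lborel. indicator {0..1::real} s *\<^sub>R (f x * ?D (x + s *\<^sub>R (- v))))
      = (LINT s|lborel. LINT x|lborel. indicator {0..1::real} s *\<^sub>R (f x * ?D (x + s *\<^sub>R (- v))))"
    by (rule lborel_pair.Fubini_integral[OF integrable_pair_shift[OF f sf mD sD]])
  also have "\<dots> = (LINT s|lborel. - (LINT x|lborel. indicator {0..1::real} s *\<^sub>R (?e x * G (x + s *\<^sub>R v))))"
  proof (rule Bochner_Integration.integral_cong[OF refl])
    fix s :: real
    have \<eta>s: "test_function (\<lambda>x. \<eta> (x - s *\<^sub>R v))"
      using \<eta> by (rule test_function_translate)
    have "(LINT x|lborel. f x * ?D (x + s *\<^sub>R (- v))) = (LINT x|lebesgue. f x * ?D (x - s *\<^sub>R v))"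
      by (simp add: integral_completion)
    also have "\<dots> = - (LINT x|lebesgue. G x * ?e (x - s *\<^sub>R v))"
      using weak[OF \<eta>s] by (simp add: frechet_derivative_translate[OF \<eta>])
    also have "(LINT x|lebesgue. G x * ?e (x - s *\<^sub>R v)) = (LINT x|lborel. G x * ?e (x - s *\<^sub>R v))"
      by (rule integral_completion) measurable
    also have "\<dots> = (LINT x|lborel. ?e x * G (x + s *\<^sub>R v))"
      using lborel_integral_shift[of "\<lambda>x. G x * ?e (x - s *\<^sub>R v)" "s *\<^sub>R v"]
      by (simp add: mult.commute)
    finally show "(LINT x|lborel. indicator {0..1::real} s *\<^sub>R (f x * ?D (x + s *\<^sub>R (- v))))
        = - (LINT x|lborel. indicator {0..1::real} s *\<^sub>R (?e x * G (x + s *\<^sub>R v)))"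
      by simp
  qed
  also have "\<dots> = - (LINT s|lborel. LINT x|lborel. indicator {0..1::real} s *\<^sub>R (?e x * G (x + s *\<^sub>R v)))"
    by (rule Bochner_Integration.integral_minus)
  also have "(LINT s|lborel. LINT x|lborel. indicator {0..1::real} s *\<^sub>R (?e x * G (x + s *\<^sub>R v)))
      = (LINT x|lborel. LINT s|lborel. indicator {0..1::real} s *\<^sub>R (?e x * G (x + s *\<^sub>R v)))"
    by (rule lborel_pair.Fubini_integral[OF integrable_pair_shift[OF me se G sG], symmetric])
  also have "\<dots> = (LINT x|lborel. F x * ?e x)"
  proof (rule Bochner_Integration.integral_cong[OF refl])
    fix x
    have "(LINT s|lborel. indicator {0..1::real} s *\<^sub>R (?e x * G (x + s *\<^sub>R v)))
        = (LINT s|lborel. ?e x * (indicator {0..1::real} s *\<^sub>R G (x + s *\<^sub>R v)))"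
      by simp
    also have "\<dots> = ?e x * F x"
      unfolding F_def by (rule integral_mult_right_zero)
    finally show "(LINT s|lborel. indicator {0..1::real} s *\<^sub>R (?e x * G (x + s *\<^sub>R v))) = F x * ?e x"
      by (simp add: mult.commute)
  qed
  finally show ?thesis
    by simp
qed

text \<open>A fundamental theorem of calculus for weak directional derivatives: the increment and
  the segment average of \<open>G\<close> have the same pairing with every test function.\<close>

lemma translation_increment:
  fixes f :: "real^'n \<Rightarrow> complex" and v :: "real^'n"
  assumes f [measurable]: "f \<in> borel_measurable borel" and sf: "square_integrable f"
    and G [measurable]: "G \<in> borel_measurable borel" and sG: "square_integrable G"
    and weak: "\<And>\<eta>. test_function \<eta> \<Longrightarrow>
      (LINT x|lebesgue. f x * of_real (frechet_derivative \<eta> (at x) v)) = - (LINT x|lebesgue. G x * of_real (\<eta> x))"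
  defines "F \<equiv> \<lambda>x. \<integral>s. indicator {0..1::real} s *\<^sub>R G (x + s *\<^sub>R v) \<partial>lborel"
  shows "AE x in lebesgue. f (x + v) - f x = F x"
proof -
  note F = square_integrable_segment_average[OF G sG, of v, folded F_def]
  note [measurable] = F(1)
  note sfv = square_integrable_shift(1)[OF f sf, of v]
  have "AE x in lebesgue. f (x + v) - f x - F x = 0"
  proof (rule du_bois_reymond)
    show "square_integrable (\<lambda>x. f (x + v) - f x - F x)"
      by (intro square_integrable_diff sfv sf F)
    fix \<eta> :: "real^'n \<Rightarrow> real"
    assume \<eta>: "test_function \<eta>"
    have [measurable]: "\<eta> \<in> borel_measurable borel"
      by (intro borel_measurable_continuous_onI test_function_continuous \<eta>)
    have int: "integrable lborel (\<lambda>x. h x * complex_of_real (\<psi> x))"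
      if "h \<in> borel_measurable borel" "square_integrable h" "test_function \<psi>" for h and \<psi> :: "real^'n \<Rightarrow> real"
    proof -
      have [measurable]: "\<psi> \<in> borel_measurable borel"
        by (intro borel_measurable_continuous_onI test_function_continuous that)
      note [measurable] = that(1)
      show ?thesis
        using integrable_mult_test_function(1)[OF that(2,3)]
        by (subst (asm) integrable_completion) measurable
    qed
    have "(LINT x|lebesgue. (f (x + v) - f x - F x) * of_real (\<eta> x)) = (LINT x|lborel. (f (x + v) - f x - F x) * of_real (\<eta> x))"
      by (rule integral_completion) measurable
    also have "\<dots> = (LINT x|lborel. f (x + v) * of_real (\<eta> x)) - (LINT x|lborel. f x * of_real (\<eta> x)) - (LINT x|lborel. F x * of_real (\<eta> x))"
      using int[OF f sf \<eta>] int[OF F(1,2) \<eta>] int[OF _ sfv \<eta>] by (simp add: left_diff_distrib)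
    also have "(LINT x|lborel. f (x + v) * of_real (\<eta> x)) = (LINT x|lborel. f x * of_real (\<eta> (x - v)))"
      using lborel_integral_shift[of "\<lambda>x. f x * complex_of_real (\<eta> (x - v))" v] by simp
    also have "(LINT x|lborel. f x * of_real (\<eta> (x - v))) - (LINT x|lborel. f x * of_real (\<eta> x))
        = (LINT x|lborel. f x * of_real (\<eta> (x - v) - \<eta> x))"
      using int[OF f sf \<eta>] int[OF f sf test_function_translate[OF \<eta>, of v]] by (simp add: right_diff_distrib)
    also have "\<dots> = (LINT x|lborel. F x * of_real (\<eta> x))"
      unfolding F_def by (rule translation_increment_tested[OF f sf G sG weak \<eta>])
    finally show "(LINT x|lebesgue. (f (x + v) - f x - F x) * of_real (\<eta> x)) = 0"
      by simp
  qed
  then show ?thesis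
    by eventually_elim simp
qed

lemma norm_sum_mult_squared_le:
  fixes z :: "'n::finite \<Rightarrow> complex" and v :: "real^'n"
  shows "(norm (\<Sum>i\<in>UNIV. of_real (v $ i) * z i))\<^sup>2 \<le> (norm v)\<^sup>2 * (\<Sum>i\<in>UNIV. (norm (z i))\<^sup>2)"
proof -
  have "norm (\<Sum>i\<in>UNIV. of_real (v $ i) * z i) \<le> (\<Sum>i\<in>UNIV. \<bar>v $ i\<bar> * norm (z i))"
    by (rule order_trans[OF norm_sum]) (simp add: norm_mult)
  then have "(norm (\<Sum>i\<in>UNIV. of_real (v $ i) * z i))\<^sup>2 \<le> (\<Sum>i\<in>UNIV. \<bar>v $ i\<bar> * norm (z i))\<^sup>2"
    by (rule power_mono) simp
  also have "\<dots> \<le> (\<Sum>i\<in>UNIV. \<bar>v $ i\<bar>\<^sup>2) * (\<Sum>i\<in>UNIV. (norm (z i))\<^sup>2)"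
    by (rule Cauchy_Schwarz_ineq_sum)
  also have "(\<Sum>i\<in>UNIV. \<bar>v $ i\<bar>\<^sup>2) = (norm v)\<^sup>2"
    by (simp add: norm_vec_def L2_set_def sum_nonneg)
  finally show ?thesis .
qed

text \<open>With \<open>G\<close> the directional derivative of \<open>f\<close> along
  \<open>v\<close>, the increment is a segment average of \<open>G\<close>, so its norm is at most
  that of \<open>G\<close>; Cauchy-Schwarz in the coordinates of \<open>v\<close> gives the factor
  \<open>(norm v)\<^sup>2\<close>. The shift is applied to a Borel representative since the integral
  is over \<open>lborel\<close>.\<close>

lemma H1_translation_bound:
  fixes f :: "real^'n \<Rightarrow> complex"
  assumes H: "f \<in> H1" and f' [measurable]: "f' \<in> borel_measurable borel" and ae: "AE x in lborel. f x = f' x"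
  shows "(\<integral>\<^sup>+x. ennreal ((norm (f' (x + v) - f' x))\<^sup>2) \<partial>lborel) \<le> ennreal ((norm v)\<^sup>2 * (\<Sum>i\<in>UNIV. L2sq (wderiv i f)))"
proof -
  have "\<forall>i. \<exists>g. g \<in> borel_measurable borel \<and> (AE x in lborel. wderiv i f x = g x)"
  proof
    fix i
    obtain g where "g \<in> borel_measurable borel" "AE x in lborel. wderiv i f x = g x"
      by (rule borel_representative[OF square_integrable_measurable[OF square_integrable_wderiv[OF H]]])
    then show "\<exists>g. g \<in> borel_measurable borel \<and> (AE x in lborel. wderiv i f x = g x)"
      by blast
  qed
  from choice[OF this] obtain g where mg [measurable]: "\<And>i. g i \<in> borel_measurable borel"
    and g: "\<And>i. AE x in lborel. wderiv i f x = g i x"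
    by blast
  have g': "AE x in lebesgue. wderiv i f x = g i x" for i
    using g by (rule AE_completion)
  have sg: "square_integrable (g i)" for i
    using square_integrable_wderiv[OF H] g' by (rule square_integrable_cong)
  have ae': "AE x in lebesgue. f x = f' x"
    using ae by (rule AE_completion)
  have sf': "square_integrable f'"
    using H1_square_integrable[OF H] ae' by (rule square_integrable_cong)
  have wp: "weak_partial i f' (g i)" for i
  proof -
    have "weak_partial i f (g i)"
      unfolding weak_partial_def
    proof (intro allI impI)
      fix \<eta> :: "real^'n \<Rightarrow> real"
      assume \<eta>: "test_function \<eta>"
      have "(LINT x|lebesgue. wderiv i f x * of_real (\<eta> x)) = (LINT x|lebesgue. g i x * of_real (\<eta> x))"
      proof (rule integral_cong_AE)
        show "AE x in lebesgue. wderiv i f x * complex_of_real (\<eta> x) = g i x * complex_of_real (\<eta> x)"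
          using g'[of i] by eventually_elim simp
      qed (intro borel_measurable_integrable integrable_mult_test_function sg \<eta> square_integrable_wderiv H)+
      then show "(LINT x|lebesgue. f x * of_real (frechet_derivative \<eta> (at x) (axis i 1))) = - (LINT x|lebesgue. g i x * of_real (\<eta> x))"
        using weak_partial_wderiv[OF H, of i] \<eta> by (simp add: weak_partial_def)
    qed
    then show ?thesis
      using weak_partial_cong[OF H1_square_integrable[OF H] ae'] by blast
  qed
  define G where "G x = (\<Sum>i\<in>UNIV. of_real (v $ i) * g i x)" for x
  have mG [measurable]: "G \<in> borel_measurable borel"
    unfolding G_def by measurable
  have le: "(norm (G x))\<^sup>2 \<le> (norm v)\<^sup>2 * (\<Sum>i\<in>UNIV. (norm (g i x))\<^sup>2)" for x
    unfolding G_def by (rule norm_sum_mult_squared_le)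
  have ig: "integrable lebesgue (\<lambda>x. (norm v)\<^sup>2 * (\<Sum>i\<in>UNIV. (norm (g i x))\<^sup>2))"
    using sg by (intro integrable_mult_right Bochner_Integration.integrable_sum) (simp add: square_integrable_def)
  have iG: "integrable lebesgue (\<lambda>x. (norm (G x))\<^sup>2)"
  proof (rule Bochner_Integration.integrable_bound[OF ig])
    show "(\<lambda>x. (norm (G x))\<^sup>2) \<in> borel_measurable lebesgue"
      by (rule measurable_completion) measurable
    show "AE x in lebesgue. norm ((norm (G x))\<^sup>2) \<le> norm ((norm v)\<^sup>2 * (\<Sum>i\<in>UNIV. (norm (g i x))\<^sup>2))"
      using order_trans[OF le abs_ge_self] by simp
  qed
  have sG: "square_integrable G"
    unfolding square_integrable_def using iG measurable_completion[of G lborel borel] by simp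
  have "L2sq G \<le> (LINT x|lebesgue. (norm v)\<^sup>2 * (\<Sum>i\<in>UNIV. (norm (g i x))\<^sup>2))"
    unfolding L2sq_def using iG ig le by (rule integral_mono)
  also have "\<dots> = (norm v)\<^sup>2 * (\<Sum>i\<in>UNIV. L2sq (g i))"
    using sg by (simp add: L2sq_def square_integrable_def Bochner_Integration.integral_sum)
  also have "(\<Sum>i\<in>UNIV. L2sq (g i)) = (\<Sum>i\<in>UNIV. L2sq (wderiv i f))"
    using L2sq_cong_AE[OF square_integrable_wderiv[OF H] g'] by simp
  finally have LG: "L2sq G \<le> (norm v)\<^sup>2 * (\<Sum>i\<in>UNIV. L2sq (wderiv i f))" .
  define F where "F x = (\<integral>s. indicator {0..1::real} s *\<^sub>R G (x + s *\<^sub>R v) \<partial>lborel)" for x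
  note F = square_integrable_segment_average[OF mG sG, of v, folded F_def]
  have "AE x in lebesgue. f' (x + v) - f' x = F x"
    unfolding F_def
  proof (rule translation_increment[OF f' sf' mG sG])
    fix \<eta> :: "real^'n \<Rightarrow> real"
    assume "test_function \<eta>"
    then show "(LINT x|lebesgue. f' x * of_real (frechet_derivative \<eta> (at x) v)) = - (LINT x|lebesgue. G x * of_real (\<eta> x))"
      unfolding G_def by (rule weak_directional_derivative[OF sf' sg wp])
  qed
  then have "(\<integral>\<^sup>+x. ennreal ((norm (f' (x + v) - f' x))\<^sup>2) \<partial>lborel) = (\<integral>\<^sup>+x. ennreal ((norm (F x))\<^sup>2) \<partial>lborel)"
    unfolding AE_completion_iff by (intro nn_integral_cong_AE) (elim eventually_mono, simp)
  also have "\<dots> = ennreal (L2sq F)"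
    using F by (intro nn_integral_norm_squared_lborel)
  also have "\<dots> \<le> ennreal ((norm v)\<^sup>2 * (\<Sum>i\<in>UNIV. L2sq (wderiv i f)))"
    using F(3) LG by (intro ennreal_leI) linarith
  finally show ?thesis .
qed

section \<open>Averages over grid cells\<close>

text \<open>A Lipschitz bound for translations in \<open>L^2\<close>, with \<open>T\<close> in the
  place of the Dirichlet integral. Through it the grid estimates of this section are free of
  derivatives.\<close>

definition translation_modulus :: "(real^'n \<Rightarrow> 'b::euclidean_space) \<Rightarrow> real \<Rightarrow> bool" where
  "translation_modulus f T \<longleftrightarrow> f \<in> borel_measurable borel \<and> square_integrable f \<and> 0 \<le> T \<and>
    (\<forall>v. (\<integral>\<^sup>+x. ennreal ((norm (f (x + v) - f x))\<^sup>2) \<partial>lborel) \<le> ennreal ((norm v)\<^sup>2 * T))"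

text \<open>For \<open>h > 0\<close> this is the half-open grid cube of side \<open>h\<close> that
  contains \<open>x\<close>. Encoding it by equality of floors makes membership an equivalence
  relation, so the cells partition the space without exceptional boundary points.\<close>

definition cell :: "real \<Rightarrow> real^'n \<Rightarrow> (real^'n) set" where
  "cell h x = {y. \<forall>i. \<lfloor>x $ i / h\<rfloor> = \<lfloor>y $ i / h\<rfloor>}"

text \<open>The conditional expectation of \<open>f\<close> on the grid of mesh \<open>h\<close>:
  \<open>h ^ CARD('n)\<close> is the volume of a cell, and the value is constant on each
  cell.\<close>

definition cell_average :: "real \<Rightarrow> (real^'n \<Rightarrow> 'b::euclidean_space) \<Rightarrow> real^'n \<Rightarrow> 'b" where
  "cell_average h f x = (1 / h ^ CARD('n)) *\<^sub>R (\<integral>y. indicator (cell h x) y *\<^sub>R f y \<partial>lborel)"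

lemma cell_eq: "y \<in> cell h x \<Longrightarrow> cell h y = cell h x"
  by (auto simp: cell_def)

lemma borel_measurable_vec_nth_compose [measurable]:
  fixes f :: "'a \<Rightarrow> real^'n"
  assumes "f \<in> borel_measurable M"
  shows "(\<lambda>x. f x $ i) \<in> borel_measurable M"
  by (rule measurable_compose[OF assms borel_measurable_continuous_onI[OF linear_continuous_on[OF bounded_linear_vec_nth]]])

lemma mem_cell_measurable [measurable]:
  "Measurable.pred (borel \<Otimes>\<^sub>M borel) (\<lambda>z. snd z \<in> cell h (fst z :: real^'n))"
proof -
  have "(\<lambda>z. snd z \<in> cell h (fst z)) = (\<lambda>z. \<forall>i. real_of_int \<lfloor>fst z $ i / h\<rfloor> = real_of_int \<lfloor>snd z $ i / h\<rfloor>)"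
    by (simp add: cell_def)
  also have "Measurable.pred (borel \<Otimes>\<^sub>M borel) \<dots>"
  proof -
    have "{z \<in> space (borel \<Otimes>\<^sub>M borel). real_of_int \<lfloor>fst z $ i / h\<rfloor> = real_of_int \<lfloor>snd z $ i / h\<rfloor>}
        \<in> sets (borel \<Otimes>\<^sub>M borel :: ((real^'n) \<times> (real^'n)) measure)" for i
      by (rule borel_measurable_eq) measurable
    then have "{z \<in> space (borel \<Otimes>\<^sub>M borel). \<forall>i\<in>UNIV. real_of_int \<lfloor>fst z $ i / h\<rfloor> = real_of_int \<lfloor>snd z $ i / h\<rfloor>}
        \<in> sets (borel \<Otimes>\<^sub>M borel :: ((real^'n) \<times> (real^'n)) measure)"
      by (intro sets.sets_Collect_finite_All) simp_all
    then show ?thesis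
      by (simp add: pred_def)
  qed
  finally show ?thesis .
qed

lemma cell_borel [measurable]: "cell h x \<in> sets borel"
proof -
  have "{y. snd (x, y) \<in> cell h (fst (x, y))} \<in> sets borel"
    by measurable
  then show ?thesis by simp
qed

lemma norm_le_card:
  fixes x :: "real^'n" and h :: real
  assumes "\<And>i. \<bar>x $ i\<bar> \<le> h"
  shows "norm x \<le> CARD('n) * h"
  using norm_le_l1_cart[of x] sum_bounded_above[of UNIV "\<lambda>i. \<bar>x $ i\<bar>" h] assms by simp

lemma cell_norm_diff:
  fixes x :: "real^'n" and h :: real
  assumes "h > 0" "y \<in> cell h x"
  shows "norm (y - x) \<le> CARD('n) * h"
proof (rule norm_le_card)
  fix i
  have "\<lfloor>x $ i / h\<rfloor> = \<lfloor>y $ i / h\<rfloor>"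
    using assms(2) by (simp add: cell_def)
  then have "\<bar>y $ i / h - x $ i / h\<bar> \<le> 1"
    by linarith
  then show "\<bar>(y - x) $ i\<bar> \<le> h"
    using assms(1) by (simp add: diff_divide_distrib[symmetric] field_simps)
qed

lemma emeasure_lborel_cube:
  fixes a :: "real^'n"
  assumes "s \<ge> 0"
  shows "emeasure lborel (cbox a (a + (\<chi> i. s))) = ennreal (s ^ CARD('n))"
    and "emeasure lborel (box a (a + (\<chi> i. s))) = ennreal (s ^ CARD('n))"
proof -
  have inner: "(\<chi> i. s) \<bullet> b = s" if "b \<in> Basis" for b :: "real^'n"
    using that by (auto simp: Basis_vec_def inner_axis)
  have prod: "(\<Prod>b\<in>(Basis :: (real^'n) set). (a + (\<chi> i. s) - a) \<bullet> b) = s ^ CARD('n)"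
    using inner by simp
  have le: "a \<bullet> b \<le> (a + (\<chi> i. s)) \<bullet> b" if "b \<in> Basis" for b
    using inner[OF that] assms by (simp add: inner_add_left)
  show "emeasure lborel (cbox a (a + (\<chi> i. s))) = ennreal (s ^ CARD('n))"
    using emeasure_lborel_cbox[OF le] prod by simp
  show "emeasure lborel (box a (a + (\<chi> i. s))) = ennreal (s ^ CARD('n))"
    using emeasure_lborel_box[OF le] prod by simp
qed

text \<open>The half-open cube lies between an open and a closed cube of the same volume.\<close>

lemma emeasure_cell:
  fixes x :: "real^'n"
  assumes h: "h > 0"
  shows "emeasure lborel (cell h x) = ennreal (h ^ CARD('n))"
proof -
  define a where "a = (\<chi> i. h * \<lfloor>x $ i / h\<rfloor>)"
  have floor: "\<lfloor>y $ i / h\<rfloor> = \<lfloor>x $ i / h\<rfloor> \<longleftrightarrow> a $ i \<le> y $ i \<and> y $ i < a $ i + h" for y :: "real^'n" and i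
    using h by (simp add: floor_eq_iff a_def field_simps)
  have "cell h x \<subseteq> cbox a (a + (\<chi> i. h))"
    using floor by (auto simp: cell_def mem_box_cart eq_commute[of "\<lfloor>x $ _ / h\<rfloor>"] less_imp_le)
  then have "emeasure lborel (cell h x) \<le> emeasure lborel (cbox a (a + (\<chi> i. h)))"
    by (intro emeasure_mono) simp_all
  moreover have "box a (a + (\<chi> i. h)) \<subseteq> cell h x"
    using floor by (auto simp: cell_def mem_box_cart eq_commute[of "\<lfloor>x $ _ / h\<rfloor>"] less_imp_le)
  then have "emeasure lborel (box a (a + (\<chi> i. h))) \<le> emeasure lborel (cell h x)"
    by (intro emeasure_mono) simp_all
  ultimately show ?thesis
    using h by (simp add: emeasure_lborel_cube)
qed

section \<open>Mean square and supremum estimates for cell averages\<close>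

lemma integrable_cell:
  fixes f :: "real^'n \<Rightarrow> 'b::euclidean_space"
  assumes f: "f \<in> borel_measurable borel" and sf: "square_integrable f" and h: "h > 0"
  shows "integrable lborel (\<lambda>y. indicator (cell h x) y *\<^sub>R f y)"
proof -
  have "square_integrable (indicator (cell h x) :: _ \<Rightarrow> real)"
    using emeasure_cell[OF h, of x] by (intro square_integrable_indicator) simp_all
  then have "integrable lebesgue (\<lambda>y. indicator (cell h x) y *\<^sub>R f y)"
    by (rule square_integrable_bilinear[OF bounded_bilinear_scaleR _ sf])
  then show ?thesis
    by (subst (asm) integrable_completion) (use f in measurable)
qed

lemma cell_average_measurable [measurable]:
  assumes [measurable]: "f \<in> borel_measurable borel"
  shows "cell_average h f \<in> borel_measurable borel"
proof -
  have "(\<lambda>(x, y). indicator (cell h x) y *\<^sub>R f y) = (\<lambda>z. (if snd z \<in> cell h (fst z) then f (snd z) else 0))"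
    by (auto simp: fun_eq_iff)
  also have "\<dots> \<in> borel_measurable (borel \<Otimes>\<^sub>M borel)"
    by measurable
  finally have "(\<lambda>(x, y). indicator (cell h x) y *\<^sub>R f y) \<in> borel_measurable (borel \<Otimes>\<^sub>M lborel)"
    by (simp cong: measurable_cong_sets)
  then have "(\<lambda>x. \<integral>y. indicator (cell h x) y *\<^sub>R f y \<partial>lborel) \<in> borel_measurable borel"
    by (rule lborel.borel_measurable_lebesgue_integral)
  then show ?thesis
    unfolding cell_average_def by measurable
qed

text \<open>Averaging commutes with subtracting a constant, after which this is Jensen's inequality
  on the cell. The free \<open>c\<close> is taken as \<open>f x\<close> for the averaging error, as
  another average or a value of \<open>f\<close> when two meshes are compared, and as 0 for plain
  bounds.\<close>

lemma cell_average_diff_squared_le: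
  fixes f :: "real^'n \<Rightarrow> 'b::euclidean_space"
  assumes f [measurable]: "f \<in> borel_measurable borel" and sf: "square_integrable f" and h: "h > 0"
  shows "ennreal ((norm (cell_average h f x - c))\<^sup>2)
    \<le> ennreal (1 / h ^ CARD('n)) * (\<integral>\<^sup>+y. indicator (cell h x) y * ennreal ((norm (f y - c))\<^sup>2) \<partial>lborel)"
proof -
  let ?m = "h ^ CARD('n)"
  have m: "?m > 0" using h by simp
  have int: "integrable lborel (\<lambda>y. indicator (cell h x) y :: real)"
    using emeasure_cell[OF h, of x] by (intro integrable_real_indicator) simp_all
  have "(\<integral>y. indicator (cell h x) y *\<^sub>R (f y - c) \<partial>lborel)
      = (\<integral>y. indicator (cell h x) y *\<^sub>R f y \<partial>lborel) - (\<integral>y. indicator (cell h x) y *\<^sub>R c \<partial>lborel)"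
    unfolding scaleR_diff_right
    by (intro Bochner_Integration.integral_diff integrable_cell f sf h integrable_scaleR_left int)
  also have "(\<integral>y. indicator (cell h x) y *\<^sub>R c \<partial>lborel) = ?m *\<^sub>R c"
    using int emeasure_cell[OF h, of x] m by (subst integral_scaleR_left) (simp_all add: measure_def)
  finally have "cell_average h f x - c = (1 / ?m) *\<^sub>R (\<integral>y. indicator (cell h x) y *\<^sub>R (f y - c) \<partial>lborel)"
    using m h by (simp add: cell_average_def scaleR_diff_right)
  then have "ennreal ((norm (cell_average h f x - c))\<^sup>2)
      = ennreal ((1 / ?m)\<^sup>2) * ennreal ((norm (\<integral>y. indicator (cell h x) y *\<^sub>R (f y - c) \<partial>lborel))\<^sup>2)"
    by (simp add: power_mult_distrib power_divide ennreal_mult[symmetric])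
  also have "\<dots> \<le> ennreal ((1 / ?m)\<^sup>2) * (emeasure lborel (cell h x) *
      (\<integral>\<^sup>+y. indicator (cell h x) y * ennreal ((norm (f y - c))\<^sup>2) \<partial>lborel))"
    by (intro mult_left_mono norm_set_integral_squared_le) (simp_all, measurable)
  also have "\<dots> = (ennreal ((1 / ?m)\<^sup>2) * ennreal ?m) *
      (\<integral>\<^sup>+y. indicator (cell h x) y * ennreal ((norm (f y - c))\<^sup>2) \<partial>lborel)"
    by (simp add: emeasure_cell[OF h] mult.assoc)
  also have "ennreal ((1 / ?m)\<^sup>2) * ennreal ?m = ennreal (1 / ?m)"
    using m by (simp add: ennreal_mult[symmetric] power2_eq_square)
  finally show ?thesis .
qed

text \<open>Substituting y = x + v and exchanging the integrals leaves the translation bound for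
  each \<open>v\<close> of norm at most \<open>r\<close>. The factor
  \<open>(2 * r) ^ CARD('n)\<close> is the volume of the cube around the ball of radius
  \<open>r\<close>.\<close>

lemma translation_modulus_pairs:
  fixes f :: "real^'n \<Rightarrow> 'b::euclidean_space"
  assumes tm: "translation_modulus f T" and r: "r \<ge> 0"
  shows "(\<integral>\<^sup>+x. \<integral>\<^sup>+y. indicator (cball 0 r) (y - x) * ennreal ((norm (f y - f x))\<^sup>2) \<partial>lborel \<partial>lborel)
    \<le> ennreal ((2 * r) ^ CARD('n) * (r\<^sup>2 * T))"
proof -
  have [measurable]: "f \<in> borel_measurable borel" and T: "0 \<le> T"
    and bound: "\<And>v. (\<integral>\<^sup>+x. ennreal ((norm (f (x + v) - f x))\<^sup>2) \<partial>lborel) \<le> ennreal ((norm v)\<^sup>2 * T)"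
    using tm by (simp_all add: translation_modulus_def)
  let ?B = "cball (0 :: real^'n) r"
  have [measurable]: "?B \<in> sets borel"
    by simp
  have "(\<integral>\<^sup>+x. \<integral>\<^sup>+y. indicator ?B (y - x) * ennreal ((norm (f y - f x))\<^sup>2) \<partial>lborel \<partial>lborel)
      = (\<integral>\<^sup>+x. \<integral>\<^sup>+v. indicator ?B v * ennreal ((norm (f (x + v) - f x))\<^sup>2) \<partial>lborel \<partial>lborel)"
  proof (rule nn_integral_cong)
    fix x
    have [measurable]: "(\<lambda>y. indicator ?B (y - x) :: ennreal) \<in> borel_measurable borel"
      by (rule measurable_compose[of "\<lambda>y. y - x" borel borel]) (simp_all add: borel_measurable_indicator)
    have "(\<lambda>y. indicator ?B (y - x) * ennreal ((norm (f y - f x))\<^sup>2)) \<in> borel_measurable borel"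
      by (intro borel_measurable_times_ennreal) measurable
    from lborel_nn_integral_shift[OF this, of x]
    show "(\<integral>\<^sup>+y. indicator ?B (y - x) * ennreal ((norm (f y - f x))\<^sup>2) \<partial>lborel)
      = (\<integral>\<^sup>+v. indicator ?B v * ennreal ((norm (f (x + v) - f x))\<^sup>2) \<partial>lborel)"
      by (simp add: add.commute)
  qed
  also have "\<dots> = (\<integral>\<^sup>+v. \<integral>\<^sup>+x. indicator ?B v * ennreal ((norm (f (x + v) - f x))\<^sup>2) \<partial>lborel \<partial>lborel)"
    by (rule lborel_pair.Fubini'[symmetric]) (unfold case_prod_beta, measurable)
  also have "\<dots> \<le> (\<integral>\<^sup>+v. indicator ?B v * ennreal (r\<^sup>2 * T) \<partial>lborel)"
  proof (rule nn_integral_mono)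
    fix v
    have "(\<integral>\<^sup>+x. indicator ?B v * ennreal ((norm (f (x + v) - f x))\<^sup>2) \<partial>lborel)
        = indicator ?B v * (\<integral>\<^sup>+x. ennreal ((norm (f (x + v) - f x))\<^sup>2) \<partial>lborel)"
      by (rule nn_integral_cmult) measurable
    also have "\<dots> \<le> indicator ?B v * ennreal ((norm v)\<^sup>2 * T)"
      by (intro mult_left_mono bound) simp
    also have "\<dots> \<le> indicator ?B v * ennreal (r\<^sup>2 * T)"
      using T by (auto intro!: ennreal_leI mult_right_mono power_mono split: split_indicator)
    finally show "(\<integral>\<^sup>+x. indicator ?B v * ennreal ((norm (f (x + v) - f x))\<^sup>2) \<partial>lborel) \<le> indicator ?B v * ennreal (r\<^sup>2 * T)" .
  qed
  also have "\<dots> = emeasure lborel ?B * ennreal (r\<^sup>2 * T)"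
    by (subst nn_integral_multc) simp_all
  also have "\<dots> \<le> ennreal ((2 * r) ^ CARD('n)) * ennreal (r\<^sup>2 * T)"
  proof (rule mult_right_mono)
    let ?a = "(\<chi> i. - r) :: real^'n"
    have "?B \<subseteq> cbox ?a (?a + (\<chi> i. 2 * r))"
    proof
      fix v
      assume "v \<in> ?B"
      then have "norm v \<le> r" by simp
      then have "\<bar>v $ i\<bar> \<le> r" for i
        using component_le_norm_cart[of v i] by linarith
      then show "v \<in> cbox ?a (?a + (\<chi> i. 2 * r))"
        by (simp add: mem_box_cart abs_le_iff) (metis minus_le_iff)
    qed
    then have "emeasure lborel ?B \<le> emeasure lborel (cbox ?a (?a + (\<chi> i. 2 * r)))"
      by (intro emeasure_mono) simp_all
    then show "emeasure lborel ?B \<le> ennreal ((2 * r) ^ CARD('n))"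
      using r emeasure_lborel_cube(1)[of "2 * r" ?a] by simp
  qed simp
  also have "\<dots> = ennreal ((2 * r) ^ CARD('n) * (r\<^sup>2 * T))"
    using r T by (simp add: ennreal_mult[symmetric])
  finally show ?thesis .
qed

lemma translation_modulus_measurable [measurable_dest]:
  "translation_modulus f T \<Longrightarrow> f \<in> borel_measurable borel"
  by (simp add: translation_modulus_def)

text \<open>Two points of one cell are at most d h apart in dimension d, so the error is bounded by
  the pair integral with \<open>r\<close> equal to d h. The volume factor (2 d h)^d of that integral
  cancels the normalisation h^-d, and h^2 remains.\<close>

lemma cell_average_L2_error:
  fixes f :: "real^'n \<Rightarrow> 'b::euclidean_space" and h :: real
  assumes tm: "translation_modulus f T" and h: "h > 0"
  shows "(\<integral>\<^sup>+x. ennreal ((norm (cell_average h f x - f x))\<^sup>2) \<partial>lborel)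
    \<le> ennreal ((2 * real CARD('n)) ^ CARD('n) * (real CARD('n))\<^sup>2 * h\<^sup>2 * T)"
proof -
  let ?d = "real CARD('n)"
  have f [measurable]: "f \<in> borel_measurable borel" and sf: "square_integrable f" and T: "0 \<le> T"
    using tm by (simp_all add: translation_modulus_def)
  have cb [measurable]: "cball (0 :: real^'n) (?d * h) \<in> sets borel"
    by simp
  have "(\<integral>\<^sup>+x. ennreal ((norm (cell_average h f x - f x))\<^sup>2) \<partial>lborel)
      \<le> (\<integral>\<^sup>+x. ennreal (1 / h ^ CARD('n)) * (\<integral>\<^sup>+y. indicator (cball 0 (?d * h)) (y - x) * ennreal ((norm (f y - f x))\<^sup>2) \<partial>lborel) \<partial>lborel)"
  proof (rule nn_integral_mono)
    fix x
    have "ennreal ((norm (cell_average h f x - f x))\<^sup>2)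
        \<le> ennreal (1 / h ^ CARD('n)) * (\<integral>\<^sup>+y. indicator (cell h x) y * ennreal ((norm (f y - f x))\<^sup>2) \<partial>lborel)"
      by (rule cell_average_diff_squared_le[OF f sf h])
    also have "\<dots> \<le> ennreal (1 / h ^ CARD('n)) * (\<integral>\<^sup>+y. indicator (cball 0 (?d * h)) (y - x) * ennreal ((norm (f y - f x))\<^sup>2) \<partial>lborel)"
      using cell_norm_diff[OF h, of _ x]
      by (intro mult_left_mono nn_integral_mono mult_right_mono) (auto split: split_indicator)
    finally show "ennreal ((norm (cell_average h f x - f x))\<^sup>2)
        \<le> ennreal (1 / h ^ CARD('n)) * (\<integral>\<^sup>+y. indicator (cball 0 (?d * h)) (y - x) * ennreal ((norm (f y - f x))\<^sup>2) \<partial>lborel)" .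
  qed
  also have "\<dots> = ennreal (1 / h ^ CARD('n)) * (\<integral>\<^sup>+x. \<integral>\<^sup>+y. indicator (cball 0 (?d * h)) (y - x) * ennreal ((norm (f y - f x))\<^sup>2) \<partial>lborel \<partial>lborel)"
  proof (rule nn_integral_cmult)
    have "(\<lambda>z::(real^'n) \<times> (real^'n). indicator (cball 0 (?d * h)) (snd z - fst z) * ennreal ((norm (f (snd z) - f (fst z)))\<^sup>2))
        \<in> borel_measurable (lborel \<Otimes>\<^sub>M lborel)"
    proof (intro borel_measurable_times_ennreal)
      show "(\<lambda>z::(real^'n) \<times> (real^'n). indicator (cball 0 (?d * h)) (snd z - fst z) :: ennreal) \<in> borel_measurable (lborel \<Otimes>\<^sub>M lborel)"
        by (rule measurable_compose[of "\<lambda>z. snd z - fst z" _ borel, OF _ borel_measurable_indicator[OF cb]]) measurable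
    qed measurable
    then show "(\<lambda>x. \<integral>\<^sup>+y. indicator (cball 0 (?d * h)) (y - x) * ennreal ((norm (f y - f x))\<^sup>2) \<partial>lborel) \<in> borel_measurable lborel"
      by (intro lborel.borel_measurable_nn_integral) (simp add: case_prod_beta)
  qed
  also have "\<dots> \<le> ennreal (1 / h ^ CARD('n)) * ennreal ((2 * (?d * h)) ^ CARD('n) * ((?d * h)\<^sup>2 * T))"
    using h by (intro mult_left_mono translation_modulus_pairs[OF tm]) simp_all
  also have "\<dots> = ennreal (1 / h ^ CARD('n) * ((2 * (?d * h)) ^ CARD('n) * ((?d * h)\<^sup>2 * T)))"
    using h T by (intro ennreal_mult[symmetric]) simp_all
  also have "1 / h ^ CARD('n) * ((2 * (?d * h)) ^ CARD('n) * ((?d * h)\<^sup>2 * T)) = (2 * ?d) ^ CARD('n) * ?d\<^sup>2 * h\<^sup>2 * T"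
    using h by (simp add: power_mult_distrib field_simps)
  finally show ?thesis
    by simp
qed

text \<open>Jensen's inequality is used twice, over the coarse cell for \<open>y\<close> and over
  the fine cell for \<open>z\<close>. Both normalisations are paid, h^-d and (h/16)^-d, against a
  pair integral of order h^(d+2) T, which leaves h^(2-d) T. The base 64 is 4 * 16: the cube around
  the ball of radius 2 d h has side 4 d h, and the fine volume contributes 16^d.\<close>

lemma cell_average_diff_sup:
  fixes f :: "real^'n \<Rightarrow> 'b::euclidean_space" and h :: real
  assumes tm: "translation_modulus f T" and h: "h > 0"
  shows "(norm (cell_average h f x - cell_average (h/16) f x))\<^sup>2
    \<le> (64 * real CARD('n)) ^ CARD('n) * (2 * real CARD('n))\<^sup>2 * (h\<^sup>2 / h ^ CARD('n)) * T"
proof -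
  let ?d = "real CARD('n)" and ?g = "h / 16"
  have f [measurable]: "f \<in> borel_measurable borel" and sf: "square_integrable f" and T: "0 \<le> T"
    using tm by (simp_all add: translation_modulus_def)
  have g: "?g > 0" using h by simp
  let ?P = "\<lambda>y z. indicator (cball 0 (2 * ?d * h)) (z - y) * ennreal ((norm (f z - f y))\<^sup>2)"
  have cb [measurable]: "cball (0 :: real^'n) (2 * ?d * h) \<in> sets borel"
    by simp
  have mi [measurable]: "(\<lambda>z::(real^'n) \<times> (real^'n). indicator (cball 0 (2 * ?d * h)) (snd z - fst z) :: ennreal) \<in> borel_measurable (lborel \<Otimes>\<^sub>M lborel)"
    by (rule measurable_compose[of "\<lambda>z. snd z - fst z" _ borel, OF _ borel_measurable_indicator[OF cb]]) measurable
  have mP: "(\<lambda>y. \<integral>\<^sup>+z. ?P y z \<partial>lborel) \<in> borel_measurable lborel"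
    by (intro lborel.borel_measurable_nn_integral, unfold case_prod_beta, intro borel_measurable_times_ennreal mi) measurable
  have "ennreal ((norm (cell_average h f x - cell_average ?g f x))\<^sup>2)
      \<le> ennreal (1 / h ^ CARD('n)) * (\<integral>\<^sup>+y. indicator (cell h x) y * ennreal ((norm (f y - cell_average ?g f x))\<^sup>2) \<partial>lborel)"
    by (rule cell_average_diff_squared_le[OF f sf h])
  also have "\<dots> \<le> ennreal (1 / h ^ CARD('n)) * (\<integral>\<^sup>+y. ennreal (1 / ?g ^ CARD('n)) * (\<integral>\<^sup>+z. ?P y z \<partial>lborel) \<partial>lborel)"
  proof (intro mult_left_mono nn_integral_mono)
    fix y
    show "indicator (cell h x) y * ennreal ((norm (f y - cell_average ?g f x))\<^sup>2) \<le> ennreal (1 / ?g ^ CARD('n)) * (\<integral>\<^sup>+z. ?P y z \<partial>lborel)"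
    proof (cases "y \<in> cell h x")
      case True
      have sub: "z - y \<in> cball 0 (2 * ?d * h)" if "z \<in> cell ?g x" for z
      proof -
        have "norm (z - y) \<le> norm (z - x) + norm (y - x)"
          using norm_triangle_ineq4[of "z - x" "y - x"] by simp
        also have "\<dots> \<le> ?d * ?g + ?d * h"
          by (intro add_mono cell_norm_diff h g True that)
        \<comment> \<open>Both cells contain \<open>x\<close>, so the distance from \<open>y\<close>
          to \<open>z\<close> is at most the sum of the two cell diameters, and h/16 is absorbed
          into \<open>h\<close>.\<close>
        also have "\<dots> \<le> 2 * ?d * h"
          using h by simp
        finally show ?thesis by simp
      qed
      have "ennreal ((norm (f y - cell_average ?g f x))\<^sup>2)
          \<le> ennreal (1 / ?g ^ CARD('n)) * (\<integral>\<^sup>+z. indicator (cell ?g x) z * ennreal ((norm (f z - f y))\<^sup>2) \<partial>lborel)"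
        using cell_average_diff_squared_le[OF f sf g, of x "f y"] by (simp add: norm_minus_commute)
      also have "\<dots> \<le> ennreal (1 / ?g ^ CARD('n)) * (\<integral>\<^sup>+z. ?P y z \<partial>lborel)"
        using sub by (intro mult_left_mono nn_integral_mono mult_right_mono) (auto split: split_indicator)
      finally show ?thesis
        using True by simp
    qed simp
  qed simp
  also have "(\<integral>\<^sup>+y. ennreal (1 / ?g ^ CARD('n)) * (\<integral>\<^sup>+z. ?P y z \<partial>lborel) \<partial>lborel)
      = ennreal (1 / ?g ^ CARD('n)) * (\<integral>\<^sup>+y. \<integral>\<^sup>+z. ?P y z \<partial>lborel \<partial>lborel)"
    by (rule nn_integral_cmult[OF mP])
  also have "ennreal (1 / h ^ CARD('n)) * (ennreal (1 / ?g ^ CARD('n)) * (\<integral>\<^sup>+y. \<integral>\<^sup>+z. ?P y z \<partial>lborel \<partial>lborel))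
      \<le> ennreal (1 / h ^ CARD('n)) * (ennreal (1 / ?g ^ CARD('n)) * ennreal ((2 * (2 * ?d * h)) ^ CARD('n) * ((2 * ?d * h)\<^sup>2 * T)))"
    using h by (intro mult_left_mono translation_modulus_pairs[OF tm]) simp_all
  also have "\<dots> = ennreal (1 / h ^ CARD('n) * (1 / ?g ^ CARD('n) * ((2 * (2 * ?d * h)) ^ CARD('n) * ((2 * ?d * h)\<^sup>2 * T))))"
  proof -
    have "0 \<le> 1 / h ^ CARD('n)" "0 \<le> 1 / ?g ^ CARD('n)" "0 \<le> (2 * (2 * ?d * h)) ^ CARD('n) * ((2 * ?d * h)\<^sup>2 * T)"
      using h T by simp_all
    then show ?thesis
      by (simp only: ennreal_mult[symmetric] mult_nonneg_nonneg)
  qed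
  also have "1 / h ^ CARD('n) * (1 / ?g ^ CARD('n) * ((2 * (2 * ?d * h)) ^ CARD('n) * ((2 * ?d * h)\<^sup>2 * T)))
      = (64 * ?d) ^ CARD('n) * (2 * ?d)\<^sup>2 * (h\<^sup>2 / h ^ CARD('n)) * T"
  proof -
    have "1 / H * (1 / (H / B) * ((A * D * H) * (e * s * T))) = (A * B * D) * e * (s / H) * T"
      if "H \<noteq> 0" "B \<noteq> 0" for A B D H e s :: real
      using that by (simp add: field_simps)
    moreover have "(2 * (2 * ?d * h)) ^ CARD('n) = 4 ^ CARD('n) * ?d ^ CARD('n) * h ^ CARD('n)"
    proof -
      have "2 * (2 * ?d * h) = 4 * ?d * h" by simp
      then show ?thesis by (simp only: power_mult_distrib)
    qed
    moreover have "(64 * ?d) ^ CARD('n) = 4 ^ CARD('n) * 16 ^ CARD('n) * ?d ^ CARD('n)"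
    proof -
      have "64 * ?d = 4 * 16 * ?d" by simp
      then show ?thesis by (simp only: power_mult_distrib)
    qed
    ultimately show ?thesis
      using h by (simp only: power_mult_distrib[of "2 * ?d" h] power_divide) simp
  qed
  finally have "ennreal ((norm (cell_average h f x - cell_average ?g f x))\<^sup>2)
      \<le> ennreal ((64 * ?d) ^ CARD('n) * (2 * ?d)\<^sup>2 * (h\<^sup>2 / h ^ CARD('n)) * T)" .
  then show ?thesis
    using h T by (subst (asm) ennreal_le_iff) simp_all
qed

lemma cell_average_sup:
  fixes f :: "real^'n \<Rightarrow> 'b::euclidean_space" and h :: real
  assumes f [measurable]: "f \<in> borel_measurable borel" and sf: "square_integrable f" and h: "h > 0"
  shows "(norm (cell_average h f x))\<^sup>2 \<le> L2sq f / h ^ CARD('n)"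
proof -
  have "ennreal ((norm (cell_average h f x))\<^sup>2)
      \<le> ennreal (1 / h ^ CARD('n)) * (\<integral>\<^sup>+y. indicator (cell h x) y * ennreal ((norm (f y))\<^sup>2) \<partial>lborel)"
    using cell_average_diff_squared_le[OF f sf h, of x 0] by simp
  also have "\<dots> \<le> ennreal (1 / h ^ CARD('n)) * (\<integral>\<^sup>+y. ennreal ((norm (f y))\<^sup>2) \<partial>lborel)"
    by (intro mult_left_mono nn_integral_mono) (auto split: split_indicator)
  also have "\<dots> = ennreal (L2sq f / h ^ CARD('n))"
    using h by (simp add: nn_integral_norm_squared_lborel[OF f sf] ennreal_mult[symmetric])
  finally show ?thesis
    using h by (subst (asm) ennreal_le_iff) simp_all
qed

text \<open>Lying in a common cell is a symmetric relation, so after Tonelli the inner integral is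
  the volume of the cell around \<open>y\<close>, which cancels the normalisation.\<close>

lemma cell_average_L2:
  fixes f :: "real^'n \<Rightarrow> 'b::euclidean_space" and h :: real
  assumes f [measurable]: "f \<in> borel_measurable borel" and sf: "square_integrable f" and h: "h > 0"
  shows "(\<integral>\<^sup>+x. ennreal ((norm (cell_average h f x))\<^sup>2) \<partial>lborel) \<le> ennreal (L2sq f)"
proof -
  have mK [measurable]: "(\<lambda>z::(real^'n) \<times> (real^'n). indicator (cell h (fst z)) (snd z) :: ennreal) \<in> borel_measurable (lborel \<Otimes>\<^sub>M lborel)"
  proof -
    have "(\<lambda>z::(real^'n) \<times> (real^'n). indicator (cell h (fst z)) (snd z) :: ennreal) = (\<lambda>z. if snd z \<in> cell h (fst z) then 1 else 0)"
      by (auto simp: fun_eq_iff)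
    moreover have "(\<lambda>z::(real^'n) \<times> (real^'n). if snd z \<in> cell h (fst z) then 1 else 0 :: ennreal) \<in> borel_measurable (borel \<Otimes>\<^sub>M borel)"
      by measurable
    ultimately show ?thesis
      by (simp cong: measurable_cong_sets)
  qed
  have mf: "(\<lambda>z::(real^'n) \<times> (real^'n). indicator (cell h (fst z)) (snd z) * ennreal ((norm (f (snd z)))\<^sup>2)) \<in> borel_measurable (lborel \<Otimes>\<^sub>M lborel)"
    by measurable
  have "(\<integral>\<^sup>+x. ennreal ((norm (cell_average h f x))\<^sup>2) \<partial>lborel)
      \<le> (\<integral>\<^sup>+x. ennreal (1 / h ^ CARD('n)) * (\<integral>\<^sup>+y. indicator (cell h x) y * ennreal ((norm (f y))\<^sup>2) \<partial>lborel) \<partial>lborel)"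
    using cell_average_diff_squared_le[OF f sf h, of _ 0] by (intro nn_integral_mono) simp
  also have "\<dots> = ennreal (1 / h ^ CARD('n)) * (\<integral>\<^sup>+x. \<integral>\<^sup>+y. indicator (cell h x) y * ennreal ((norm (f y))\<^sup>2) \<partial>lborel \<partial>lborel)"
    using mf by (intro nn_integral_cmult lborel.borel_measurable_nn_integral) (simp add: case_prod_beta)
  also have "(\<integral>\<^sup>+x. \<integral>\<^sup>+y. indicator (cell h x) y * ennreal ((norm (f y))\<^sup>2) \<partial>lborel \<partial>lborel)
      = (\<integral>\<^sup>+y. \<integral>\<^sup>+x. indicator (cell h x) y * ennreal ((norm (f y))\<^sup>2) \<partial>lborel \<partial>lborel)"
    using mf by (intro lborel_pair.Fubini'[symmetric]) (simp add: case_prod_beta)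
  also have "\<dots> = (\<integral>\<^sup>+y. ennreal (h ^ CARD('n)) * ennreal ((norm (f y))\<^sup>2) \<partial>lborel)"
  proof (rule nn_integral_cong)
    fix y
    have "(\<integral>\<^sup>+x. indicator (cell h x) y * ennreal ((norm (f y))\<^sup>2) \<partial>lborel) = (\<integral>\<^sup>+x. indicator (cell h y) x * ennreal ((norm (f y))\<^sup>2) \<partial>lborel)"
      by (intro nn_integral_cong) (auto simp: cell_def split: split_indicator)
    also have "\<dots> = emeasure lborel (cell h y) * ennreal ((norm (f y))\<^sup>2)"
      by (subst nn_integral_multc) simp_all
    finally show "(\<integral>\<^sup>+x. indicator (cell h x) y * ennreal ((norm (f y))\<^sup>2) \<partial>lborel) = ennreal (h ^ CARD('n)) * ennreal ((norm (f y))\<^sup>2)"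
      by (simp add: emeasure_cell[OF h])
  qed
  also have "\<dots> = ennreal (h ^ CARD('n)) * ennreal (L2sq f)"
    by (subst nn_integral_cmult) (simp_all add: nn_integral_norm_squared_lborel[OF f sf])
  also have "ennreal (1 / h ^ CARD('n)) * (ennreal (h ^ CARD('n)) * ennreal (L2sq f)) = ennreal (L2sq f)"
    using h by (simp add: mult.assoc[symmetric] ennreal_mult[symmetric])
  finally show ?thesis .
qed

section \<open>The embedding into \<open>L^4\<close> by telescoping over meshes\<close>

lemma sum_squared_le_weighted:
  fixes a :: "nat \<Rightarrow> real"
  shows "(\<Sum>k<n. a k)\<^sup>2 \<le> 2 * (\<Sum>k<n. 2 ^ k * (a k)\<^sup>2)"
proof -
  have "(\<Sum>k<n. a k)\<^sup>2 = (\<Sum>k<n. sqrt ((1/2) ^ k) * (sqrt (2 ^ k) * a k))\<^sup>2"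
  proof -
    have "sqrt ((1/2) ^ k) * (sqrt (2 ^ k) * a k) = a k" for k
      by (simp add: real_sqrt_mult[symmetric] mult.assoc[symmetric] power_mult_distrib[symmetric] del: real_sqrt_power)
    then show ?thesis by (simp only:)
  qed
  also have "\<dots> \<le> (\<Sum>k<n. (sqrt ((1/2) ^ k))\<^sup>2) * (\<Sum>k<n. (sqrt (2 ^ k) * a k)\<^sup>2)"
    by (rule Cauchy_Schwarz_ineq_sum)
  also have "\<dots> = (\<Sum>k<n. (1/2) ^ k) * (\<Sum>k<n. 2 ^ k * (a k)\<^sup>2)"
    by (simp add: power_mult_distrib)
  also have "\<dots> \<le> 2 * (\<Sum>k<n. 2 ^ k * (a k)\<^sup>2)"
  proof (rule mult_right_mono)
    have "(\<Sum>k<n. (1/2::real) ^ k) \<le> (\<Sum>k. (1/2) ^ k)"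
      by (rule sum_le_suminf) (simp_all add: summable_geometric)
    also have "\<dots> = 2"
      by (subst suminf_geometric) simp_all
    finally show "(\<Sum>k<n. (1/2::real) ^ k) \<le> 2" .
  qed (simp add: sum_nonneg)
  finally show ?thesis .
qed

text \<open>The weighted square bound is Cauchy-Schwarz with weights 2^-k and 2^k; applied twice it
  produces weights 2^k * 4^k = 8^k and the constant 4 * 2. It takes the place of the triangle
  inequality in \<open>L^4\<close> and works pointwise.\<close>

lemma sum_power4_le_weighted:
  fixes a :: "nat \<Rightarrow> real"
  shows "(\<Sum>k<n. a k) ^ 4 \<le> 8 * (\<Sum>k<n. 8 ^ k * (a k) ^ 4)"
proof -
  let ?b = "\<lambda>k. 2 ^ k * (a k)\<^sup>2"
  have "(\<Sum>k<n. a k) ^ 4 = ((\<Sum>k<n. a k)\<^sup>2)\<^sup>2"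
    by simp
  also have "\<dots> \<le> (2 * (\<Sum>k<n. ?b k))\<^sup>2"
    by (intro power_mono sum_squared_le_weighted) simp
  also have "\<dots> = 4 * (\<Sum>k<n. ?b k)\<^sup>2"
    by (simp add: power_mult_distrib)
  also have "\<dots> \<le> 4 * (2 * (\<Sum>k<n. 2 ^ k * (?b k)\<^sup>2))"
    by (intro mult_left_mono sum_squared_le_weighted) simp
  also have "(\<Sum>k<n. 2 ^ k * (?b k)\<^sup>2) = (\<Sum>k<n. 8 ^ k * (a k) ^ 4)"
  proof (rule sum.cong[OF refl])
    fix k
    have "(2::real) ^ k * (2 ^ k)\<^sup>2 = 8 ^ k"
      by (simp add: power2_eq_square power_mult_distrib[symmetric])
    then show "2 ^ k * (?b k)\<^sup>2 = 8 ^ k * (a k) ^ 4"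
      by (simp add: power_mult_distrib mult.assoc[symmetric])
  qed
  finally show ?thesis by simp
qed

text \<open>The fourth power is at most the squared supremum times the square. The supremum
  contributes h^(2-d) T. The mean square contributes h^2 T, with a factor 4 because both averaging
  errors enter with weight 2. The product is of order h^(4-d) T^2.\<close>

lemma cell_average_diff_L4:
  fixes f :: "real^'n \<Rightarrow> 'b::euclidean_space" and h :: real
  assumes tm: "translation_modulus f T" and h: "0 < h" "h \<le> 1" and n: "CARD('n) \<le> 3"
  defines "K \<equiv> 4 * ((2 * real CARD('n)) ^ CARD('n) * (real CARD('n))\<^sup>2) * ((64 * real CARD('n)) ^ CARD('n) * (2 * real CARD('n))\<^sup>2)"
  shows "(\<integral>\<^sup>+x. ennreal ((norm (cell_average h f x - cell_average (h/16) f x)) ^ 4) \<partial>lborel) \<le> ennreal (K * h * T\<^sup>2)"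
proof -
  define A where "A = (2 * real CARD('n)) ^ CARD('n) * (real CARD('n))\<^sup>2"
  define B where "B = (64 * real CARD('n)) ^ CARD('n) * (2 * real CARD('n))\<^sup>2"
  have AB: "A \<ge> 0" "B \<ge> 0" by (simp_all add: A_def B_def)
  have f [measurable]: "f \<in> borel_measurable borel" and sf: "square_integrable f" and T: "0 \<le> T"
    using tm by (simp_all add: translation_modulus_def)
  let ?D = "\<lambda>x. cell_average h f x - cell_average (h/16) f x"
  have err: "(\<integral>\<^sup>+x. ennreal ((norm (cell_average g f x - f x))\<^sup>2) \<partial>lborel) \<le> ennreal (A * h\<^sup>2 * T)"
    if g: "0 < g" "g \<le> h" for g
  proof -
    have "A * g\<^sup>2 * T \<le> A * h\<^sup>2 * T"
      using g T AB by (intro mult_right_mono mult_left_mono power_mono) simp_all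
    then show ?thesis
      using order_trans[OF cell_average_L2_error[OF tm g(1)]] by (simp add: A_def ennreal_leI)
  qed
  have "(\<integral>\<^sup>+x. ennreal ((norm (?D x))\<^sup>2) \<partial>lborel)
      \<le> (\<integral>\<^sup>+x. 2 * ennreal ((norm (cell_average h f x - f x))\<^sup>2) + 2 * ennreal ((norm (cell_average (h/16) f x - f x))\<^sup>2) \<partial>lborel)"
  proof (rule nn_integral_mono)
    fix x
    have "(norm (?D x))\<^sup>2 \<le> 2 * (norm (cell_average h f x - f x))\<^sup>2 + 2 * (norm (cell_average (h/16) f x - f x))\<^sup>2"
      using norm_add_squared_le[of "cell_average h f x - f x" "f x - cell_average (h/16) f x"]
      by (simp add: norm_minus_commute)
    then have "ennreal ((norm (?D x))\<^sup>2) \<le> ennreal (2 * (norm (cell_average h f x - f x))\<^sup>2 + 2 * (norm (cell_average (h/16) f x - f x))\<^sup>2)"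
      by (rule ennreal_leI)
    then show "ennreal ((norm (?D x))\<^sup>2) \<le> 2 * ennreal ((norm (cell_average h f x - f x))\<^sup>2) + 2 * ennreal ((norm (cell_average (h/16) f x - f x))\<^sup>2)"
      by (simp add: ennreal_mult)
  qed
  also have "\<dots> = 2 * (\<integral>\<^sup>+x. ennreal ((norm (cell_average h f x - f x))\<^sup>2) \<partial>lborel)
      + 2 * (\<integral>\<^sup>+x. ennreal ((norm (cell_average (h/16) f x - f x))\<^sup>2) \<partial>lborel)"
    by (subst nn_integral_add; (subst nn_integral_cmult)?; (subst nn_integral_cmult)?) simp_all
  also have "\<dots> \<le> 2 * ennreal (A * h\<^sup>2 * T) + 2 * ennreal (A * h\<^sup>2 * T)"
    using h by (intro add_mono mult_left_mono err) simp_all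
  also have "\<dots> = ennreal (4 * A * h\<^sup>2 * T)"
  proof -
    have "0 \<le> A * h\<^sup>2 * T" using AB T by simp
    then have "ennreal (4 * (A * h\<^sup>2 * T)) = 4 * ennreal (A * h\<^sup>2 * T)"
      by (subst ennreal_mult) simp_all
    moreover have "2 * e + 2 * e = 4 * e" for e :: ennreal
      by (simp add: distrib_right[symmetric])
    ultimately show ?thesis
      by (simp only: mult.assoc)
  qed
  finally have L2: "(\<integral>\<^sup>+x. ennreal ((norm (?D x))\<^sup>2) \<partial>lborel) \<le> ennreal (4 * A * h\<^sup>2 * T)" .
  have s: "0 \<le> B * (h\<^sup>2 / h ^ CARD('n)) * T"
    using AB T h by simp
  have "(\<integral>\<^sup>+x. ennreal ((norm (?D x)) ^ 4) \<partial>lborel) \<le> (\<integral>\<^sup>+x. ennreal (B * (h\<^sup>2 / h ^ CARD('n)) * T) * ennreal ((norm (?D x))\<^sup>2) \<partial>lborel)"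
  proof (rule nn_integral_mono)
    fix x
    have "(norm (?D x)) ^ 4 = (norm (?D x))\<^sup>2 * (norm (?D x))\<^sup>2"
      by (simp add: power_add[symmetric])
    also have "\<dots> \<le> B * (h\<^sup>2 / h ^ CARD('n)) * T * (norm (?D x))\<^sup>2"
      unfolding B_def by (intro mult_right_mono cell_average_diff_sup[OF tm h(1)]) simp
    finally show "ennreal ((norm (?D x)) ^ 4) \<le> ennreal (B * (h\<^sup>2 / h ^ CARD('n)) * T) * ennreal ((norm (?D x))\<^sup>2)"
      using s by (simp add: ennreal_mult[symmetric] ennreal_leI)
  qed
  also have "\<dots> = ennreal (B * (h\<^sup>2 / h ^ CARD('n)) * T) * (\<integral>\<^sup>+x. ennreal ((norm (?D x))\<^sup>2) \<partial>lborel)"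
    by (rule nn_integral_cmult) measurable
  also have "\<dots> \<le> ennreal (B * (h\<^sup>2 / h ^ CARD('n)) * T) * ennreal (4 * A * h\<^sup>2 * T)"
    by (intro mult_left_mono L2) simp
  also have "\<dots> = ennreal (B * (h\<^sup>2 / h ^ CARD('n)) * T * (4 * A * h\<^sup>2 * T))"
    using s AB T by (simp add: ennreal_mult[symmetric])
  also have "\<dots> \<le> ennreal (K * h * T\<^sup>2)"
  proof (rule ennreal_leI)
    \<comment> \<open>The dimension bound enters here: h^4 / h^d \<le> h for d \<le> 3 and h \<le>
      1. Some positive power of \<open>h\<close> must survive for the sum over meshes to
      converge.\<close>
    have "h ^ 3 \<le> h ^ CARD('n)"
      using n h by (intro power_decreasing) simp_all
    then have "h * h ^ 3 \<le> h * h ^ CARD('n)"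
      using h by (intro mult_left_mono) simp_all
    then have "h ^ 4 \<le> h * h ^ CARD('n)"
      by (simp add: power_Suc[symmetric] del: power_Suc)
    then have "h ^ 4 / h ^ CARD('n) \<le> h"
      using h by (simp add: pos_divide_le_eq)
    then have le: "K * T\<^sup>2 * (h ^ 4 / h ^ CARD('n)) \<le> K * T\<^sup>2 * h"
      by (rule mult_left_mono) (simp add: K_def)
    have eq: "B * (h\<^sup>2 / h ^ CARD('n)) * T * (4 * A * h\<^sup>2 * T) = K * T\<^sup>2 * (h ^ 4 / h ^ CARD('n))"
    proof -
      have K: "K = 4 * A * B" by (simp add: K_def A_def B_def)
      have "h ^ 4 = h\<^sup>2 * h\<^sup>2" by (simp add: power_add[symmetric])
      then show ?thesis
        unfolding K by (simp add: power2_eq_square[of T])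
    qed
    show "B * (h\<^sup>2 / h ^ CARD('n)) * T * (4 * A * h\<^sup>2 * T) \<le> K * h * T\<^sup>2"
      using le unfolding eq by (simp only: mult.assoc mult.commute[of h "T\<^sup>2"])
  qed
  finally show ?thesis .
qed

text \<open>The squared errors at meshes h/16^k integrate to a convergent geometric series of ratio
  1/256. Their sum is therefore finite at almost every point, and the terms tend to 0 there.\<close>

lemma cell_average_tendsto_AE:
  fixes f :: "real^'n \<Rightarrow> 'b::euclidean_space" and h :: real
  assumes tm: "translation_modulus f T" and h: "0 < h"
  shows "AE x in lborel. (\<lambda>k. cell_average (h / 16 ^ k) f x) \<longlonglongrightarrow> f x"
proof -
  define A where "A = (2 * real CARD('n)) ^ CARD('n) * (real CARD('n))\<^sup>2"
  have A: "A \<ge> 0" by (simp add: A_def)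
  have f [measurable]: "f \<in> borel_measurable borel" and T: "0 \<le> T"
    using tm by (simp_all add: translation_modulus_def)
  let ?e = "\<lambda>k x. ennreal ((norm (cell_average (h / 16 ^ k) f x - f x))\<^sup>2)"
  have err: "(\<integral>\<^sup>+x. ?e k x \<partial>lborel) \<le> ennreal (A * h\<^sup>2 * T * (1/256) ^ k)" for k
  proof -
    have "((16::real) ^ k)\<^sup>2 = 256 ^ k"
      by (simp add: power2_eq_square power_mult_distrib[symmetric])
    then have "A * (h / 16 ^ k)\<^sup>2 * T = A * h\<^sup>2 * T * (1/256) ^ k"
      by (simp add: power_divide)
    moreover have "(\<integral>\<^sup>+x. ?e k x \<partial>lborel) \<le> ennreal (A * (h / 16 ^ k)\<^sup>2 * T)"
      using cell_average_L2_error[OF tm, of "h / 16 ^ k"] h by (simp add: A_def)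
    ultimately show ?thesis by (simp only:)
  qed
  have "(\<integral>\<^sup>+x. (\<Sum>k. ?e k x) \<partial>lborel) = (\<Sum>k. \<integral>\<^sup>+x. ?e k x \<partial>lborel)"
    by (rule nn_integral_suminf) measurable
  also have "\<dots> \<le> (\<Sum>k. ennreal (A * h\<^sup>2 * T * (1/256) ^ k))"
    by (intro suminf_le err) simp_all
  also have "\<dots> = ennreal (\<Sum>k. A * h\<^sup>2 * T * (1/256) ^ k)"
    using A T by (intro suminf_ennreal2 summable_mult summable_geometric) simp_all
  also have "\<dots> < \<infinity>"
    by (simp only: infinity_ennreal_def ennreal_less_top)
  finally have "(\<integral>\<^sup>+x. (\<Sum>k. ?e k x) \<partial>lborel) \<noteq> \<infinity>"
    by simp
  then have "AE x in lborel. (\<Sum>k. ?e k x) \<noteq> \<infinity>"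
    by (intro nn_integral_noteq_infinite) measurable
  then show ?thesis
  proof eventually_elim
    case (elim x)
    have "summable (\<lambda>k. (norm (cell_average (h / 16 ^ k) f x - f x))\<^sup>2)"
      by (rule summable_suminf_not_top) (use elim in simp_all)
    then have "(\<lambda>k. (norm (cell_average (h / 16 ^ k) f x - f x))\<^sup>2) \<longlonglongrightarrow> 0"
      by (rule summable_LIMSEQ_zero)
    from tendsto_real_sqrt[OF this]
    have "(\<lambda>k. norm (cell_average (h / 16 ^ k) f x - f x)) \<longlonglongrightarrow> 0"
      by simp
    then show ?case
      by (simp add: tendsto_norm_zero_iff LIM_zero_iff)
  qed
qed

text \<open>Telescoping over the meshes h/16^k and splitting the fourth power costs weights 8^k,
  while the k-th difference gains 16^-k, so the series has ratio 1/2. The constant 16 is the 8 of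
  the splitting times the sum 2 of that series.\<close>

lemma cell_average_L4_error:
  fixes f :: "real^'n \<Rightarrow> 'b::euclidean_space" and h :: real
  assumes tm: "translation_modulus f T" and h: "0 < h" "h \<le> 1" and n: "CARD('n) \<le> 3"
  defines "K \<equiv> 4 * ((2 * real CARD('n)) ^ CARD('n) * (real CARD('n))\<^sup>2) * ((64 * real CARD('n)) ^ CARD('n) * (2 * real CARD('n))\<^sup>2)"
  shows "(\<integral>\<^sup>+x. ennreal ((norm (f x - cell_average h f x)) ^ 4) \<partial>lborel) \<le> ennreal (16 * K * h * T\<^sup>2)"
proof -
  have K: "K \<ge> 0" by (simp add: K_def)
  have f [measurable]: "f \<in> borel_measurable borel"
    using tm by (simp add: translation_modulus_def)
  define D where "D k x = norm (cell_average (h / 16 ^ k) f x - cell_average (h / 16 ^ Suc k) f x)" for k x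
  have [measurable]: "D k \<in> borel_measurable borel" for k
    unfolding D_def by measurable
  have DL4: "(\<integral>\<^sup>+x. ennreal (8 * (8 ^ k * D k x ^ 4)) \<partial>lborel) \<le> ennreal (8 * K * h * T\<^sup>2 * (1/2) ^ k)" for k
  proof -
    have hk: "0 < h / 16 ^ k" "h / 16 ^ k \<le> 1"
      using h by (simp_all add: pos_divide_le_eq order_trans[OF h(2)])
    have "(\<integral>\<^sup>+x. ennreal (8 * (8 ^ k * D k x ^ 4)) \<partial>lborel) = (\<integral>\<^sup>+x. ennreal (8 * 8 ^ k) * ennreal (D k x ^ 4) \<partial>lborel)"
      by (simp add: ennreal_mult[symmetric] D_def mult.assoc)
    also have "\<dots> = ennreal (8 * 8 ^ k) * (\<integral>\<^sup>+x. ennreal (D k x ^ 4) \<partial>lborel)"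
      by (rule nn_integral_cmult) measurable
    also have "\<dots> \<le> ennreal (8 * 8 ^ k) * ennreal (K * (h / 16 ^ k) * T\<^sup>2)"
      using cell_average_diff_L4[OF tm hk n] by (intro mult_left_mono) (simp_all add: D_def K_def mult.commute[of 16])
    also have "\<dots> = ennreal (8 * 8 ^ k * (K * (h / 16 ^ k) * T\<^sup>2))"
      using K h by (intro ennreal_mult[symmetric]) simp_all
    also have "8 * 8 ^ k * (K * (h / 16 ^ k) * T\<^sup>2) = 8 * K * h * T\<^sup>2 * (8 ^ k / 16 ^ k)"
      by simp
    also have "(8::real) ^ k / 16 ^ k = (1/2) ^ k"
      by (simp add: power_divide[symmetric])
    finally show ?thesis .
  qed
  have "AE x in lborel. ennreal ((norm (f x - cell_average h f x)) ^ 4) \<le> (\<Sum>k. ennreal (8 * (8 ^ k * D k x ^ 4)))"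
    using cell_average_tendsto_AE[OF tm h(1)]
  proof eventually_elim
    case (elim x)
    have le: "ennreal ((norm (cell_average (h / 16 ^ n) f x - cell_average h f x)) ^ 4) \<le> (\<Sum>k. ennreal (8 * (8 ^ k * D k x ^ 4)))" for n
    proof -
      have "norm (cell_average (h / 16 ^ n) f x - cell_average h f x)
          = norm (\<Sum>k<n. cell_average (h / 16 ^ Suc k) f x - cell_average (h / 16 ^ k) f x)"
        unfolding sum_lessThan_telescope[of "\<lambda>k. cell_average (h / 16 ^ k) f x" n] by simp
      also have "\<dots> \<le> (\<Sum>k<n. D k x)"
        unfolding D_def by (rule order_trans[OF norm_sum]) (simp add: norm_minus_commute)
      finally have "(norm (cell_average (h / 16 ^ n) f x - cell_average h f x)) ^ 4 \<le> (\<Sum>k<n. D k x) ^ 4"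
        by (rule power_mono) simp
      also have "\<dots> \<le> 8 * (\<Sum>k<n. 8 ^ k * D k x ^ 4)"
        by (rule sum_power4_le_weighted)
      also have "\<dots> = (\<Sum>k<n. 8 * (8 ^ k * D k x ^ 4))"
        by (rule sum_distrib_left)
      finally have "ennreal ((norm (cell_average (h / 16 ^ n) f x - cell_average h f x)) ^ 4) \<le> ennreal (\<Sum>k<n. 8 * (8 ^ k * D k x ^ 4))"
        by (rule ennreal_leI)
      also have "\<dots> = (\<Sum>k<n. ennreal (8 * (8 ^ k * D k x ^ 4)))"
        by (rule sum_ennreal[symmetric]) (simp add: D_def)
      also have "\<dots> \<le> (\<Sum>k. ennreal (8 * (8 ^ k * D k x ^ 4)))"
        by (rule sum_le_suminf) simp_all
      finally show ?thesis .
    qed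
    have "(\<lambda>n. ennreal ((norm (cell_average (h / 16 ^ n) f x - cell_average h f x)) ^ 4)) \<longlonglongrightarrow> ennreal ((norm (f x - cell_average h f x)) ^ 4)"
      using elim by (intro tendsto_ennrealI tendsto_intros)
    then show ?case
      by (rule LIMSEQ_le_const2) (use le in blast)
  qed
  then have "(\<integral>\<^sup>+x. ennreal ((norm (f x - cell_average h f x)) ^ 4) \<partial>lborel) \<le> (\<integral>\<^sup>+x. (\<Sum>k. ennreal (8 * (8 ^ k * D k x ^ 4))) \<partial>lborel)"
    by (rule nn_integral_mono_AE)
  also have "\<dots> = (\<Sum>k. \<integral>\<^sup>+x. ennreal (8 * (8 ^ k * D k x ^ 4)) \<partial>lborel)"
    by (rule nn_integral_suminf) measurable
  also have "\<dots> \<le> (\<Sum>k. ennreal (8 * K * h * T\<^sup>2 * (1/2) ^ k))"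
    by (intro suminf_le DL4) simp_all
  also have "\<dots> = ennreal (\<Sum>k. 8 * K * h * T\<^sup>2 * (1/2) ^ k)"
    using K h by (intro suminf_ennreal2 summable_mult summable_geometric) simp_all
  also have "(\<Sum>k. 8 * K * h * T\<^sup>2 * (1/2) ^ k) = 8 * K * h * T\<^sup>2 * (\<Sum>k. (1/2) ^ k)"
    by (rule suminf_mult) (simp add: summable_geometric)
  also have "(\<Sum>k. (1/2::real) ^ k) = 2"
    by (subst suminf_geometric) simp_all
  finally show ?thesis
    by (simp add: mult.commute mult.left_commute)
qed

lemma norm_add_power4_le: "(norm (a + b)) ^ 4 \<le> 8 * (norm a) ^ 4 + 8 * (norm b) ^ 4"
proof -
  have sq: "(s + t)\<^sup>2 \<le> 2 * s\<^sup>2 + 2 * t\<^sup>2" for s t :: real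
    using norm_add_squared_le[of s t] by simp
  have "(norm (a + b)) ^ 4 = ((norm (a + b))\<^sup>2)\<^sup>2"
    by simp
  also have "\<dots> \<le> (2 * (norm a)\<^sup>2 + 2 * (norm b)\<^sup>2)\<^sup>2"
    by (intro power_mono norm_add_squared_le) simp
  also have "\<dots> \<le> 2 * (2 * (norm a)\<^sup>2)\<^sup>2 + 2 * (2 * (norm b)\<^sup>2)\<^sup>2"
    by (rule sq)
  also have "\<dots> = 8 * (norm a) ^ 4 + 8 * (norm b) ^ 4"
    by (simp add: power_mult_distrib)
  finally show ?thesis .
qed

text \<open>The factor 512 is 8 * 16 * 4: the 8 of \<open>norm_add_power4_le\<close>, the 16 of the
  telescoping sum and the 4 of a single mesh.\<close>

definition sobolev_const :: "'n::finite itself \<Rightarrow> real" where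
  "sobolev_const t = 512 * ((2 * real CARD('n)) ^ CARD('n) * (real CARD('n))\<^sup>2) * ((64 * real CARD('n)) ^ CARD('n) * (2 * real CARD('n))\<^sup>2)"

lemma sobolev_const_nonneg: "0 \<le> sobolev_const t"
  by (simp add: sobolev_const_def)

text \<open>The function is split into its cell average, whose fourth power is controlled by
  supremum times mean square, and the remainder. The mesh \<open>h\<close> is left free so that the
  coefficient of \<open>T\<close> can be made arbitrarily small.\<close>

lemma translation_modulus_L4:
  fixes f :: "real^'n \<Rightarrow> 'b::euclidean_space" and h :: real
  assumes tm: "translation_modulus f T" and h: "0 < h" "h \<le> 1" and n: "CARD('n) \<le> 3"
  shows "(\<integral>\<^sup>+x. ennreal ((norm (f x)) ^ 4) \<partial>lborel)
    \<le> ennreal (sobolev_const TYPE('n) * h * T\<^sup>2 + 8 / h ^ CARD('n) * (L2sq f)\<^sup>2)"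
proof -
  let ?K = "4 * ((2 * real CARD('n)) ^ CARD('n) * (real CARD('n))\<^sup>2) * ((64 * real CARD('n)) ^ CARD('n) * (2 * real CARD('n))\<^sup>2)"
  have f [measurable]: "f \<in> borel_measurable borel" and sf: "square_integrable f"
    using tm by (simp_all add: translation_modulus_def)
  let ?A = "cell_average h f" and ?S = "L2sq f / h ^ CARD('n)"
  have S: "0 \<le> ?S" using h by simp
  have avg: "(\<integral>\<^sup>+x. ennreal ((norm (?A x)) ^ 4) \<partial>lborel) \<le> ennreal (?S * L2sq f)"
  proof -
    have "(\<integral>\<^sup>+x. ennreal ((norm (?A x)) ^ 4) \<partial>lborel) \<le> (\<integral>\<^sup>+x. ennreal ?S * ennreal ((norm (?A x))\<^sup>2) \<partial>lborel)"
    proof (rule nn_integral_mono)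
      fix x
      have "(norm (?A x)) ^ 4 = (norm (?A x))\<^sup>2 * (norm (?A x))\<^sup>2"
        by (simp add: power_add[symmetric])
      also have "\<dots> \<le> ?S * (norm (?A x))\<^sup>2"
        by (intro mult_right_mono cell_average_sup f sf h) simp
      finally show "ennreal ((norm (?A x)) ^ 4) \<le> ennreal ?S * ennreal ((norm (?A x))\<^sup>2)"
        using S by (simp add: ennreal_mult[symmetric] ennreal_leI)
    qed
    also have "\<dots> = ennreal ?S * (\<integral>\<^sup>+x. ennreal ((norm (?A x))\<^sup>2) \<partial>lborel)"
      by (rule nn_integral_cmult) measurable
    also have "\<dots> \<le> ennreal ?S * ennreal (L2sq f)"
      by (intro mult_left_mono cell_average_L2 f sf h) simp
    also have "\<dots> = ennreal (?S * L2sq f)"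
      using S by (intro ennreal_mult[symmetric]) simp_all
    finally show ?thesis .
  qed
  have "(\<integral>\<^sup>+x. ennreal ((norm (f x)) ^ 4) \<partial>lborel)
      \<le> (\<integral>\<^sup>+x. ennreal 8 * ennreal ((norm (f x - ?A x)) ^ 4) + ennreal 8 * ennreal ((norm (?A x)) ^ 4) \<partial>lborel)"
  proof (rule nn_integral_mono)
    fix x
    have "(norm (f x)) ^ 4 \<le> 8 * (norm (f x - ?A x)) ^ 4 + 8 * (norm (?A x)) ^ 4"
      using norm_add_power4_le[of "f x - ?A x" "?A x"] by simp
    then have "ennreal ((norm (f x)) ^ 4) \<le> ennreal (8 * (norm (f x - ?A x)) ^ 4 + 8 * (norm (?A x)) ^ 4)"
      by (rule ennreal_leI)
    then show "ennreal ((norm (f x)) ^ 4) \<le> ennreal 8 * ennreal ((norm (f x - ?A x)) ^ 4) + ennreal 8 * ennreal ((norm (?A x)) ^ 4)"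
      by (simp add: ennreal_mult)
  qed
  also have "\<dots> = ennreal 8 * (\<integral>\<^sup>+x. ennreal ((norm (f x - ?A x)) ^ 4) \<partial>lborel) + ennreal 8 * (\<integral>\<^sup>+x. ennreal ((norm (?A x)) ^ 4) \<partial>lborel)"
    by (subst nn_integral_add; (subst nn_integral_cmult)?; (subst nn_integral_cmult)?) simp_all
  also have "\<dots> \<le> ennreal 8 * ennreal (16 * ?K * h * T\<^sup>2) + ennreal 8 * ennreal (?S * L2sq f)"
    by (intro add_mono mult_left_mono avg cell_average_L4_error[OF tm h n]) simp_all
  also have "\<dots> = ennreal (8 * (16 * ?K * h * T\<^sup>2) + 8 * (?S * L2sq f))"
  proof -
    have "0 \<le> 16 * ?K * h * T\<^sup>2" "0 \<le> ?S * L2sq f"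
      using h by simp_all
    then show ?thesis
      by (subst ennreal_plus) (simp_all only: ennreal_mult mult_nonneg_nonneg zero_le_numeral)
  qed
  also have "8 * (16 * ?K * h * T\<^sup>2) + 8 * (?S * L2sq f) = sobolev_const TYPE('n) * h * T\<^sup>2 + 8 / h ^ CARD('n) * (L2sq f)\<^sup>2"
    by (simp add: sobolev_const_def power2_eq_square[of "L2sq f"])
  finally show ?thesis .
qed

section \<open>Local compactness through finitely many cells\<close>

lemma finite_cells_cover:
  fixes R h :: real
  assumes h: "h > 0"
  obtains Z :: "(real^'n) set" where "finite Z" and "cball 0 R \<subseteq> (\<Union>z\<in>Z. cell h z)"
proof -
  define g where "g x i = \<lfloor>x $ i / h\<rfloor>" for x :: "real^'n" and i
  define m where "m = \<lceil>\<bar>R\<bar> / h\<rceil> + 1"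
  \<comment> \<open>A cell is determined by its integer vector of floors, and on a ball these
    vectors are bounded; one point is then picked for each vector that occurs.\<close>
  have "g ` cball 0 R \<subseteq> (\<Pi>\<^sub>E i\<in>UNIV. {-m..m})"
  proof (clarsimp simp: PiE_iff)
    fix x :: "real^'n" and i
    assume "norm x \<le> R"
    then have "\<bar>x $ i\<bar> \<le> \<bar>R\<bar>"
      using component_le_norm_cart[of x i] by linarith
    then have "\<bar>x $ i / h\<bar> \<le> \<bar>R\<bar> / h"
      using h by (simp add: divide_right_mono)
    then show "- m \<le> g x i \<and> g x i \<le> m"
      unfolding g_def m_def by linarith
  qed
  moreover have "finite (\<Pi>\<^sub>E i\<in>(UNIV :: 'n set). {-m..m})"
    by (intro finite_PiE) simp_all
  ultimately have "finite (g ` cball 0 R)"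
    by (rule finite_subset)
  then obtain Z where Z: "Z \<subseteq> cball 0 R" "finite Z" "g ` cball 0 R = g ` Z"
    using finite_subset_image[of "g ` cball 0 R" g "cball 0 R"] by auto
  have "cball 0 R \<subseteq> (\<Union>z\<in>Z. cell h z)"
  proof
    fix x :: "real^'n"
    assume "x \<in> cball 0 R"
    then obtain z where "z \<in> Z" "g x = g z"
      using Z(3) by (metis image_iff)
    then show "x \<in> (\<Union>z\<in>Z. cell h z)"
      by (auto simp: cell_def g_def fun_eq_iff)
  qed
  with Z(2) show ?thesis
    by (rule that)
qed

text \<open>A quantitative form of the Rellich theorem: on the ball the function is its cell average
  up to an error of order h^2 T, and the average takes only the finitely many values attached to
  \<open>Z\<close>.\<close>

lemma translation_modulus_compactness:
  fixes f :: "real^'n \<Rightarrow> 'b::euclidean_space" and h R :: real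
  assumes tm: "translation_modulus f T" and h: "0 < h"
    and Z: "finite Z" "cball 0 R \<subseteq> (\<Union>z\<in>Z. cell h z)"
  shows "(\<integral>\<^sup>+x. indicator (cball 0 R) x * ennreal ((norm (f x))\<^sup>2) \<partial>lborel)
    \<le> ennreal (2 * ((2 * real CARD('n)) ^ CARD('n) * (real CARD('n))\<^sup>2 * h\<^sup>2 * T)
        + 2 * h ^ CARD('n) * (\<Sum>z\<in>Z. (norm (cell_average h f z))\<^sup>2))"
proof -
  let ?C = "(2 * real CARD('n)) ^ CARD('n) * (real CARD('n))\<^sup>2 * h\<^sup>2 * T" and ?A = "cell_average h f"
  have f [measurable]: "f \<in> borel_measurable borel" and T: "0 \<le> T"
    using tm by (simp_all add: translation_modulus_def)
  have [measurable]: "cball (0 :: real^'n) R \<in> sets borel"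
    by simp
  have "(\<integral>\<^sup>+x. indicator (cball 0 R) x * ennreal ((norm (f x))\<^sup>2) \<partial>lborel)
      \<le> (\<integral>\<^sup>+x. ennreal 2 * ennreal ((norm (?A x - f x))\<^sup>2) + ennreal 2 * (\<Sum>z\<in>Z. ennreal ((norm (?A z))\<^sup>2) * indicator (cell h z) x) \<partial>lborel)"
  proof (rule nn_integral_mono)
    fix x
    show "indicator (cball 0 R) x * ennreal ((norm (f x))\<^sup>2)
        \<le> ennreal 2 * ennreal ((norm (?A x - f x))\<^sup>2) + ennreal 2 * (\<Sum>z\<in>Z. ennreal ((norm (?A z))\<^sup>2) * indicator (cell h z) x)"
    proof (cases "x \<in> cball 0 R")
      case True
      then obtain z where z: "z \<in> Z" "x \<in> cell h z"
        using Z(2) by blast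
      have "(norm (f x))\<^sup>2 \<le> 2 * (norm (?A x - f x))\<^sup>2 + 2 * (norm (?A x))\<^sup>2"
        using norm_add_squared_le[of "f x - ?A x" "?A x"] by (simp add: norm_minus_commute)
      also have "\<dots> = 2 * (norm (?A x - f x))\<^sup>2 + 2 * (norm (?A z))\<^sup>2"
        using cell_eq[OF z(2)] by (simp add: cell_average_def)
      finally have "ennreal ((norm (f x))\<^sup>2) \<le> ennreal (2 * (norm (?A x - f x))\<^sup>2 + 2 * (norm (?A z))\<^sup>2)"
        by (rule ennreal_leI)
      also have "\<dots> = ennreal 2 * ennreal ((norm (?A x - f x))\<^sup>2) + ennreal 2 * (ennreal ((norm (?A z))\<^sup>2) * indicator (cell h z) x)"
        using z(2) by (simp add: ennreal_mult)
      also have "\<dots> \<le> ennreal 2 * ennreal ((norm (?A x - f x))\<^sup>2) + ennreal 2 * (\<Sum>z\<in>Z. ennreal ((norm (?A z))\<^sup>2) * indicator (cell h z) x)"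
        using z(1) Z(1) by (intro add_left_mono mult_left_mono member_le_sum) simp_all
      finally show ?thesis
        using True by simp
    qed simp
  qed
  also have "\<dots> = ennreal 2 * (\<integral>\<^sup>+x. ennreal ((norm (?A x - f x))\<^sup>2) \<partial>lborel) + ennreal 2 * (\<Sum>z\<in>Z. ennreal ((norm (?A z))\<^sup>2) * emeasure lborel (cell h z))"
    by (subst nn_integral_add; (subst nn_integral_cmult)?; (subst nn_integral_cmult)?; (subst nn_integral_sum)?; (subst nn_integral_cmult_indicator)?) simp_all
  also have "\<dots> \<le> ennreal 2 * ennreal ?C + ennreal 2 * (\<Sum>z\<in>Z. ennreal ((norm (?A z))\<^sup>2) * emeasure lborel (cell h z))"
    by (intro add_right_mono mult_left_mono cell_average_L2_error[OF tm h]) simp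
  also have "(\<Sum>z\<in>Z. ennreal ((norm (?A z))\<^sup>2) * emeasure lborel (cell h z)) = ennreal (h ^ CARD('n) * (\<Sum>z\<in>Z. (norm (?A z))\<^sup>2))"
  proof -
    have "ennreal (h ^ CARD('n) * (\<Sum>z\<in>Z. (norm (?A z))\<^sup>2)) = (\<Sum>z\<in>Z. ennreal (h ^ CARD('n) * (norm (?A z))\<^sup>2))"
      using h by (simp add: sum_distrib_left sum_ennreal)
    then show ?thesis
      using h by (simp add: emeasure_cell[OF h] ennreal_mult mult.commute)
  qed
  also have "ennreal 2 * ennreal ?C + ennreal 2 * ennreal (h ^ CARD('n) * (\<Sum>z\<in>Z. (norm (?A z))\<^sup>2))
      = ennreal (2 * ?C + 2 * (h ^ CARD('n) * (\<Sum>z\<in>Z. (norm (?A z))\<^sup>2)))"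
  proof -
    have "0 \<le> ?C" "0 \<le> h ^ CARD('n) * (\<Sum>z\<in>Z. (norm (?A z))\<^sup>2)"
      using h T by (simp_all add: sum_nonneg)
    then show ?thesis
      by (subst ennreal_plus) (simp_all only: ennreal_mult mult_nonneg_nonneg zero_le_numeral)
  qed
  finally show ?thesis
    by (simp only: mult.assoc)
qed

section \<open>Coercive forms and the Riesz representation\<close>

lemma convergent_subsequence_finite_family:
  fixes u :: "'i \<Rightarrow> nat \<Rightarrow> 'e::euclidean_space"
  assumes "finite I" and "\<And>i. i \<in> I \<Longrightarrow> bounded (range (u i))"
  shows "\<exists>r :: nat \<Rightarrow> nat. strict_mono r \<and> (\<forall>i\<in>I. convergent (u i \<circ> r))"
  using assms
proof (induction I rule: finite_induct)
  case empty
  have "strict_mono (id :: nat \<Rightarrow> nat)"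
    by (simp add: strict_mono_def)
  then show ?case by blast
next
  case (insert j I)
  have "\<exists>r :: nat \<Rightarrow> nat. strict_mono r \<and> (\<forall>i\<in>I. convergent (u i \<circ> r))"
    by (rule insert.IH) (simp add: insert.prems)
  then obtain r :: "nat \<Rightarrow> nat" where r: "strict_mono r" "\<And>i. i \<in> I \<Longrightarrow> convergent (u i \<circ> r)"
    by blast
  have "bounded (range (u j \<circ> r))"
    using insert.prems[of j] by (rule bounded_subset) auto
  then obtain l and s :: "nat \<Rightarrow> nat" where s: "strict_mono s" "((u j \<circ> r) \<circ> s) \<longlonglongrightarrow> l"
    using bounded_imp_convergent_subsequence by blast
  have "convergent (u i \<circ> (r \<circ> s))" if "i \<in> insert j I" for i
  proof (cases "i = j")
    case True
    then show ?thesis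
      using s(2) by (auto simp: convergent_def comp_assoc)
  next
    case False
    then have "convergent (u i \<circ> r)"
      using that r(2) by blast
    from convergent_subseq_convergent[OF this s(1)] show ?thesis
      by (simp only: comp_assoc)
  qed
  moreover have "strict_mono (r \<circ> s)"
    using r(1) s(1) by (rule strict_mono_o)
  ultimately show ?case by blast
qed

text \<open>The vectors are functions representing classes modulo null sets, so the linear structure
  is passed explicitly as \<open>lin\<close> and the form is only semidefinite. The scalars are
  real, because the forms inserted later are real parts of Hermitian forms.\<close>

locale symmetric_form =
  fixes X :: "'v set" and lin :: "real \<Rightarrow> 'v \<Rightarrow> real \<Rightarrow> 'v \<Rightarrow> 'v" and b :: "'v \<Rightarrow> 'v \<Rightarrow> real"
  assumes lin_mem: "f \<in> X \<Longrightarrow> h \<in> X \<Longrightarrow> lin s f t h \<in> X"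
    and lin_left: "f \<in> X \<Longrightarrow> h \<in> X \<Longrightarrow> k \<in> X \<Longrightarrow> b (lin s f t h) k = s * b f k + t * b h k"
    and sym: "f \<in> X \<Longrightarrow> h \<in> X \<Longrightarrow> b f h = b h f"
    and nonneg: "f \<in> X \<Longrightarrow> 0 \<le> b f f"
begin

lemma lin_right:
  assumes "f \<in> X" "h \<in> X" "k \<in> X"
  shows "b k (lin s f t h) = s * b k f + t * b k h"
  using assms sym[of k "lin s f t h"] sym[of k f] sym[of k h] by (simp add: lin_left lin_mem)

lemma quadratic_lin:
  assumes "f \<in> X" "h \<in> X"
  shows "b (lin s f t h) (lin s f t h) = s\<^sup>2 * b f f + 2 * s * t * b f h + t\<^sup>2 * b h h"
  using assms sym[of h f] by (simp add: lin_left lin_right lin_mem power2_eq_square algebra_simps)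

lemma quadratic_diff_le:
  assumes "f \<in> X" "h \<in> X"
  shows "b (lin 1 f (-1) h) (lin 1 f (-1) h) \<le> 2 * b f f + 2 * b h h"
  using quadratic_lin[OF assms, of 1 "-1"] quadratic_lin[OF assms, of 1 1] nonneg[OF lin_mem[OF assms, of 1 1]]
  by simp

text \<open>The difference of the two sides is the value of the form at
  \<open>2 f - h\<close>.\<close>

lemma quadratic_le_diff:
  assumes "f \<in> X" "h \<in> X"
  shows "b h h \<le> 2 * b f f + 2 * b (lin 1 f (-1) h) (lin 1 f (-1) h)"
  using quadratic_lin[OF assms, of 1 "-1"] quadratic_lin[OF assms, of 2 "-1"] nonneg[OF lin_mem[OF assms, of 2 "-1"]]
  by simp

lemma Cauchy_Schwarz:
  assumes "f \<in> X" "h \<in> X"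
  shows "(b f h)\<^sup>2 \<le> b f f * b h h"
proof (cases "b h h = 0")
  case True
  have "b f h = 0"
  proof (rule ccontr)
    assume n: "b f h \<noteq> 0"
    \<comment> \<open>Since \<open>b h h = 0\<close>, the form along multiples of \<open>h\<close>
      added to \<open>f\<close> is affine; the coefficient is the one at which it equals -1.\<close>
    have "0 \<le> b f f + 2 * (- (b f f + 1) / (2 * b f h)) * b f h"
      using quadratic_lin[OF assms, of 1 "- (b f f + 1) / (2 * b f h)"] True
        nonneg[OF lin_mem[OF assms, of 1 "- (b f f + 1) / (2 * b f h)"]] by simp
    also have "\<dots> = -1"
      using n by (simp add: field_simps)
    finally show False by simp
  qed
  with True show ?thesis by simp
next
  case False
  then have pos: "b h h > 0"
    using nonneg[OF assms(2)] by simp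
  have "0 \<le> (b h h)\<^sup>2 * b f f + 2 * b h h * (- b f h) * b f h + (- b f h)\<^sup>2 * b h h"
    using quadratic_lin[OF assms, of "b h h" "- b f h"] nonneg[OF lin_mem[OF assms, of "b h h" "- b f h"]] by simp
  also have "\<dots> = b h h * (b f f * b h h - (b f h)\<^sup>2)"
    by (simp add: power2_eq_square algebra_simps)
  finally show ?thesis
    using pos by (simp add: zero_le_mult_iff)
qed

end

text \<open>Here \<open>n\<close> is the square of a complete norm and \<open>b\<close> the form to
  be inverted. Only the upper bound of \<open>b\<close> by \<open>n\<close> is assumed; the opposite
  inequality is the conclusion of the next lemma.\<close>

locale complete_form_pair =
  n: symmetric_form X lin n + b: symmetric_form X lin b
  for X :: "'v set" and lin and n b +
  fixes C :: real
  assumes bound: "f \<in> X \<Longrightarrow> b f f \<le> C * n f f"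
    and nonempty: "X \<noteq> {}"
    and complete: "(\<And>k. F k \<in> X) \<Longrightarrow>
      (\<And>e. e > 0 \<Longrightarrow> \<exists>N. \<forall>k\<ge>N. \<forall>l\<ge>N. n (lin 1 (F k) (-1) (F l)) (lin 1 (F k) (-1) (F l)) < e) \<Longrightarrow>
      \<exists>f\<in>X. (\<lambda>k. n (lin 1 (F k) (-1) f) (lin 1 (F k) (-1) f)) \<longlonglongrightarrow> 0"
begin

text \<open>
  A normalised sequence along which \<^term>\<open>b\<close> tends to zero has, by the Garding inequality, a
  subsequence that is Cauchy for \<^term>\<open>n\<close> as soon as the finitely many functionals converge.
\<close>

lemma coercive:
  fixes l :: "'i \<Rightarrow> 'v \<Rightarrow> 'e::euclidean_space"
  assumes definite: "\<And>f. f \<in> X \<Longrightarrow> b f f = 0 \<Longrightarrow> n f f = 0"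
    and I: "finite I"
    and l_lin: "\<And>i f h s t. i \<in> I \<Longrightarrow> f \<in> X \<Longrightarrow> h \<in> X \<Longrightarrow> l i (lin s f t h) = s *\<^sub>R l i f + t *\<^sub>R l i h"
    and l_bound: "\<And>i f. i \<in> I \<Longrightarrow> f \<in> X \<Longrightarrow> (norm (l i f))\<^sup>2 \<le> M * n f f"
    and c: "c > 0" and K: "K \<ge> 0"
    and garding: "\<And>f. f \<in> X \<Longrightarrow> c * n f f \<le> b f f + K * (\<Sum>i\<in>I. (norm (l i f))\<^sup>2)"
  shows "\<exists>c'>0. \<forall>f\<in>X. c' * n f f \<le> b f f"
proof (rule ccontr)
  assume contra: "\<not> (\<exists>c'>0. \<forall>f\<in>X. c' * n f f \<le> b f f)"
  have "\<exists>g\<in>X. n g g = 1 \<and> b g g < 1 / real (Suc k)" for k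
  proof -
    have "\<not> (\<forall>f\<in>X. 1 / real (Suc k) * n f f \<le> b f f)"
      using contra by (metis divide_pos_pos of_nat_0_less_iff zero_less_Suc zero_less_one)
    then obtain f where f: "f \<in> X" "b f f < 1 / real (Suc k) * n f f"
      by (auto simp: not_le)
    then have "n f f \<noteq> 0"
      using b.nonneg[OF f(1)] by auto
    then have pos: "n f f > 0"
      using n.nonneg[OF f(1)] by simp
    \<comment> \<open>Normalisation to \<open>n\<close>-norm one; a scalar multiple is written as a
      combination whose second coefficient is 0.\<close>
    let ?s = "1 / sqrt (n f f)"
    have s: "?s\<^sup>2 = 1 / n f f"
      using pos by (simp add: power_divide)
    have "n (lin ?s f 0 f) (lin ?s f 0 f) = 1"
      using n.quadratic_lin[OF f(1) f(1), of ?s 0] pos unfolding s by simp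
    moreover have "b (lin ?s f 0 f) (lin ?s f 0 f) < 1 / real (Suc k)"
      using b.quadratic_lin[OF f(1) f(1), of ?s 0] f(2) pos unfolding s
      by (simp add: pos_divide_less_eq)
    ultimately show ?thesis
      using n.lin_mem[OF f(1) f(1)] by blast
  qed
  then obtain g where g: "\<And>k. g k \<in> X" "\<And>k. n (g k) (g k) = 1" "\<And>k. b (g k) (g k) < 1 / real (Suc k)"
    by metis
  have "bounded (range (\<lambda>k. l i (g k)))" if "i \<in> I" for i
  proof -
    have "norm (l i (g k)) \<le> sqrt M" for k
      using l_bound[OF that g(1)[of k]] g(2)[of k] by (simp add: real_le_rsqrt)
    then show ?thesis
      by (auto simp: bounded_iff)
  qed
  from convergent_subsequence_finite_family[OF I, of "\<lambda>i k. l i (g k)", OF this]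
  obtain r :: "nat \<Rightarrow> nat" where r: "strict_mono r" "\<And>i. i \<in> I \<Longrightarrow> convergent ((\<lambda>k. l i (g k)) \<circ> r)"
    by blast
  define F where "F k = g (r k)" for k
  have F: "F k \<in> X" "n (F k) (F k) = 1" for k
    using g by (simp_all add: F_def)
  have bF: "(\<lambda>k. b (F k) (F k)) \<longlonglongrightarrow> 0"
  proof (rule real_tendsto_sandwich[where f="\<lambda>k. 0" and h="\<lambda>k. 1 / real (Suc k)"])
    have "b (F k) (F k) \<le> 1 / real (Suc k)" for k
    proof -
      have "1 / real (Suc (r k)) \<le> 1 / real (Suc k)"
        using seq_suble[OF r(1), of k] by (intro divide_left_mono) simp_all
      then show ?thesis
        using g(3)[of "r k"] by (simp add: F_def)
    qed
    then show "\<forall>\<^sub>F k in sequentially. b (F k) (F k) \<le> 1 / real (Suc k)"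
      by (intro always_eventually allI)
    show "(\<lambda>k. 1 / real (Suc k)) \<longlonglongrightarrow> 0"
      using LIMSEQ_inverse_real_of_nat by (simp add: inverse_eq_divide)
  qed (use b.nonneg F in simp_all)
  have lF: "Cauchy (\<lambda>k. l i (F k))" if "i \<in> I" for i
    using r(2)[OF that] by (intro convergent_Cauchy) (simp add: F_def comp_def)
  have "\<exists>N. \<forall>k\<ge>N. \<forall>m\<ge>N. n (lin 1 (F k) (-1) (F m)) (lin 1 (F k) (-1) (F m)) < e" if e: "e > 0" for e
  proof -
    \<comment> \<open>The threshold is such that the contribution 4 d of the two small values of
      \<open>b\<close>, together with at most K d from each of the functionals, stays strictly below
      \<open>c * e\<close>.\<close>
    define d where "d = c * e / (8 + 8 * K * real (card I))"
    have den: "8 + 8 * K * real (card I) > 0"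
      using K by (simp add: add_pos_nonneg)
    have d: "d > 0"
      using c e den by (simp add: d_def)
    have "\<forall>i\<in>I. \<exists>N. \<forall>k\<ge>N. \<forall>m\<ge>N. norm (l i (F k) - l i (F m)) < sqrt d"
      using lF d by (auto simp: Cauchy_iff)
    from bchoice[OF this] obtain N
      where N: "\<And>i k m. i \<in> I \<Longrightarrow> k \<ge> N i \<Longrightarrow> m \<ge> N i \<Longrightarrow> norm (l i (F k) - l i (F m)) < sqrt d"
      by blast
    obtain N0 where N0: "\<And>k. k \<ge> N0 \<Longrightarrow> b (F k) (F k) < d"
      using LIMSEQ_D[OF bF d] b.nonneg F(1) by (auto simp: abs_of_nonneg)
    define N1 where "N1 = Max (insert N0 (N ` I))"
    have N1: "N0 \<le> N1" "\<And>i. i \<in> I \<Longrightarrow> N i \<le> N1"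
      using I by (simp_all add: N1_def)
    have "n (lin 1 (F k) (-1) (F m)) (lin 1 (F k) (-1) (F m)) < e" if km: "k \<ge> N1" "m \<ge> N1" for k m
    proof -
      let ?D = "lin 1 (F k) (-1) (F m)"
      have "(\<Sum>i\<in>I. (norm (l i ?D))\<^sup>2) \<le> (\<Sum>i\<in>I. d)"
      proof (rule sum_mono)
        fix i
        assume i: "i \<in> I"
        have "norm (l i (F k) - l i (F m)) \<le> sqrt d"
          using N[OF i, of k m] N1(2)[OF i] km by simp
        then have "(norm (l i (F k) - l i (F m)))\<^sup>2 \<le> (sqrt d)\<^sup>2"
          by (rule power_mono) simp
        then show "(norm (l i ?D))\<^sup>2 \<le> d"
          using d by (simp add: l_lin[OF i F(1) F(1)])
      qed
      then have "K * (\<Sum>i\<in>I. (norm (l i ?D))\<^sup>2) \<le> K * (real (card I) * d)"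
        using K by (intro mult_left_mono) simp_all
      moreover have "b ?D ?D \<le> 4 * d"
        using b.quadratic_diff_le[OF F(1) F(1), of k m] N0[of k] N0[of m] N1(1) km by simp
      ultimately have "c * n ?D ?D \<le> 4 * d + K * (real (card I) * d)"
        using garding[OF n.lin_mem[OF F(1) F(1)], of 1 k "-1" m] by linarith
      also have "\<dots> < (8 + 8 * K * real (card I)) * d"
      proof -
        have "0 \<le> K * (real (card I) * d)"
          using K d by simp
        then have "4 * d + K * (real (card I) * d) < 8 * d + 8 * (K * (real (card I) * d))"
          using d by linarith
        then show ?thesis
          by (simp add: algebra_simps)
      qed
      also have "\<dots> = c * e"
        using den by (simp add: d_def)
      finally show ?thesis
        using c by simp
    qed
    then show ?thesis by blast
  qed
  from complete[OF F(1) this] obtain f where f: "f \<in> X"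
    and lim: "(\<lambda>k. n (lin 1 (F k) (-1) f) (lin 1 (F k) (-1) f)) \<longlonglongrightarrow> 0"
    by blast
  \<comment> \<open>The limit has \<open>b f f = 0\<close>, hence \<open>n f f = 0\<close> by
    definiteness. The normalised vectors \<open>F k\<close> would then keep squared distance at
    least 1/2 from their own limit.\<close>
  have "b f f \<le> 2 * b (F k) (F k) + 2 * (C * n (lin 1 (F k) (-1) f) (lin 1 (F k) (-1) f))" for k
    using b.quadratic_le_diff[OF F(1) f, of k] bound[OF n.lin_mem[OF F(1) f], of 1 k "-1"] by linarith
  moreover have "(\<lambda>k. 2 * b (F k) (F k) + 2 * (C * n (lin 1 (F k) (-1) f) (lin 1 (F k) (-1) f))) \<longlonglongrightarrow> 2 * 0 + 2 * (C * 0)"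
    by (intro tendsto_intros bF lim)
  ultimately have "b f f \<le> 2 * 0 + 2 * (C * 0)"
    by (intro LIMSEQ_le_const[of _ _ "b f f"]) blast+
  then have nf: "n f f = 0"
    using b.nonneg[OF f] definite[OF f] by simp
  have le: "n (F k) (F k) \<le> 2 * n f f + 2 * n (lin 1 (F k) (-1) f) (lin 1 (F k) (-1) f)" for k
    using n.quadratic_lin[OF F(1) f, of 1 k "-1"] n.quadratic_lin[OF F(1) f, of 1 k "-2"]
      n.nonneg[OF n.lin_mem[OF F(1) f], of 1 k "-2"] by simp
  have "1/2 \<le> n (lin 1 (F k) (-1) f) (lin 1 (F k) (-1) f)" for k
    using le[of k] nf F(2)[of k] by linarith
  then have "1/2 \<le> (0::real)"
    by (intro LIMSEQ_le_const[OF lim] exI allI impI)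
  then show False by simp
qed

text \<open>The direct method for the functional \<open>J\<close>: coercivity bounds it from below,
  the parallelogram identity makes a minimising sequence Cauchy, and the first variation gives the
  equation for the limit.\<close>

lemma riesz_representation:
  assumes coercive: "c > 0" "\<And>f. f \<in> X \<Longrightarrow> c * n f f \<le> b f f"
    and \<phi>_lin: "\<And>f h s t. f \<in> X \<Longrightarrow> h \<in> X \<Longrightarrow> \<phi> (lin s f t h) = s * \<phi> f + t * \<phi> h"
    and \<phi>_bound: "\<And>f. f \<in> X \<Longrightarrow> (\<phi> f)\<^sup>2 \<le> M * n f f" and M: "M > 0"
  shows "\<exists>f\<in>X. \<forall>h\<in>X. b f h = \<phi> h"
proof -
  define J where "J f = b f f - 2 * \<phi> f" for f
  have J_ge: "- (M / c) \<le> J f" if f: "f \<in> X" for f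
  proof -
    \<comment> \<open>Expanded and divided by \<open>M * c\<close>, this square yields
      \<open>2 * \<phi> f \<le> c * n f f + M / c\<close>, in which the quadratic term is absorbed
      by coercivity.\<close>
    have "0 \<le> (c * \<phi> f - M)\<^sup>2"
      by simp
    then have "2 * (M * c) * \<phi> f \<le> c\<^sup>2 * (\<phi> f)\<^sup>2 + M\<^sup>2"
      by (simp add: power2_diff power_mult_distrib ac_simps)
    also have "\<dots> \<le> c\<^sup>2 * (M * n f f) + M\<^sup>2"
      using \<phi>_bound[OF f] by (intro add_right_mono mult_left_mono) simp_all
    also have "\<dots> = (M * c) * (c * n f f + M / c)"
      using coercive(1) by (simp add: power2_eq_square field_simps)
    finally have "(M * c) * (2 * \<phi> f) \<le> (M * c) * (c * n f f + M / c)"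
      by (simp add: algebra_simps)
    then have "2 * \<phi> f \<le> c * n f f + M / c"
      using M coercive(1) by (subst (asm) mult_le_cancel_left_pos) simp_all
    then show ?thesis
      using coercive(2)[OF f] by (simp add: J_def)
  qed
  define m where "m = Inf (J ` X)"
  have bdd: "bdd_below (J ` X)"
    using J_ge by (intro bdd_belowI[of _ "- (M / c)"]) auto
  have m_le: "m \<le> J f" if "f \<in> X" for f
    unfolding m_def using that bdd by (intro cInf_lower) simp_all
  have "\<exists>g\<in>X. J g < m + 1 / real (Suc k)" for k
  proof -
    have "m < m + 1 / real (Suc k)" by simp
    then show ?thesis
      using cInf_less_iff[of "J ` X" "m + 1 / real (Suc k)"] bdd nonempty unfolding m_def by auto
  qed
  then obtain g where g: "\<And>k. g k \<in> X" "\<And>k. J (g k) < m + 1 / real (Suc k)"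
    by metis
  have gap: "b (lin 1 (g k) (-1) (g l)) (lin 1 (g k) (-1) (g l)) \<le> 2 * (1 / real (Suc k)) + 2 * (1 / real (Suc l))" for k l
  proof -
    \<comment> \<open>Parallelogram identity at the midpoint, where the linear terms cancel; the
      midpoint cannot lie below the infimum \<open>m\<close>.\<close>
    have "2 * J (g k) + 2 * J (g l) - 4 * J (lin (1/2) (g k) (1/2) (g l)) = b (lin 1 (g k) (-1) (g l)) (lin 1 (g k) (-1) (g l))"
      unfolding J_def using b.quadratic_lin[OF g(1) g(1), of "1/2" k "1/2" l] b.quadratic_lin[OF g(1) g(1), of 1 k "-1" l]
        \<phi>_lin[OF g(1) g(1), of "1/2" k "1/2" l] by (simp add: power2_eq_square algebra_simps)
    moreover have "m \<le> J (lin (1/2) (g k) (1/2) (g l))"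
      by (intro m_le b.lin_mem g)
    ultimately show ?thesis
      using g(2)[of k] g(2)[of l] by linarith
  qed
  have inv0: "(\<lambda>k. 1 / real (Suc k)) \<longlonglongrightarrow> 0"
    using LIMSEQ_inverse_real_of_nat by (simp add: inverse_eq_divide)
  have "\<exists>N. \<forall>k\<ge>N. \<forall>l\<ge>N. n (lin 1 (g k) (-1) (g l)) (lin 1 (g k) (-1) (g l)) < e" if e: "e > 0" for e
  proof -
    have "c * e / 4 > 0" using coercive(1) e by simp
    from LIMSEQ_D[OF inv0 this] obtain N where N: "\<And>k. k \<ge> N \<Longrightarrow> 1 / real (Suc k) < c * e / 4"
      by auto
    have "n (lin 1 (g k) (-1) (g l)) (lin 1 (g k) (-1) (g l)) < e" if "k \<ge> N" "l \<ge> N" for k l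
    proof -
      have "c * n (lin 1 (g k) (-1) (g l)) (lin 1 (g k) (-1) (g l)) < c * e"
        using coercive(2)[OF b.lin_mem[OF g(1) g(1)], of 1 k "-1" l] gap[of k l] N[OF that(1)] N[OF that(2)] by linarith
      then show ?thesis
        using coercive(1) by simp
    qed
    then show ?thesis by blast
  qed
  from complete[OF g(1) this] obtain f where f: "f \<in> X"
    and lim: "(\<lambda>k. n (lin 1 (g k) (-1) f) (lin 1 (g k) (-1) f)) \<longlonglongrightarrow> 0"
    by blast
  have "b f h = \<phi> h" if h: "h \<in> X" for h
  proof -
    have "(\<lambda>k. (b (g k) h - b f h)\<^sup>2) \<longlonglongrightarrow> 0"
    proof (rule real_tendsto_sandwich[where f="\<lambda>k. 0" and h="\<lambda>k. C * n (lin 1 (g k) (-1) f) (lin 1 (g k) (-1) f) * b h h"])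
      have "(b (g k) h - b f h)\<^sup>2 \<le> C * n (lin 1 (g k) (-1) f) (lin 1 (g k) (-1) f) * b h h" for k
      proof -
        have "(b (g k) h - b f h)\<^sup>2 = (b (lin 1 (g k) (-1) f) h)\<^sup>2"
          by (simp add: b.lin_left g(1) f h)
        also have "\<dots> \<le> b (lin 1 (g k) (-1) f) (lin 1 (g k) (-1) f) * b h h"
          by (intro b.Cauchy_Schwarz b.lin_mem g f h)
        also have "\<dots> \<le> C * n (lin 1 (g k) (-1) f) (lin 1 (g k) (-1) f) * b h h"
          by (intro mult_right_mono bound b.lin_mem g f b.nonneg h)
        finally show ?thesis .
      qed
      then show "\<forall>\<^sub>F k in sequentially. (b (g k) h - b f h)\<^sup>2 \<le> C * n (lin 1 (g k) (-1) f) (lin 1 (g k) (-1) f) * b h h"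
        by (intro always_eventually allI)
      have "(\<lambda>k. C * n (lin 1 (g k) (-1) f) (lin 1 (g k) (-1) f) * b h h) \<longlonglongrightarrow> C * 0 * b h h"
        by (intro tendsto_intros lim)
      then show "(\<lambda>k. C * n (lin 1 (g k) (-1) f) (lin 1 (g k) (-1) f) * b h h) \<longlonglongrightarrow> 0"
        by simp
    qed simp_all
    from tendsto_real_sqrt[OF this] have "(\<lambda>k. b (g k) h - b f h) \<longlonglongrightarrow> 0"
      by (simp add: tendsto_rabs_zero_iff)
    then have blim: "(\<lambda>k. b (g k) h) \<longlonglongrightarrow> b f h"
      by (simp add: LIM_zero_iff)
    \<comment> \<open>\<open>x\<close> is the defect in the equation and \<open>t\<close> the step
      in direction \<open>h\<close> that exposes it; the \<open>+ 1\<close> in the denominator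
      covers \<open>b h h = 0\<close>. The variation is taken at \<open>g k\<close> and only
      afterwards passed to the limit, so that \<open>J\<close> is not evaluated at
      \<open>f\<close>.\<close>
    define x where "x = b f h - \<phi> h"
    define t where "t = - x / (b h h + 1)"
    have B: "b h h \<ge> 0"
      using h by (rule b.nonneg)
    have "0 \<le> 2 * t * (b (g k) h - \<phi> h) + t\<^sup>2 * b h h + 1 / real (Suc k)" for k
    proof -
      have "J (lin 1 (g k) t h) = J (g k) + (2 * t * (b (g k) h - \<phi> h) + t\<^sup>2 * b h h)"
        unfolding J_def using b.quadratic_lin[OF g(1) h, of 1 k t] \<phi>_lin[OF g(1) h, of 1 k t]
        by (simp add: algebra_simps)
      then show ?thesis
        using m_le[OF b.lin_mem[OF g(1) h], of 1 k t] g(2)[of k] by linarith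
    qed
    moreover have "(\<lambda>k. 2 * t * (b (g k) h - \<phi> h) + t\<^sup>2 * b h h + 1 / real (Suc k)) \<longlonglongrightarrow> 2 * t * (b f h - \<phi> h) + t\<^sup>2 * b h h + 0"
      by (intro tendsto_intros blim inv0)
    ultimately have "0 \<le> 2 * t * (b f h - \<phi> h) + t\<^sup>2 * b h h + 0"
      by (intro LIMSEQ_le_const[of _ _ 0]) auto
    also have "\<dots> = - (x\<^sup>2 * (b h h + 2) / (b h h + 1)\<^sup>2)"
    proof -
      have "b h h + 1 \<noteq> 0" using B by simp
      then show ?thesis
        unfolding x_def[symmetric] t_def by (simp add: power2_eq_square divide_simps) (simp add: algebra_simps)
    qed
    finally have "x\<^sup>2 * (b h h + 2) / (b h h + 1)\<^sup>2 \<le> 0"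
      by simp
    then have "x\<^sup>2 * (b h h + 2) \<le> 0"
      using B by (simp add: divide_le_0_iff)
    then have "x = 0"
      using B by (simp add: mult_le_0_iff)
    then show ?thesis
      by (simp add: x_def)
  qed
  with f show ?thesis by blast
qed

end

section \<open>Sobolev and compactness estimates for vector valued functions\<close>

lemma norm_vec_squared:
  fixes x :: "'a::real_normed_vector ^ 'm"
  shows "(norm x)\<^sup>2 = (\<Sum>j\<in>UNIV. (norm (x $ j))\<^sup>2)"
  by (simp add: norm_vec_def L2_set_def sum_nonneg)

lemma square_integrable_nth:
  fixes f :: "real^'n \<Rightarrow> complex^'m"
  assumes "square_integrable f"
  shows "square_integrable (\<lambda>x. f x $ j)"
  unfolding square_integrable_def
proof
  have [measurable]: "f \<in> borel_measurable lebesgue"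
    using assms by (rule square_integrable_measurable)
  have c: "continuous_on UNIV (\<lambda>x::complex^'m. x $ j)"
    by (rule linear_continuous_on[OF bounded_linear_vec_nth])
  show m: "(\<lambda>x. f x $ j) \<in> borel_measurable lebesgue"
    by (rule measurable_compose[OF _ borel_measurable_continuous_onI[OF c]]) measurable
  show "integrable lebesgue (\<lambda>x. (norm (f x $ j))\<^sup>2)"
  proof (rule Bochner_Integration.integrable_bound)
    show "integrable lebesgue (\<lambda>x. (norm (f x))\<^sup>2)"
      using assms by (simp add: square_integrable_def)
    show "(\<lambda>x. (norm (f x $ j))\<^sup>2) \<in> borel_measurable lebesgue"
      using m by measurable
    show "AE x in lebesgue. norm ((norm (f x $ j))\<^sup>2) \<le> norm ((norm (f x))\<^sup>2)"
      by (rule AE_I2) (simp add: power_mono Finite_Cartesian_Product.norm_nth_le)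
  qed
qed

lemma borel_measurable_vecI:
  fixes f :: "'a \<Rightarrow> complex^'m"
  assumes "\<And>j. (\<lambda>x. f x $ j) \<in> borel_measurable M"
  shows "f \<in> borel_measurable M"
proof (subst borel_measurable_euclidean_space, rule ballI)
  fix b :: "complex^'m"
  assume "b \<in> Basis"
  then obtain j u where b: "b = axis j u"
    unfolding Basis_vec_def by blast
  have "(\<lambda>x. f x $ j \<bullet> u) \<in> borel_measurable M"
    by (intro borel_measurable_inner assms borel_measurable_const)
  then show "(\<lambda>x. f x \<bullet> b) \<in> borel_measurable M"
    by (simp add: b inner_axis)
qed

lemma square_integrable_vecI:
  fixes f :: "real^'n \<Rightarrow> complex^'m"
  assumes "\<And>j. square_integrable (\<lambda>x. f x $ j)"
  shows "square_integrable f"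
  unfolding square_integrable_def
proof
  show "f \<in> borel_measurable lebesgue"
    by (rule borel_measurable_vecI[OF square_integrable_measurable[OF assms]])
  show "integrable lebesgue (\<lambda>x. (norm (f x))\<^sup>2)"
    unfolding norm_vec_squared using assms
    by (intro Bochner_Integration.integrable_sum) (simp add: square_integrable_def)
qed

lemma L2sq_vec:
  fixes f :: "real^'n \<Rightarrow> complex^'m"
  assumes "square_integrable f"
  shows "L2sq f = (\<Sum>j\<in>UNIV. L2sq (\<lambda>x. f x $ j))"
  unfolding L2sq_def norm_vec_squared using square_integrable_nth[OF assms]
  by (intro Bochner_Integration.integral_sum) (simp add: square_integrable_def)

text \<open>The Dirichlet integral of a vector valued function. For components in \<open>H1\<close>
  the chosen representatives of the weak derivatives do not affect its value.\<close>

definition grad_sq :: "(real^'n \<Rightarrow> complex^'m) \<Rightarrow> real" where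
  "grad_sq f = (\<Sum>j\<in>UNIV. \<Sum>i\<in>UNIV. L2sq (wderiv i (\<lambda>x. f x $ j)))"

lemma grad_sq_nonneg: "0 \<le> grad_sq f"
  by (simp add: grad_sq_def sum_nonneg)

lemma H1_translation_modulus:
  fixes f :: "real^'n \<Rightarrow> complex^'m"
  assumes H: "\<And>j. (\<lambda>x. f x $ j) \<in> H1"
  obtains f' where "translation_modulus f' (grad_sq f)" and "AE x in lborel. f x = f' x"
proof -
  have sf: "square_integrable f"
    by (intro square_integrable_vecI H1_square_integrable H)
  obtain f' where f' [measurable]: "f' \<in> borel_measurable borel" and ae: "AE x in lborel. f x = f' x"
    by (rule borel_representative[OF square_integrable_measurable[OF sf]])
  have sf': "square_integrable f'"
    using sf AE_completion[OF ae] by (rule square_integrable_cong)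
  have c: "continuous_on UNIV (\<lambda>x::complex^'m. x $ j)" for j
    by (rule linear_continuous_on[OF bounded_linear_vec_nth])
  have m [measurable]: "(\<lambda>x. f' x $ j) \<in> borel_measurable borel" for j
    by (rule measurable_compose[OF f' borel_measurable_continuous_onI[OF c]])
  have "(\<integral>\<^sup>+x. ennreal ((norm (f' (x + v) - f' x))\<^sup>2) \<partial>lborel) \<le> ennreal ((norm v)\<^sup>2 * grad_sq f)" for v
  proof -
    have "(\<integral>\<^sup>+x. ennreal ((norm (f' (x + v) - f' x))\<^sup>2) \<partial>lborel)
        = (\<integral>\<^sup>+x. (\<Sum>j\<in>UNIV. ennreal ((norm (f' (x + v) $ j - f' x $ j))\<^sup>2)) \<partial>lborel)"
      unfolding norm_vec_squared by (simp add: sum_ennreal)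
    also have "\<dots> = (\<Sum>j\<in>UNIV. \<integral>\<^sup>+x. ennreal ((norm (f' (x + v) $ j - f' x $ j))\<^sup>2) \<partial>lborel)"
    proof (rule nn_integral_sum)
      fix j
      have [measurable]: "(\<lambda>x. f' (x + v) $ j) \<in> borel_measurable borel"
        by (rule measurable_compose[of "\<lambda>x. x + v" borel borel, OF _ m]) measurable
      show "(\<lambda>x. ennreal ((norm (f' (x + v) $ j - f' x $ j))\<^sup>2)) \<in> borel_measurable lborel"
        by measurable
    qed
    also have "\<dots> \<le> (\<Sum>j\<in>UNIV. ennreal ((norm v)\<^sup>2 * (\<Sum>i\<in>UNIV. L2sq (wderiv i (\<lambda>x. f x $ j)))))"
    proof (rule sum_mono)
      fix j
      show "(\<integral>\<^sup>+x. ennreal ((norm (f' (x + v) $ j - f' x $ j))\<^sup>2) \<partial>lborel) \<le> ennreal ((norm v)\<^sup>2 * (\<Sum>i\<in>UNIV. L2sq (wderiv i (\<lambda>x. f x $ j))))"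
        by (rule H1_translation_bound[OF H m]) (use ae in \<open>eventually_elim, simp\<close>)
    qed
    also have "\<dots> = ennreal ((norm v)\<^sup>2 * grad_sq f)"
      by (subst sum_ennreal) (simp_all add: grad_sq_def sum_distrib_left sum_nonneg)
    finally show ?thesis .
  qed
  then have "translation_modulus f' (grad_sq f)"
    using f' sf' grad_sq_nonneg by (simp add: translation_modulus_def)
  then show ?thesis
    using ae by (rule that)
qed

lemma H1_L4:
  fixes f :: "real^'n \<Rightarrow> complex^'m" and h :: real
  assumes H: "\<And>j. (\<lambda>x. f x $ j) \<in> H1" and h: "0 < h" "h \<le> 1" and n: "CARD('n) \<le> 3"
  shows "integrable lebesgue (\<lambda>x. (norm (f x)) ^ 4)"
    and "(LINT x|lebesgue. (norm (f x)) ^ 4) \<le> sobolev_const TYPE('n) * h * (grad_sq f)\<^sup>2 + 8 / h ^ CARD('n) * (L2sq f)\<^sup>2"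
proof -
  have sf: "square_integrable f"
    by (intro square_integrable_vecI H1_square_integrable H)
  obtain f' where tm: "translation_modulus f' (grad_sq f)" and ae: "AE x in lborel. f x = f' x"
    by (rule H1_translation_modulus[OF H])
  have L: "L2sq f' = L2sq f"
    using L2sq_cong_AE[OF sf AE_completion[OF ae]] by simp
  have "(\<integral>\<^sup>+x. ennreal ((norm (f x)) ^ 4) \<partial>lebesgue) = (\<integral>\<^sup>+x. ennreal ((norm (f x)) ^ 4) \<partial>lborel)"
    by (rule nn_integral_completion)
  also have "\<dots> = (\<integral>\<^sup>+x. ennreal ((norm (f' x)) ^ 4) \<partial>lborel)"
    by (rule nn_integral_cong_AE) (use ae in \<open>eventually_elim, simp\<close>)
  also have "\<dots> \<le> ennreal (sobolev_const TYPE('n) * h * (grad_sq f)\<^sup>2 + 8 / h ^ CARD('n) * (L2sq f)\<^sup>2)"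
    using translation_modulus_L4[OF tm h n] by (simp add: L)
  finally have le: "(\<integral>\<^sup>+x. ennreal ((norm (f x)) ^ 4) \<partial>lebesgue)
      \<le> ennreal (sobolev_const TYPE('n) * h * (grad_sq f)\<^sup>2 + 8 / h ^ CARD('n) * (L2sq f)\<^sup>2)" .
  have [measurable]: "f \<in> borel_measurable lebesgue"
    using sf by (rule square_integrable_measurable)
  show int: "integrable lebesgue (\<lambda>x. (norm (f x)) ^ 4)"
  proof (rule integrableI_nonneg)
    show "(\<lambda>x. (norm (f x)) ^ 4) \<in> borel_measurable lebesgue"
      by measurable
    show "(\<integral>\<^sup>+x. ennreal ((norm (f x)) ^ 4) \<partial>lebesgue) < \<infinity>"
      using le by (rule le_less_trans) simp
  qed simp
  have nn: "0 \<le> sobolev_const TYPE('n) * h * (grad_sq f)\<^sup>2 + 8 / h ^ CARD('n) * (L2sq f)\<^sup>2"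
    using h sobolev_const_nonneg by (intro add_nonneg_nonneg mult_nonneg_nonneg) simp_all
  have "ennreal (LINT x|lebesgue. (norm (f x)) ^ 4) = (\<integral>\<^sup>+x. ennreal ((norm (f x)) ^ 4) \<partial>lebesgue)"
    by (rule nn_integral_eq_integral[OF int, symmetric]) simp
  then have "ennreal (LINT x|lebesgue. (norm (f x)) ^ 4)
      \<le> ennreal (sobolev_const TYPE('n) * h * (grad_sq f)\<^sup>2 + 8 / h ^ CARD('n) * (L2sq f)\<^sup>2)"
    using le by (simp only:)
  then show "(LINT x|lebesgue. (norm (f x)) ^ 4) \<le> sobolev_const TYPE('n) * h * (grad_sq f)\<^sup>2 + 8 / h ^ CARD('n) * (L2sq f)\<^sup>2"
    by (simp only: ennreal_le_iff[OF nn])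
qed

text \<open>The cell average without its normalisation and over \<open>lebesgue\<close>: for square
  integrable \<open>f\<close> it depends only on the class of \<open>f\<close> modulo null sets and
  is linear and bounded. These are the functionals \<open>l\<close> of the coercivity
  argument.\<close>

definition cell_integral :: "real \<Rightarrow> real^'n \<Rightarrow> (real^'n \<Rightarrow> 'b::euclidean_space) \<Rightarrow> 'b" where
  "cell_integral h z f = (LINT x|lebesgue. indicator (cell h z) x *\<^sub>R f x)"

lemma cell_square_integrable:
  assumes "h > 0"
  shows "square_integrable (indicator (cell h z) :: real^'n \<Rightarrow> real)"
  using emeasure_cell[OF assms, of z] by (intro square_integrable_indicator) simp_all

text \<open>The mesh is chosen so that the averaging error is at most \<open>e\<close> times the
  Dirichlet integral. \<open>Z\<close>, \<open>h\<close> and \<open>K\<close> are obtained before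
  \<open>f\<close>, so the same finitely many functionals serve all functions.\<close>

lemma H1_local_compactness:
  fixes R e :: real
  assumes e: "e > 0"
  obtains Z :: "(real^'n) set" and h K :: real where "finite Z" and "h > 0" and "K \<ge> 0"
    and "\<And>f :: real^'n \<Rightarrow> complex^'m. (\<And>j. (\<lambda>x. f x $ j) \<in> H1) \<Longrightarrow>
      (LINT x|lebesgue. indicator (cball 0 R) x * (norm (f x))\<^sup>2)
        \<le> e * grad_sq f + K * (\<Sum>z\<in>Z. (norm (cell_integral h z f))\<^sup>2)"
proof -
  define A where "A = (2 * real CARD('n)) ^ CARD('n) * (real CARD('n))\<^sup>2"
  \<comment> \<open>Solves \<open>2 * A * h\<^sup>2 \<le> e\<close>, where \<open>A\<close> is the
    constant of the mean square error; the \<open>+ 1\<close> keeps the denominator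
    positive.\<close>
  define h where "h = sqrt (e / (2 * (A + 1)))"
  have A: "A \<ge> 0" by (simp add: A_def)
  have h: "h > 0" using e A by (simp add: h_def)
  have h2: "2 * A * h\<^sup>2 \<le> e"
  proof -
    have "h\<^sup>2 = e / (2 * (A + 1))"
      using e A by (simp add: h_def)
    moreover have "2 * A * (e / (2 * (A + 1))) = e * (A / (A + 1))"
      using A by (simp add: divide_simps)
    ultimately have "2 * A * h\<^sup>2 = e * (A / (A + 1))"
      by (simp only:)
    also have "\<dots> \<le> e * 1"
      using e A by (intro mult_left_mono) simp_all
    also have "\<dots> = e"
      by simp
    finally show ?thesis .
  qed
  obtain Z :: "(real^'n) set" where Z: "finite Z" "cball 0 R \<subseteq> (\<Union>z\<in>Z. cell h z)"
    by (rule finite_cells_cover[OF h])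
  \<comment> \<open>This is \<open>2 * h ^ CARD('n)\<close> times the squared normalisation that
    turns cell averages into cell integrals.\<close>
  define K where "K = 2 / h ^ CARD('n)"
  have K: "K \<ge> 0" using h by (simp add: K_def)
  show ?thesis
  proof (rule that[OF Z(1) h K])
    fix f :: "real^'n \<Rightarrow> complex^'m"
    assume H: "\<And>j. (\<lambda>x. f x $ j) \<in> H1"
    have sf: "square_integrable f"
      by (intro square_integrable_vecI H1_square_integrable H)
    obtain f' where tm: "translation_modulus f' (grad_sq f)" and ae: "AE x in lborel. f x = f' x"
      by (rule H1_translation_modulus[OF H])
    have f' [measurable]: "f' \<in> borel_measurable borel" and sf': "square_integrable f'"
      using tm by (simp_all add: translation_modulus_def)
    have avg: "cell_average h f' z = (1 / h ^ CARD('n)) *\<^sub>R cell_integral h z f" for z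
    proof -
      have "cell_integral h z f = (LINT x|lebesgue. indicator (cell h z) x *\<^sub>R f' x)"
        unfolding cell_integral_def
      proof (rule integral_cong_AE)
        show "AE x in lebesgue. indicator (cell h z) x *\<^sub>R f x = indicator (cell h z) x *\<^sub>R f' x"
          using AE_completion[OF ae] by eventually_elim simp
      qed (intro borel_measurable_integrable square_integrable_bilinear[OF bounded_bilinear_scaleR] cell_square_integrable h sf sf')+
      also have "\<dots> = (LINT x|lborel. indicator (cell h z) x *\<^sub>R f' x)"
        by (rule integral_completion) measurable
      finally show ?thesis
        by (simp add: cell_average_def)
    qed
    have int: "integrable lebesgue (\<lambda>x. indicator (cball 0 R) x * (norm (f x))\<^sup>2)"
      using integrable_mult_indicator[of "cball 0 R" lebesgue "\<lambda>x. (norm (f x))\<^sup>2"] sf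
      by (simp add: square_integrable_def)
    have "ennreal (LINT x|lebesgue. indicator (cball 0 R) x * (norm (f x))\<^sup>2) = (\<integral>\<^sup>+x. ennreal (indicator (cball 0 R) x * (norm (f x))\<^sup>2) \<partial>lebesgue)"
      by (rule nn_integral_eq_integral[OF int, symmetric]) simp
    also have "\<dots> = (\<integral>\<^sup>+x. ennreal (indicator (cball 0 R) x * (norm (f x))\<^sup>2) \<partial>lborel)"
      by (rule nn_integral_completion)
    also have "\<dots> = (\<integral>\<^sup>+x. indicator (cball 0 R) x * ennreal ((norm (f' x))\<^sup>2) \<partial>lborel)"
      by (rule nn_integral_cong_AE) (use ae in \<open>eventually_elim, simp add: ennreal_mult split: split_indicator\<close>)
    also have "\<dots> \<le> ennreal (2 * (A * h\<^sup>2 * grad_sq f) + 2 * h ^ CARD('n) * (\<Sum>z\<in>Z. (norm (cell_average h f' z))\<^sup>2))"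
      using translation_modulus_compactness[OF tm h Z] by (simp only: A_def)
    also have "\<dots> \<le> ennreal (e * grad_sq f + K * (\<Sum>z\<in>Z. (norm (cell_integral h z f))\<^sup>2))"
    proof (intro ennreal_leI add_mono)
      show "2 * (A * h\<^sup>2 * grad_sq f) \<le> e * grad_sq f"
        using mult_right_mono[OF h2 grad_sq_nonneg[of f]] by simp
      have "2 * h ^ CARD('n) * (\<Sum>z\<in>Z. (norm (cell_average h f' z))\<^sup>2) = 2 * h ^ CARD('n) * (1 / h ^ CARD('n))\<^sup>2 * (\<Sum>z\<in>Z. (norm (cell_integral h z f))\<^sup>2)"
        by (simp add: avg power_mult_distrib power_divide sum_divide_distrib[symmetric])
      also have "2 * h ^ CARD('n) * (1 / h ^ CARD('n))\<^sup>2 = K"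
        using h by (simp add: K_def power2_eq_square)
      finally show "2 * h ^ CARD('n) * (\<Sum>z\<in>Z. (norm (cell_average h f' z))\<^sup>2) \<le> K * (\<Sum>z\<in>Z. (norm (cell_integral h z f))\<^sup>2)"
        by simp
    qed
    finally have le: "ennreal (LINT x|lebesgue. indicator (cball 0 R) x * (norm (f x))\<^sup>2)
        \<le> ennreal (e * grad_sq f + K * (\<Sum>z\<in>Z. (norm (cell_integral h z f))\<^sup>2))" .
    have nn: "0 \<le> e * grad_sq f + K * (\<Sum>z\<in>Z. (norm (cell_integral h z f))\<^sup>2)"
      using e K grad_sq_nonneg[of f] by (intro add_nonneg_nonneg mult_nonneg_nonneg sum_nonneg) simp_all
    show "(LINT x|lebesgue. indicator (cball 0 R) x * (norm (f x))\<^sup>2)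
        \<le> e * grad_sq f + K * (\<Sum>z\<in>Z. (norm (cell_integral h z f))\<^sup>2)"
      using le by (simp only: ennreal_le_iff[OF nn])
  qed
qed

section \<open>Forms of confined Schroedinger operators\<close>

lemma borel_measurable_cnj [measurable (raw)]:
  "f \<in> borel_measurable M \<Longrightarrow> (\<lambda>x. cnj (f x)) \<in> borel_measurable M"
  by (rule measurable_compose[OF _ borel_measurable_continuous_onI])
    (auto intro: continuous_intros)

lemma square_integrable_cnj: "square_integrable f \<Longrightarrow> square_integrable (\<lambda>x. cnj (f x))"
  by (auto simp: square_integrable_def borel_measurable_cnj)

lemma norm_vector_smult: "norm (c *s x) = cmod c * norm (x :: complex^'m)"
proof (rule power2_eq_imp_eq)
  show "(norm (c *s x))\<^sup>2 = (cmod c * norm x)\<^sup>2"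
    by (simp add: norm_vec_squared norm_mult power_mult_distrib sum_distrib_left)
qed simp_all

lemma norm_lincomb_squared_le:
  fixes f h :: "complex^'m"
  shows "(norm (c *s f + d *s h))\<^sup>2 \<le> 2 * (cmod c)\<^sup>2 * (norm f)\<^sup>2 + 2 * (cmod d)\<^sup>2 * (norm h)\<^sup>2"
  using norm_add_squared_le[of "c *s f" "d *s h"] by (simp add: norm_vector_smult power_mult_distrib)

lemma form_domainD:
  assumes "f \<in> form_domain V"
  shows form_domain_H1: "(\<lambda>x. f x $ j) \<in> H1"
    and form_domain_integrable: "integrable lebesgue (\<lambda>x. V x * (norm (f x))\<^sup>2)"
    and form_domain_square_integrable: "square_integrable f"
proof -
  show 1: "(\<lambda>x. f x $ j) \<in> H1" for j
    using assms by (simp add: form_domain_def)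
  show "integrable lebesgue (\<lambda>x. V x * (norm (f x))\<^sup>2)"
    using assms by (simp add: form_domain_def)
  show "square_integrable f"
    by (intro square_integrable_vecI H1_square_integrable 1)
qed

lemma L2_inner_integrable:
  assumes "square_integrable f" "square_integrable h"
  shows "integrable lebesgue (\<lambda>x. f x $ j * cnj (h x $ j))"
proof (rule square_integrable_bilinear[OF bounded_bilinear_mult])
  show "square_integrable (\<lambda>x. cnj (h x $ j))"
    by (intro square_integrable_cnj square_integrable_nth assms)
qed (rule square_integrable_nth[OF assms(1)])

lemma L2_inner_lincomb:
  assumes "square_integrable f" "square_integrable g" "square_integrable h"
  shows "L2_inner (\<lambda>x. c *s f x + d *s g x) h = c * L2_inner f h + d * L2_inner g h"
proof -
  have "L2_inner (\<lambda>x. c *s f x + d *s g x) h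
      = (LINT x|lebesgue. c * (\<Sum>j\<in>UNIV. f x $ j * cnj (h x $ j)) + d * (\<Sum>j\<in>UNIV. g x $ j * cnj (h x $ j)))"
    unfolding L2_inner_def
    by (simp add: distrib_right sum.distrib sum_distrib_left mult.assoc)
  also have "\<dots> = c * L2_inner f h + d * L2_inner g h"
    unfolding L2_inner_def
    by (subst Bochner_Integration.integral_add)
      (auto intro!: integrable_mult_right Bochner_Integration.integrable_sum L2_inner_integrable assms)
  finally show ?thesis .
qed

lemma L2_inner_cnj: "L2_inner h f = cnj (L2_inner f h)"
proof -
  have "cnj (L2_inner f h) = (LINT x|lebesgue. cnj (\<Sum>j\<in>UNIV. f x $ j * cnj (h x $ j)))"
    unfolding L2_inner_def by (rule Bochner_Integration.integral_cnj[symmetric])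
  then show ?thesis
    by (simp add: L2_inner_def mult.commute)
qed

lemma L2_inner_self:
  assumes "square_integrable f"
  shows "L2_inner f f = of_real (L2sq f)"
proof -
  have "(\<Sum>j\<in>UNIV. f x $ j * cnj (f x $ j)) = complex_of_real ((norm (f x))\<^sup>2)" for x
    by (simp add: norm_vec_squared complex_norm_square[symmetric] del: of_real_power)
  then show ?thesis
    by (simp add: L2_inner_def L2sq_def del: of_real_power)
qed

text \<open>Each of the two components is bounded by the product of the full norms, which gives 2
  before squaring.\<close>

lemma norm_L2_inner_le:
  assumes "square_integrable f" "square_integrable h"
  shows "(cmod (L2_inner f h))\<^sup>2 \<le> 4 * (L2sq f * L2sq h)"
proof -
  have "cmod (L2_inner f h) \<le> (LINT x|lebesgue. cmod (\<Sum>j\<in>UNIV. f x $ j * cnj (h x $ j)))"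
    unfolding L2_inner_def by (rule integral_norm_bound)
  also have "\<dots> \<le> (LINT x|lebesgue. 2 * (norm (f x) * norm (h x)))"
  proof (rule integral_mono)
    fix x
    have "cmod (\<Sum>j\<in>UNIV. f x $ j * cnj (h x $ j)) \<le> (\<Sum>j\<in>(UNIV::2 set). norm (f x) * norm (h x))"
      by (rule order_trans[OF norm_sum sum_mono])
        (simp add: norm_mult mult_mono Finite_Cartesian_Product.norm_nth_le)
    then show "cmod (\<Sum>j\<in>UNIV. f x $ j * cnj (h x $ j)) \<le> 2 * (norm (f x) * norm (h x))"
      by simp
  qed (intro integrable_norm Bochner_Integration.integrable_sum L2_inner_integrable assms
      integrable_mult_right square_integrable_norm_mult)+
  also have "\<dots> = 2 * (LINT x|lebesgue. norm (f x) * norm (h x))"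
    by (rule integral_mult_right_zero)
  finally have "(cmod (L2_inner f h))\<^sup>2 \<le> (2 * (LINT x|lebesgue. norm (f x) * norm (h x)))\<^sup>2"
    by (rule power_mono) simp
  also have "\<dots> \<le> 4 * (L2sq f * L2sq h)"
    using Cauchy_Schwarz_L2[OF assms] by (simp add: power_mult_distrib)
  finally show ?thesis .
qed

locale confined_form =
  fixes V :: "real^'n \<Rightarrow> real" and \<Phi> :: "real^'n \<Rightarrow> complex^2" and W :: "real^'n \<Rightarrow> complex^2^2" and C :: real
  assumes dimension: "CARD('n) \<le> 3"
    and V_nonneg: "0 \<le> V x"
    and V_measurable: "V \<in> borel_measurable lebesgue"
    and V_at_infinity: "filterlim V at_top at_infinity"
    and \<Phi>: "\<Phi> \<in> form_domain V"
    and W_measurable: "(\<lambda>x. W x $ j $ k) \<in> borel_measurable lebesgue"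
    and C_nonneg: "0 \<le> C"
    and W_bound: "AE x in lebesgue. \<forall>j k. cmod (W x $ j $ k) \<le> C * (1 + (norm (\<Phi> x))\<^sup>2)"
    and W_hermitian: "AE x in lebesgue. \<forall>j k. W x $ j $ k = cnj (W x $ k $ j)"
begin

lemma form_domain_lincomb:
  assumes "f \<in> form_domain V" "h \<in> form_domain V"
  shows "(\<lambda>x. c *s f x + d *s h x) \<in> form_domain V"
proof -
  have "(\<lambda>x. (c *s f x + d *s h x) $ j) \<in> H1" for j
    using H1_lincomb(1)[OF form_domain_H1[OF assms(1)] form_domain_H1[OF assms(2)], of c j d j] by simp
  moreover have "integrable lebesgue (\<lambda>x. V x * (norm (c *s f x + d *s h x))\<^sup>2)"
  proof (rule Bochner_Integration.integrable_bound)
    show "integrable lebesgue (\<lambda>x. 2 * (cmod c)\<^sup>2 * (V x * (norm (f x))\<^sup>2) + 2 * (cmod d)\<^sup>2 * (V x * (norm (h x))\<^sup>2))"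
      by (intro Bochner_Integration.integrable_add integrable_mult_right form_domain_integrable assms)
    have "square_integrable (\<lambda>x. c *s f x + d *s h x)"
      by (intro square_integrable_vecI H1_square_integrable calculation)
    then have [measurable]: "(\<lambda>x. c *s f x + d *s h x) \<in> borel_measurable lebesgue"
      by (rule square_integrable_measurable)
    note [measurable] = V_measurable
    show "(\<lambda>x. V x * (norm (c *s f x + d *s h x))\<^sup>2) \<in> borel_measurable lebesgue"
      by measurable
    show "AE x in lebesgue. norm (V x * (norm (c *s f x + d *s h x))\<^sup>2)
        \<le> norm (2 * (cmod c)\<^sup>2 * (V x * (norm (f x))\<^sup>2) + 2 * (cmod d)\<^sup>2 * (V x * (norm (h x))\<^sup>2))"
    proof (rule AE_I2)
      fix x
      have "V x * (norm (c *s f x + d *s h x))\<^sup>2 \<le> V x * (2 * (cmod c)\<^sup>2 * (norm (f x))\<^sup>2 + 2 * (cmod d)\<^sup>2 * (norm (h x))\<^sup>2)"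
        by (intro mult_left_mono norm_lincomb_squared_le V_nonneg)
      also have "\<dots> = 2 * (cmod c)\<^sup>2 * (V x * (norm (f x))\<^sup>2) + 2 * (cmod d)\<^sup>2 * (V x * (norm (h x))\<^sup>2)"
        by (simp add: algebra_simps)
      finally have "V x * (norm (c *s f x + d *s h x))\<^sup>2 \<le> 2 * (cmod c)\<^sup>2 * (V x * (norm (f x))\<^sup>2) + 2 * (cmod d)\<^sup>2 * (V x * (norm (h x))\<^sup>2)" .
      then show "norm (V x * (norm (c *s f x + d *s h x))\<^sup>2)
        \<le> norm (2 * (cmod c)\<^sup>2 * (V x * (norm (f x))\<^sup>2) + 2 * (cmod d)\<^sup>2 * (V x * (norm (h x))\<^sup>2))"
        using V_nonneg[of x] by (simp add: abs_mult)
    qed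
  qed
  ultimately show ?thesis
    by (simp add: form_domain_def)
qed

lemma square_integrable_norm_sq:
  assumes "f \<in> form_domain V"
  shows "square_integrable (\<lambda>x. (norm (f x))\<^sup>2)"
proof -
  have [measurable]: "f \<in> borel_measurable lebesgue"
    by (rule square_integrable_measurable[OF form_domain_square_integrable[OF assms]])
  have "(\<lambda>x. (norm (f x))\<^sup>2) \<in> borel_measurable lebesgue"
    by measurable
  then show ?thesis
    using H1_L4(1)[OF form_domain_H1[OF assms] _ _ dimension, of 1] by (simp add: square_integrable_def)
qed

text \<open>All functions of the form domain lie in \<open>L^4\<close>, so both
  \<open>(norm (\<Phi> x))\<^sup>2\<close> and \<open>norm (f x) * norm (h x)\<close> are square
  integrable, and so their product is integrable.\<close>

lemma weight_integrable:
  assumes "f \<in> form_domain V" "h \<in> form_domain V"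
  shows "integrable lebesgue (\<lambda>x. (1 + (norm (\<Phi> x))\<^sup>2) * (norm (f x) * norm (h x)))"
proof -
  have prod: "square_integrable (\<lambda>x. norm (f x) * norm (h x))"
    unfolding square_integrable_def
  proof
    have [measurable]: "f \<in> borel_measurable lebesgue" "h \<in> borel_measurable lebesgue"
      by (rule square_integrable_measurable[OF form_domain_square_integrable[OF assms(1)]],
          rule square_integrable_measurable[OF form_domain_square_integrable[OF assms(2)]])
    show "(\<lambda>x. norm (f x) * norm (h x)) \<in> borel_measurable lebesgue"
      by measurable
    have "integrable lebesgue (\<lambda>x. (norm (f x))\<^sup>2 * (norm (h x))\<^sup>2)"
      by (rule square_integrable_bilinear[OF bounded_bilinear_mult]; rule square_integrable_norm_sq; rule assms)
    then show "integrable lebesgue (\<lambda>x. (norm (norm (f x) * norm (h x)))\<^sup>2)"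
      by (simp add: power_mult_distrib abs_mult)
  qed
  have "integrable lebesgue (\<lambda>x. norm (f x) * norm (h x))"
    by (rule square_integrable_norm_mult[OF form_domain_square_integrable[OF assms(1)]
          form_domain_square_integrable[OF assms(2)]])
  moreover have "integrable lebesgue (\<lambda>x. (norm (\<Phi> x))\<^sup>2 * (norm (f x) * norm (h x)))"
    by (rule square_integrable_bilinear[OF bounded_bilinear_mult square_integrable_norm_sq[OF \<Phi>] prod])
  ultimately show ?thesis
    by (simp add: distrib_right)
qed

lemma kinetic_integrable:
  assumes "f \<in> form_domain V" "h \<in> form_domain V"
  shows "integrable lebesgue (\<lambda>x. wderiv i (\<lambda>y. f y $ j) x * cnj (wderiv i (\<lambda>y. h y $ j) x))"
proof (rule square_integrable_bilinear[OF bounded_bilinear_mult])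
  show "square_integrable (wderiv i (\<lambda>y. f y $ j))"
    by (intro square_integrable_wderiv form_domain_H1[OF assms(1)])
  show "square_integrable (\<lambda>x. cnj (wderiv i (\<lambda>y. h y $ j) x))"
    by (intro square_integrable_cnj square_integrable_wderiv form_domain_H1[OF assms(2)])
qed

lemma confinement_integrable:
  assumes "f \<in> form_domain V" "h \<in> form_domain V"
  shows "integrable lebesgue (\<lambda>x. of_real (V x) * f x $ j * cnj (h x $ j))"
proof (rule Bochner_Integration.integrable_bound)
  show "integrable lebesgue (\<lambda>x. V x * (norm (f x))\<^sup>2 + V x * (norm (h x))\<^sup>2)"
    by (intro Bochner_Integration.integrable_add form_domain_integrable assms)
  note [measurable] = V_measurable
  have [measurable]: "(\<lambda>x. f x $ j) \<in> borel_measurable lebesgue" "(\<lambda>x. h x $ j) \<in> borel_measurable lebesgue"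
    by (rule square_integrable_measurable[OF H1_square_integrable[OF form_domain_H1[OF assms(1)]]],
        rule square_integrable_measurable[OF H1_square_integrable[OF form_domain_H1[OF assms(2)]]])
  show "(\<lambda>x. of_real (V x) * f x $ j * cnj (h x $ j)) \<in> borel_measurable lebesgue"
    by measurable
  show "AE x in lebesgue. norm (of_real (V x) * f x $ j * cnj (h x $ j)) \<le> norm (V x * (norm (f x))\<^sup>2 + V x * (norm (h x))\<^sup>2)"
  proof (rule AE_I2)
    fix x
    have "cmod (f x $ j) * cmod (h x $ j) \<le> norm (f x) * norm (h x)"
      by (intro mult_mono Finite_Cartesian_Product.norm_nth_le) simp_all
    also have "\<dots> \<le> (norm (f x))\<^sup>2 + (norm (h x))\<^sup>2"
      using sum_squares_bound[of "norm (f x)" "norm (h x)"] mult_nonneg_nonneg[of "norm (f x)" "norm (h x)"]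
      by (simp del: mult_nonneg_nonneg)
    finally have "V x * (cmod (f x $ j) * cmod (h x $ j)) \<le> V x * ((norm (f x))\<^sup>2 + (norm (h x))\<^sup>2)"
      by (intro mult_left_mono V_nonneg)
    then show "norm (of_real (V x) * f x $ j * cnj (h x $ j)) \<le> norm (V x * (norm (f x))\<^sup>2 + V x * (norm (h x))\<^sup>2)"
      using V_nonneg[of x] by (simp add: norm_mult distrib_left)
  qed
qed

text \<open>The vectors are quantified inside the almost everywhere statement, so that a single null
  set serves all functions. The factor 2 counts the columns of \<open>W x\<close>.\<close>

lemma potential_bound:
  "AE x in lebesgue. \<forall>u v :: complex^2. \<forall>j. cmod ((W x *v u) $ j * cnj (v $ j)) \<le> 2 * C * ((1 + (norm (\<Phi> x))\<^sup>2) * (norm u * norm v))"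
  using W_bound
proof eventually_elim
  case (elim x)
  show ?case
  proof (intro allI)
    fix u v :: "complex^2" and j
    let ?w = "C * (1 + (norm (\<Phi> x))\<^sup>2)"
    have w: "0 \<le> ?w" using C_nonneg by simp
    have "cmod ((W x *v u) $ j) \<le> (\<Sum>k\<in>UNIV. cmod (W x $ j $ k) * cmod (u $ k))"
      by (simp add: matrix_vector_mult_def) (rule order_trans[OF norm_sum], simp add: norm_mult)
    also have "\<dots> \<le> (\<Sum>k\<in>(UNIV :: 2 set). ?w * norm u)"
      using elim w by (intro sum_mono mult_mono Finite_Cartesian_Product.norm_nth_le) simp_all
    also have "\<dots> = 2 * ?w * norm u" by simp
    finally have "cmod ((W x *v u) $ j) * cmod (v $ j) \<le> (2 * ?w * norm u) * norm v"
      using w by (intro mult_mono Finite_Cartesian_Product.norm_nth_le) simp_all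
    then show "cmod ((W x *v u) $ j * cnj (v $ j)) \<le> 2 * C * ((1 + (norm (\<Phi> x))\<^sup>2) * (norm u * norm v))"
      by (simp add: norm_mult mult.assoc)
  qed
qed

lemma potential_integrable:
  assumes "f \<in> form_domain V" "h \<in> form_domain V"
  shows "integrable lebesgue (\<lambda>x. (W x *v f x) $ j * cnj (h x $ j))"
proof (rule Bochner_Integration.integrable_bound)
  show "integrable lebesgue (\<lambda>x. 2 * C * ((1 + (norm (\<Phi> x))\<^sup>2) * (norm (f x) * norm (h x))))"
    by (intro integrable_mult_right weight_integrable assms)
  note [measurable] = W_measurable
  have [measurable]: "(\<lambda>x. f x $ j) \<in> borel_measurable lebesgue" "(\<lambda>x. h x $ j) \<in> borel_measurable lebesgue" for j
    by (rule square_integrable_measurable[OF H1_square_integrable[OF form_domain_H1[OF assms(1)]]],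
        rule square_integrable_measurable[OF H1_square_integrable[OF form_domain_H1[OF assms(2)]]])
  show "(\<lambda>x. (W x *v f x) $ j * cnj (h x $ j)) \<in> borel_measurable lebesgue"
    by (simp add: matrix_vector_mult_def) measurable
  show "AE x in lebesgue. norm ((W x *v f x) $ j * cnj (h x $ j)) \<le> norm (2 * C * ((1 + (norm (\<Phi> x))\<^sup>2) * (norm (f x) * norm (h x))))"
    using potential_bound
  proof eventually_elim
    case (elim x)
    then show ?case
      using C_nonneg by (simp add: abs_mult)
  qed
qed

lemma form_integrable:
  assumes "f \<in> form_domain V" "h \<in> form_domain V"
  shows "integrable lebesgue (\<lambda>x. \<Sum>j\<in>UNIV.
        1/2 * (\<Sum>i\<in>UNIV. wderiv i (\<lambda>y. f y $ j) x * cnj (wderiv i (\<lambda>y. h y $ j) x))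
        + of_real (V x) * f x $ j * cnj (h x $ j) + (W x *v f x) $ j * cnj (h x $ j))"
  by (intro Bochner_Integration.integrable_sum Bochner_Integration.integrable_add integrable_mult_right
      kinetic_integrable confinement_integrable potential_integrable assms)

lemma wderiv_lincomb_AE:
  assumes "f \<in> form_domain V" "g \<in> form_domain V"
  shows "AE x in lebesgue. \<forall>j i. wderiv i (\<lambda>y. (c *s f y + d *s g y) $ j) x
    = c * wderiv i (\<lambda>y. f y $ j) x + d * wderiv i (\<lambda>y. g y $ j) x"
proof -
  have "AE x in lebesgue. \<forall>j\<in>UNIV. \<forall>i\<in>UNIV. wderiv i (\<lambda>y. (c *s f y + d *s g y) $ j) x
    = c * wderiv i (\<lambda>y. f y $ j) x + d * wderiv i (\<lambda>y. g y $ j) x"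
  proof (intro AE_finite_allI)
    fix j i
    show "AE x in lebesgue. wderiv i (\<lambda>y. (c *s f y + d *s g y) $ j) x
        = c * wderiv i (\<lambda>y. f y $ j) x + d * wderiv i (\<lambda>y. g y $ j) x"
      using H1_lincomb(2)[OF form_domain_H1[OF assms(1)] form_domain_H1[OF assms(2)], of i c j d j] by simp
  qed simp_all
  then show ?thesis by simp
qed

lemma form_lincomb:
  assumes f: "f \<in> form_domain V" and g: "g \<in> form_domain V" and h: "h \<in> form_domain V"
  shows "schroedinger_form V W (\<lambda>x. c *s f x + d *s g x) h = c * schroedinger_form V W f h + d * schroedinger_form V W g h"
proof -
  let ?I = "\<lambda>f x. \<Sum>j\<in>UNIV.
        1/2 * (\<Sum>i\<in>UNIV. wderiv i (\<lambda>y. f y $ j) x * cnj (wderiv i (\<lambda>y. h y $ j) x))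
        + of_real (V x) * f x $ j * cnj (h x $ j) + (W x *v f x) $ j * cnj (h x $ j)"
  note int = form_integrable[OF f h] form_integrable[OF g h] form_integrable[OF form_domain_lincomb[OF f g] h]
  have "schroedinger_form V W (\<lambda>x. c *s f x + d *s g x) h = (LINT x|lebesgue. c * ?I f x + d * ?I g x)"
    unfolding schroedinger_form_def
  proof (rule integral_cong_AE)
    show "AE x in lebesgue. ?I (\<lambda>x. c *s f x + d *s g x) x = c * ?I f x + d * ?I g x"
      using wderiv_lincomb_AE[OF f g, of c d]
    proof eventually_elim
      case (elim x)
      have W: "(W x *v (c *s f x + d *s g x)) $ j = c * (W x *v f x) $ j + d * (W x *v g x) $ j" for j
        by (simp add: matrix_vector_mult_def distrib_left sum.distrib sum_distrib_left ac_simps)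
      show ?case
        unfolding elim[rule_format] W
        by (simp add: sum_distrib_left sum.distrib[symmetric]) (simp add: algebra_simps sum.distrib sum_distrib_left add_divide_distrib)
    qed
  qed (intro borel_measurable_integrable int Bochner_Integration.integrable_add integrable_mult_right)+
  also have "\<dots> = c * schroedinger_form V W f h + d * schroedinger_form V W g h"
    unfolding schroedinger_form_def
    by (subst Bochner_Integration.integral_add; (intro integrable_mult_right int)?) simp
  finally show ?thesis .
qed

lemma form_hermitian:
  assumes f: "f \<in> form_domain V" and h: "h \<in> form_domain V"
  shows "schroedinger_form V W h f = cnj (schroedinger_form V W f h)"
  unfolding schroedinger_form_def
proof (subst Bochner_Integration.integral_cnj[symmetric], rule integral_cong_AE)
  show "AE x in lebesgue. (\<Sum>j\<in>UNIV.
        1/2 * (\<Sum>i\<in>UNIV. wderiv i (\<lambda>y. h y $ j) x * cnj (wderiv i (\<lambda>y. f y $ j) x))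
        + of_real (V x) * h x $ j * cnj (f x $ j) + (W x *v h x) $ j * cnj (f x $ j))
      = cnj (\<Sum>j\<in>UNIV.
        1/2 * (\<Sum>i\<in>UNIV. wderiv i (\<lambda>y. f y $ j) x * cnj (wderiv i (\<lambda>y. h y $ j) x))
        + of_real (V x) * f x $ j * cnj (h x $ j) + (W x *v f x) $ j * cnj (h x $ j))"
    using W_hermitian
  proof eventually_elim
    case (elim x)
    have "(\<Sum>j\<in>UNIV. (W x *v h x) $ j * cnj (f x $ j)) = (\<Sum>j\<in>UNIV. \<Sum>k\<in>UNIV. W x $ j $ k * h x $ k * cnj (f x $ j))"
      by (simp add: matrix_vector_mult_def sum_distrib_right)
    also have "\<dots> = (\<Sum>k\<in>UNIV. \<Sum>j\<in>UNIV. W x $ j $ k * h x $ k * cnj (f x $ j))"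
      by (rule sum.swap)
    also have "\<dots> = (\<Sum>k\<in>UNIV. cnj ((W x *v f x) $ k * cnj (h x $ k)))"
    proof (rule sum.cong[OF refl])
      fix k
      have "cnj (W x $ k $ j) = W x $ j $ k" for j
        using elim[rule_format, of j k] by simp
      then show "(\<Sum>j\<in>UNIV. W x $ j $ k * h x $ k * cnj (f x $ j)) = cnj ((W x *v f x) $ k * cnj (h x $ k))"
        by (simp add: matrix_vector_mult_def sum_distrib_left ac_simps)
    qed
    finally show ?case
      by (simp add: sum.distrib cnj_sum ac_simps)
  qed
next
  note int = form_integrable[OF f h] form_integrable[OF h f]
  show "(\<lambda>x. \<Sum>j\<in>UNIV.
        1/2 * (\<Sum>i\<in>UNIV. wderiv i (\<lambda>y. h y $ j) x * cnj (wderiv i (\<lambda>y. f y $ j) x))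
        + of_real (V x) * h x $ j * cnj (f x $ j) + (W x *v h x) $ j * cnj (f x $ j)) \<in> borel_measurable lebesgue"
    using int(2) by (rule borel_measurable_integrable)
  show "(\<lambda>x. cnj (\<Sum>j\<in>UNIV.
        1/2 * (\<Sum>i\<in>UNIV. wderiv i (\<lambda>y. f y $ j) x * cnj (wderiv i (\<lambda>y. h y $ j) x))
        + of_real (V x) * f x $ j * cnj (h x $ j) + (W x *v f x) $ j * cnj (h x $ j))) \<in> borel_measurable lebesgue"
    using int(1) by (intro borel_measurable_integrable integrable_cnj)
qed

end

section \<open>Relative boundedness of the potential part\<close>

definition confinement :: "(real^'n \<Rightarrow> real) \<Rightarrow> (real^'n \<Rightarrow> complex^2) \<Rightarrow> real" where
  "confinement V f = (LINT x|lebesgue. V x * (norm (f x))\<^sup>2)"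

lemma sqrt_add_squares_le:
  assumes "a \<ge> 0" "b \<ge> 0" "s \<ge> 0" "t \<ge> 0"
  shows "sqrt (a * s\<^sup>2 + b * t\<^sup>2) \<le> sqrt a * s + sqrt b * t"
proof (rule real_le_lsqrt)
  show "a * s\<^sup>2 + b * t\<^sup>2 \<le> (sqrt a * s + sqrt b * t)\<^sup>2"
    using assms by (simp add: power2_sum power_mult_distrib)
qed (use assms in simp_all)

context confined_form
begin

lemma confinement_nonneg: "0 \<le> confinement V f"
  unfolding confinement_def by (rule integral_nonneg_AE) (simp add: V_nonneg)

lemma Re_form:
  assumes f: "f \<in> form_domain V"
  shows "Re (schroedinger_form V W f f) = grad_sq f / 2 + confinement V f
    + Re (LINT x|lebesgue. (\<Sum>j\<in>UNIV. (W x *v f x) $ j * cnj (f x $ j)))"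
proof -
  let ?k = "\<lambda>x. \<Sum>j\<in>UNIV. 1/2 * (\<Sum>i\<in>UNIV. wderiv i (\<lambda>y. f y $ j) x * cnj (wderiv i (\<lambda>y. f y $ j) x))"
    and ?v = "\<lambda>x. \<Sum>j\<in>UNIV. of_real (V x) * f x $ j * cnj (f x $ j)"
    and ?w = "\<lambda>x. \<Sum>j\<in>UNIV. (W x *v f x) $ j * cnj (f x $ j)"
  have k: "integrable lebesgue ?k" and v: "integrable lebesgue ?v" and w: "integrable lebesgue ?w"
    by (intro Bochner_Integration.integrable_sum integrable_mult_right kinetic_integrable
        confinement_integrable potential_integrable f)+
  have "schroedinger_form V W f f = (LINT x|lebesgue. (?k x + ?v x) + ?w x)"
    unfolding schroedinger_form_def by (simp only: sum.distrib)
  also have "\<dots> = (LINT x|lebesgue. ?k x) + (LINT x|lebesgue. ?v x) + (LINT x|lebesgue. ?w x)"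
    using k v w by simp
  also have "(LINT x|lebesgue. ?k x) = of_real (grad_sq f / 2)"
  proof -
    have "(LINT x|lebesgue. ?k x) = (\<Sum>j\<in>UNIV. 1/2 * (\<Sum>i\<in>UNIV. (LINT x|lebesgue. wderiv i (\<lambda>y. f y $ j) x * cnj (wderiv i (\<lambda>y. f y $ j) x))))"
    proof (subst Bochner_Integration.integral_sum)
      show "(\<Sum>j\<in>UNIV. (LINT x|lebesgue. 1/2 * (\<Sum>i\<in>UNIV. wderiv i (\<lambda>y. f y $ j) x * cnj (wderiv i (\<lambda>y. f y $ j) x))))
          = (\<Sum>j\<in>UNIV. 1/2 * (\<Sum>i\<in>UNIV. (LINT x|lebesgue. wderiv i (\<lambda>y. f y $ j) x * cnj (wderiv i (\<lambda>y. f y $ j) x))))"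
        by (rule sum.cong[OF refl], subst integral_mult_right_zero, subst Bochner_Integration.integral_sum)
          (simp_all add: kinetic_integrable f)
    qed (intro Bochner_Integration.integrable_sum integrable_mult_right kinetic_integrable f)
    also have "\<dots> = of_real (grad_sq f / 2)"
      by (simp add: grad_sq_def L2sq_def sum_divide_distrib complex_norm_square[symmetric] del: of_real_power)
    finally show ?thesis .
  qed
  also have "(LINT x|lebesgue. ?v x) = of_real (confinement V f)"
  proof -
    have "?v x = of_real (V x * (norm (f x))\<^sup>2)" for x
      by (simp add: norm_vec_squared sum_distrib_left mult.assoc complex_norm_square[symmetric] del: of_real_power)
    then show ?thesis
      by (simp add: confinement_def del: of_real_mult)
  qed
  finally show ?thesis
    by simp
qed

text \<open>Cauchy-Schwarz bounds the integral of |\<open>\<Phi>\<close>|^2 |f|^2 by the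
  \<open>L^2\<close> norms of the two squares, and the \<open>L^4\<close> estimate with a small mesh
  then controls the second one. The coefficient 1/4 is strictly below the kinetic coefficient 1/2,
  so a quarter of the Dirichlet integral survives.\<close>

lemma potential_relative_bound:
  "\<exists>M\<ge>0. \<forall>f\<in>form_domain V.
    cmod (LINT x|lebesgue. (\<Sum>j\<in>UNIV. (W x *v f x) $ j * cnj (f x $ j))) \<le> grad_sq f / 4 + M * L2sq f"
proof -
  define P where "P = L2sq (\<lambda>x. (norm (\<Phi> x))\<^sup>2)"
  define K where "K = sobolev_const TYPE('n)"
  \<comment> \<open>The requirement 4 C sqrt (P K h) \<le> 1/4 means 256 C^2 P K h \<le> 1, and
    \<open>h = 1 / D\<close> satisfies it; the summand 1 ensures h \<le> 1, as the
    \<open>L^4\<close> estimate demands.\<close>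
  define D where "D = 1 + 256 * C\<^sup>2 * P * K"
  define h where "h = 1 / D"
  define M where "M = 4 * C + 4 * C * sqrt (P * (8 / h ^ CARD('n)))"
  have P: "P \<ge> 0" and K: "K \<ge> 0"
    by (simp_all add: P_def K_def sobolev_const_nonneg)
  have den: "1 \<le> D"
    using P K by (simp add: D_def)
  then have h: "0 < h" "h \<le> 1"
    by (simp_all add: h_def)
  have Ch: "4 * C * sqrt (P * (K * h)) \<le> 1/4"
  proof -
    have "256 * C\<^sup>2 * P * K * h = (D - 1) / D"
      by (simp add: h_def D_def)
    also have "\<dots> \<le> 1"
      using den by simp
    finally have "256 * C\<^sup>2 * P * K * h \<le> 1" .
    then have "(16 * C * sqrt (P * (K * h)))\<^sup>2 \<le> 1\<^sup>2"
      using P K h by (simp add: power_mult_distrib mult.assoc)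
    then have "16 * C * sqrt (P * (K * h)) \<le> 1"
      by (rule power2_le_imp_le) simp
    then show ?thesis by simp
  qed
  have M: "M \<ge> 0"
    using C_nonneg P h by (simp add: M_def)
  have "cmod (LINT x|lebesgue. (\<Sum>j\<in>UNIV. (W x *v f x) $ j * cnj (f x $ j))) \<le> grad_sq f / 4 + M * L2sq f"
    if f: "f \<in> form_domain V" for f
  proof -
    let ?G = "grad_sq f" and ?S = "L2sq f"
    let ?T = "LINT x|lebesgue. (norm (\<Phi> x))\<^sup>2 * (norm (f x))\<^sup>2"
    have i1: "integrable lebesgue (\<lambda>x. (norm (\<Phi> x))\<^sup>2 * (norm (f x))\<^sup>2)"
      by (rule square_integrable_bilinear[OF bounded_bilinear_mult square_integrable_norm_sq[OF \<Phi>] square_integrable_norm_sq[OF f]])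
    have i2: "integrable lebesgue (\<lambda>x. (norm (f x))\<^sup>2)"
      using form_domain_square_integrable[OF f] by (simp add: square_integrable_def)
    have iw: "integrable lebesgue (\<lambda>x. \<Sum>j\<in>UNIV. (W x *v f x) $ j * cnj (f x $ j))"
      by (intro Bochner_Integration.integrable_sum potential_integrable f)
    have "cmod (LINT x|lebesgue. (\<Sum>j\<in>UNIV. (W x *v f x) $ j * cnj (f x $ j)))
        \<le> (LINT x|lebesgue. cmod (\<Sum>j\<in>UNIV. (W x *v f x) $ j * cnj (f x $ j)))"
      by (rule integral_norm_bound)
    also have "\<dots> \<le> (LINT x|lebesgue. 4 * C * ((norm (f x))\<^sup>2 + (norm (\<Phi> x))\<^sup>2 * (norm (f x))\<^sup>2))"
    proof (rule integral_mono_AE)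
      show "AE x in lebesgue. cmod (\<Sum>j\<in>UNIV. (W x *v f x) $ j * cnj (f x $ j)) \<le> 4 * C * ((norm (f x))\<^sup>2 + (norm (\<Phi> x))\<^sup>2 * (norm (f x))\<^sup>2)"
        using potential_bound
      proof eventually_elim
        case (elim x)
        have "cmod (\<Sum>j\<in>UNIV. (W x *v f x) $ j * cnj (f x $ j)) \<le> (\<Sum>j\<in>(UNIV::2 set). 2 * C * ((1 + (norm (\<Phi> x))\<^sup>2) * (norm (f x) * norm (f x))))"
          using elim by (intro order_trans[OF norm_sum sum_mono]) blast
        then show ?case
          by (simp add: power2_eq_square[of "norm (f x)"] algebra_simps)
      qed
    qed (intro integrable_norm iw integrable_mult_right Bochner_Integration.integrable_add i1 i2)+
    also have "\<dots> = 4 * C * (?S + ?T)"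
      using i1 i2 by (simp add: L2sq_def)
    also have "\<dots> \<le> 4 * C * (?S + (sqrt (P * (K * h)) * ?G + sqrt (P * (8 / h ^ CARD('n))) * ?S))"
    proof (intro mult_left_mono add_left_mono)
      have "?T\<^sup>2 = (LINT x|lebesgue. norm ((norm (\<Phi> x))\<^sup>2) * norm ((norm (f x))\<^sup>2))\<^sup>2"
        by simp
      also have "\<dots> \<le> P * L2sq (\<lambda>x. (norm (f x))\<^sup>2)"
        unfolding P_def by (rule Cauchy_Schwarz_L2[OF square_integrable_norm_sq[OF \<Phi>] square_integrable_norm_sq[OF f]])
      also have "L2sq (\<lambda>x. (norm (f x))\<^sup>2) = (LINT x|lebesgue. (norm (f x)) ^ 4)"
        by (simp add: L2sq_def)
      also have "P * (LINT x|lebesgue. (norm (f x)) ^ 4) \<le> P * (K * h * ?G\<^sup>2 + 8 / h ^ CARD('n) * ?S\<^sup>2)"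
        unfolding K_def by (intro mult_left_mono H1_L4(2)[OF form_domain_H1[OF f] h dimension] P)
      also have "\<dots> = (P * (K * h)) * ?G\<^sup>2 + (P * (8 / h ^ CARD('n))) * ?S\<^sup>2"
        by (simp add: algebra_simps)
      finally have "?T \<le> sqrt ((P * (K * h)) * ?G\<^sup>2 + (P * (8 / h ^ CARD('n))) * ?S\<^sup>2)"
        by (rule real_le_rsqrt)
      also have "\<dots> \<le> sqrt (P * (K * h)) * ?G + sqrt (P * (8 / h ^ CARD('n))) * ?S"
        using P K h by (intro sqrt_add_squares_le grad_sq_nonneg) simp_all
      finally show "?T \<le> sqrt (P * (K * h)) * ?G + sqrt (P * (8 / h ^ CARD('n))) * ?S" .
    qed (use C_nonneg in simp)
    also have "\<dots> = (4 * C * sqrt (P * (K * h))) * ?G + M * ?S"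
      by (simp add: M_def algebra_simps)
    also have "\<dots> \<le> 1/4 * ?G + M * ?S"
      by (intro add_right_mono mult_right_mono Ch grad_sq_nonneg)
    finally show ?thesis by simp
  qed
  with M show ?thesis by blast
qed

section \<open>Invariance under null sets and completeness of the form domain\<close>

lemma form_domain_cong:
  assumes f: "f \<in> form_domain V" and ae: "AE x in lebesgue. f x = g x"
  shows "g \<in> form_domain V"
proof -
  have "AE x in lebesgue. f x $ j = g x $ j" for j
    using ae by eventually_elim simp
  then have H: "(\<lambda>x. g x $ j) \<in> H1" for j
    by (rule H1_cong[OF form_domain_H1[OF f]])
  have "square_integrable g"
    using form_domain_square_integrable[OF f] ae by (rule square_integrable_cong)
  then have [measurable]: "g \<in> borel_measurable lebesgue"
    by (rule square_integrable_measurable)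
  note [measurable] = V_measurable
  have "integrable lebesgue (\<lambda>x. V x * (norm (g x))\<^sup>2)"
  proof (rule integrable_cong_AE_imp[OF form_domain_integrable[OF f]])
    show "(\<lambda>x. V x * (norm (g x))\<^sup>2) \<in> borel_measurable lebesgue"
      by measurable
    show "AE x in lebesgue. V x * (norm (f x))\<^sup>2 = V x * (norm (g x))\<^sup>2"
      using ae by eventually_elim simp
  qed
  with H show ?thesis
    by (simp add: form_domain_def)
qed

lemma form_cong:
  assumes f: "f \<in> form_domain V" and ae: "AE x in lebesgue. f x = g x" and h: "h \<in> form_domain V"
  shows "schroedinger_form V W f h = schroedinger_form V W g h"
  unfolding schroedinger_form_def
proof (rule integral_cong_AE)
  note g = form_domain_cong[OF f ae]
  have wd: "wderiv i (\<lambda>y. f y $ j) = wderiv i (\<lambda>y. g y $ j)" for i j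
    by (rule wderiv_cong[OF form_domain_H1[OF f]]) (use ae in \<open>eventually_elim, simp\<close>)
  show "AE x in lebesgue. (\<Sum>j\<in>UNIV.
        1/2 * (\<Sum>i\<in>UNIV. wderiv i (\<lambda>y. f y $ j) x * cnj (wderiv i (\<lambda>y. h y $ j) x))
        + of_real (V x) * f x $ j * cnj (h x $ j) + (W x *v f x) $ j * cnj (h x $ j))
      = (\<Sum>j\<in>UNIV.
        1/2 * (\<Sum>i\<in>UNIV. wderiv i (\<lambda>y. g y $ j) x * cnj (wderiv i (\<lambda>y. h y $ j) x))
        + of_real (V x) * g x $ j * cnj (h x $ j) + (W x *v g x) $ j * cnj (h x $ j))"
    using ae by eventually_elim (simp add: wd)
qed (intro borel_measurable_integrable form_integrable form_domain_cong[OF f ae] f h)+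

lemma form_zero:
  assumes f: "f \<in> form_domain V" and ae: "AE x in lebesgue. f x = 0" and h: "h \<in> form_domain V"
  shows "schroedinger_form V W f h = 0"
proof -
  have "AE x in lebesgue. f x = 0 *s f x + 0 *s f x"
    using ae by eventually_elim simp
  then have "schroedinger_form V W f h = schroedinger_form V W (\<lambda>x. 0 *s f x + 0 *s f x) h"
    by (rule form_cong[OF f _ h])
  then show ?thesis
    by (simp only: form_lincomb[OF f f h] mult_zero_left add_0_left)
qed

lemma L2sq_wderiv_diff:
  assumes f: "f \<in> form_domain V" and g: "g \<in> form_domain V"
  shows "L2sq (\<lambda>x. wderiv i (\<lambda>y. f y $ j) x - wderiv i (\<lambda>y. g y $ j) x) = L2sq (wderiv i (\<lambda>y. (f y - g y) $ j))"
proof (rule L2sq_cong_AE)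
  show "square_integrable (\<lambda>x. wderiv i (\<lambda>y. f y $ j) x - wderiv i (\<lambda>y. g y $ j) x)"
    by (intro square_integrable_diff square_integrable_wderiv form_domain_H1[OF f] form_domain_H1[OF g])
  show "AE x in lebesgue. wderiv i (\<lambda>y. f y $ j) x - wderiv i (\<lambda>y. g y $ j) x = wderiv i (\<lambda>y. (f y - g y) $ j) x"
    using H1_lincomb(2)[OF form_domain_H1[OF f, of j] form_domain_H1[OF g, of j], of i 1 "-1"]
    by eventually_elim simp
qed

lemma form_domain_diff:
  assumes "f \<in> form_domain V" "g \<in> form_domain V"
  shows "(\<lambda>x. f x - g x) \<in> form_domain V"
  using form_domain_lincomb[OF assms, of 1 "-1"] by simp

text \<open>The functions and each of their weak derivatives converge separately in
  \<open>L^2\<close>, and closedness of the weak derivative matches the limits. Since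
  \<open>V\<close> may be unbounded, \<open>L^2\<close> convergence says nothing about the
  confinement term; that term is treated by Fatou's lemma along an almost everywhere convergent
  subsequence.\<close>

lemma form_domain_complete:
  fixes F :: "nat \<Rightarrow> real^'n \<Rightarrow> complex^2"
  defines "N \<equiv> \<lambda>f. grad_sq f / 2 + confinement V f + L2sq f"
  assumes F: "\<And>k. F k \<in> form_domain V"
    and cauchy: "\<And>e. e > 0 \<Longrightarrow> \<exists>K. \<forall>k\<ge>K. \<forall>l\<ge>K. N (\<lambda>x. F k x - F l x) < e"
  shows "\<exists>f\<in>form_domain V. (\<lambda>k. N (\<lambda>x. F k x - f x)) \<longlonglongrightarrow> 0"
proof -
  have N_ge: "L2sq f \<le> N f" "confinement V f \<le> N f" "L2sq (wderiv i (\<lambda>x. f x $ j)) \<le> 2 * N f" for f i j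
  proof -
    have "L2sq (wderiv i (\<lambda>x. f x $ j)) \<le> (\<Sum>i\<in>UNIV. L2sq (wderiv i (\<lambda>x. f x $ j)))"
      by (rule member_le_sum) simp_all
    also have "\<dots> \<le> grad_sq f"
      unfolding grad_sq_def by (rule member_le_sum) (simp_all add: sum_nonneg)
    finally have "L2sq (wderiv i (\<lambda>x. f x $ j)) \<le> grad_sq f" .
    moreover have "2 * N f = grad_sq f + 2 * confinement V f + 2 * L2sq f"
      by (simp add: N_def)
    ultimately show "L2sq (wderiv i (\<lambda>x. f x $ j)) \<le> 2 * N f"
      using confinement_nonneg[of f] L2sq_nonneg[of f] by linarith
    show "L2sq f \<le> N f" "confinement V f \<le> N f"
      using confinement_nonneg[of f] grad_sq_nonneg[of f] L2sq_nonneg[of f] unfolding N_def by linarith+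
  qed
  have sF: "square_integrable (F k)" for k
    by (rule form_domain_square_integrable[OF F])
  have "\<exists>K. \<forall>k\<ge>K. \<forall>l\<ge>K. L2sq (\<lambda>x. F k x - F l x) < e" if "e > 0" for e
    using cauchy[OF that] N_ge(1) by (meson le_less_trans)
  then obtain f r where f: "square_integrable f" and Flim: "(\<lambda>k. L2sq (\<lambda>x. F k x - f x)) \<longlonglongrightarrow> 0"
    and r: "strict_mono (r :: nat \<Rightarrow> nat)" and ae: "AE x in lebesgue. (\<lambda>k. F (r k) x) \<longlonglongrightarrow> f x"
    by (rule L2_complete[OF sF])
  have "\<exists>g. square_integrable g \<and> (\<lambda>k. L2sq (\<lambda>x. wderiv i (\<lambda>y. F k y $ j) x - g x)) \<longlonglongrightarrow> 0" for i j
  proof -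
    have s: "square_integrable (wderiv i (\<lambda>y. F k y $ j))" for k
      by (intro square_integrable_wderiv form_domain_H1[OF F])
    have c: "\<exists>K. \<forall>k\<ge>K. \<forall>l\<ge>K. L2sq (\<lambda>x. wderiv i (\<lambda>y. F k y $ j) x - wderiv i (\<lambda>y. F l y $ j) x) < e" if "e > 0" for e
    proof -
      obtain K where K: "\<And>k l. k \<ge> K \<Longrightarrow> l \<ge> K \<Longrightarrow> N (\<lambda>x. F k x - F l x) < e / 2"
        using cauchy[of "e/2"] \<open>e > 0\<close> by auto
      have "L2sq (\<lambda>x. wderiv i (\<lambda>y. F k y $ j) x - wderiv i (\<lambda>y. F l y $ j) x) < e" if "k \<ge> K" "l \<ge> K" for k l
        using N_ge(3)[of i "\<lambda>x. F k x - F l x" j] K[OF that] unfolding L2sq_wderiv_diff[OF F F] by linarith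
      then show ?thesis by blast
    qed
    show ?thesis
      by (rule L2_complete[OF s c]) blast+
  qed
  then have "\<forall>p. \<exists>g. square_integrable g \<and> (\<lambda>k. L2sq (\<lambda>x. wderiv (fst p) (\<lambda>y. F k y $ snd p) x - g x)) \<longlonglongrightarrow> 0"
    by blast
  from choice[OF this] obtain G
    where G: "\<And>p. square_integrable (G p) \<and> (\<lambda>k. L2sq (\<lambda>x. wderiv (fst p) (\<lambda>y. F k y $ snd p) x - G p x)) \<longlonglongrightarrow> 0"
    by blast
  define g where "g i j = G (i, j)" for i j
  have g: "square_integrable (g i j)"
    and glim: "(\<lambda>k. L2sq (\<lambda>x. wderiv i (\<lambda>y. F k y $ j) x - g i j x)) \<longlonglongrightarrow> 0" for i j
    using G[of "(i, j)"] by (simp_all add: g_def)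
  have sf: "square_integrable (\<lambda>x. f x $ j)" for j
    by (rule square_integrable_nth[OF f])
  have wp: "weak_partial i (\<lambda>x. f x $ j) (g i j)" for i j
  proof (rule weak_partial_limit[OF square_integrable_nth[OF sF] sf _ g _ _ glim])
    show "square_integrable (wderiv i (\<lambda>y. F k y $ j))" "weak_partial i (\<lambda>x. F k x $ j) (wderiv i (\<lambda>y. F k y $ j))" for k
      by (intro wderiv form_domain_H1[OF F])+
    show "(\<lambda>k. L2sq (\<lambda>x. F k x $ j - f x $ j)) \<longlonglongrightarrow> 0"
    proof (rule real_tendsto_sandwich[where f="\<lambda>k. 0" and h="\<lambda>k. L2sq (\<lambda>x. F k x - f x)"])
      have "L2sq (\<lambda>x. F k x $ j - f x $ j) \<le> L2sq (\<lambda>x. F k x - f x)" for k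
        using member_le_sum[of j UNIV "\<lambda>j. L2sq (\<lambda>x. (F k x - f x) $ j)"]
        by (simp add: L2sq_vec[OF square_integrable_diff[OF sF f]])
      then show "\<forall>\<^sub>F k in sequentially. L2sq (\<lambda>x. F k x $ j - f x $ j) \<le> L2sq (\<lambda>x. F k x - f x)"
        by (intro always_eventually allI)
    qed (use Flim in simp_all)
  qed
  have H: "(\<lambda>x. f x $ j) \<in> H1" for j
    unfolding H1_def using sf wp g by blast
  have wd: "AE x in lebesgue. wderiv i (\<lambda>y. f y $ j) x = g i j x" for i j
    by (rule wderiv_eqI[OF H g wp])
  \<comment> \<open>Fatou is applied to the differences from a fixed \<open>F k\<close>. One
    application with bound 1 puts the limit into the form domain, and small bounds give convergence
    of the confinement term.\<close>
  have conf: "integrable lebesgue (\<lambda>x. V x * (norm (F k x - f x))\<^sup>2) \<and> confinement V (\<lambda>x. F k x - f x) \<le> e"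
    if K: "\<forall>k\<ge>K. \<forall>l\<ge>K. N (\<lambda>x. F k x - F l x) < e" and k: "k \<ge> K" for k K e
  proof -
    let ?g = "\<lambda>l x. V x * (norm (F k x - F (r (l + K)) x))\<^sup>2"
    have int: "integrable lebesgue (?g l)" for l
      by (rule form_domain_integrable[OF form_domain_diff[OF F F]])
    have le: "integral\<^sup>L lebesgue (?g l) \<le> e" for l
    proof -
      have "K \<le> r (l + K)"
        using seq_suble[OF r, of "l + K"] by linarith
      then have "N (\<lambda>x. F k x - F (r (l + K)) x) < e"
        using K k by blast
      then show ?thesis
        using N_ge(2)[of "\<lambda>x. F k x - F (r (l + K)) x"] by (simp add: confinement_def)
    qed
    have lim: "AE x in lebesgue. (\<lambda>l. ?g l x) \<longlonglongrightarrow> V x * (norm (F k x - f x))\<^sup>2"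
      using ae
    proof eventually_elim
      case (elim x)
      then show ?case
        by (intro tendsto_intros LIMSEQ_ignore_initial_segment[where f="\<lambda>k. F (r k) x"])
    qed
    note [measurable] = V_measurable square_integrable_measurable[OF f] square_integrable_measurable[OF sF]
    have m: "(\<lambda>x. V x * (norm (F k x - f x))\<^sup>2) \<in> borel_measurable lebesgue"
      by measurable
    show ?thesis
      unfolding confinement_def
      using fatou_bounded[of lebesgue ?g e, OF int _ le lim m] V_nonneg by simp
  qed
  have fX: "f \<in> form_domain V"
  proof -
    obtain K where "\<forall>k\<ge>K. \<forall>l\<ge>K. N (\<lambda>x. F k x - F l x) < 1"
      using cauchy[of 1] by auto
    from conf[OF this order_refl] have i: "integrable lebesgue (\<lambda>x. V x * (norm (F K x - f x))\<^sup>2)"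
      by blast
    have "integrable lebesgue (\<lambda>x. V x * (norm (f x))\<^sup>2)"
    proof (rule Bochner_Integration.integrable_bound)
      show "integrable lebesgue (\<lambda>x. 2 * (V x * (norm (F K x - f x))\<^sup>2) + 2 * (V x * (norm (F K x))\<^sup>2))"
        by (intro Bochner_Integration.integrable_add integrable_mult_right i form_domain_integrable[OF F])
      note [measurable] = V_measurable square_integrable_measurable[OF f]
      show "(\<lambda>x. V x * (norm (f x))\<^sup>2) \<in> borel_measurable lebesgue"
        by measurable
      show "AE x in lebesgue. norm (V x * (norm (f x))\<^sup>2) \<le> norm (2 * (V x * (norm (F K x - f x))\<^sup>2) + 2 * (V x * (norm (F K x))\<^sup>2))"
      proof (rule AE_I2)
        fix x
        have "(norm (f x))\<^sup>2 \<le> 2 * (norm (F K x - f x))\<^sup>2 + 2 * (norm (F K x))\<^sup>2"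
          using norm_add_squared_le[of "f x - F K x" "F K x"] by (simp add: norm_minus_commute)
        then have "V x * (norm (f x))\<^sup>2 \<le> V x * (2 * (norm (F K x - f x))\<^sup>2 + 2 * (norm (F K x))\<^sup>2)"
          by (intro mult_left_mono V_nonneg)
        then show "norm (V x * (norm (f x))\<^sup>2) \<le> norm (2 * (V x * (norm (F K x - f x))\<^sup>2) + 2 * (V x * (norm (F K x))\<^sup>2))"
          using V_nonneg[of x] by (simp add: distrib_left mult.left_commute)
      qed
    qed
    with H show ?thesis
      by (simp add: form_domain_def)
  qed
  have "(\<lambda>k. confinement V (\<lambda>x. F k x - f x)) \<longlonglongrightarrow> 0"
  proof (rule LIMSEQ_I)
    fix e :: real
    assume e: "e > 0"
    then obtain K where K: "\<forall>k\<ge>K. \<forall>l\<ge>K. N (\<lambda>x. F k x - F l x) < e / 2"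
      using cauchy[of "e/2"] by auto
    have "norm (confinement V (\<lambda>x. F k x - f x) - 0) < e" if "k \<ge> K" for k
      using conf[OF K that] confinement_nonneg[of "\<lambda>x. F k x - f x"] e by simp
    then show "\<exists>K. \<forall>k\<ge>K. norm (confinement V (\<lambda>x. F k x - f x) - 0) < e"
      by blast
  qed
  moreover have "(\<lambda>k. L2sq (wderiv i (\<lambda>x. (F k x - f x) $ j))) \<longlonglongrightarrow> 0" for i j
  proof -
    have "L2sq (wderiv i (\<lambda>x. (F k x - f x) $ j)) = L2sq (\<lambda>x. wderiv i (\<lambda>y. F k y $ j) x - g i j x)" for k
      unfolding L2sq_wderiv_diff[OF F fX, symmetric]
    proof (rule L2sq_cong_AE)
      show "square_integrable (\<lambda>x. wderiv i (\<lambda>y. F k y $ j) x - wderiv i (\<lambda>y. f y $ j) x)"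
        by (intro square_integrable_diff square_integrable_wderiv form_domain_H1[OF F] H)
      show "AE x in lebesgue. wderiv i (\<lambda>y. F k y $ j) x - wderiv i (\<lambda>y. f y $ j) x = wderiv i (\<lambda>y. F k y $ j) x - g i j x"
        using wd[of i j] by eventually_elim simp
    qed
    then show ?thesis
      using glim[of i j] by simp
  qed
  then have "(\<lambda>k. grad_sq (\<lambda>x. F k x - f x)) \<longlonglongrightarrow> (\<Sum>j\<in>(UNIV::2 set). \<Sum>i\<in>(UNIV::'n set). 0)"
    unfolding grad_sq_def by (intro tendsto_sum)
  ultimately have "(\<lambda>k. N (\<lambda>x. F k x - f x)) \<longlonglongrightarrow> 0 / 2 + 0 + 0"
    unfolding N_def using Flim by (intro tendsto_intros) simp_all
  then show ?thesis
    using fX by (intro bexI[of _ f]) simp_all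
qed

end

section \<open>Solvability\<close>

lemma cell_integral_lincomb:
  fixes f g :: "real^'n \<Rightarrow> complex^2"
  assumes "square_integrable f" "square_integrable g" "h > 0"
  shows "cell_integral h z (\<lambda>x. of_real s *s f x + of_real t *s g x) = s *\<^sub>R cell_integral h z f + t *\<^sub>R cell_integral h z g"
proof -
  have sm: "complex_of_real a *s v = a *\<^sub>R v" for a and v :: "complex^2"
    unfolding vec_eq_iff vector_smult_component vector_scaleR_component
    by (simp add: scaleR_conv_of_real)
  note int = square_integrable_bilinear[OF bounded_bilinear_scaleR cell_square_integrable[OF assms(3)]]
  have "cell_integral h z (\<lambda>x. of_real s *s f x + of_real t *s g x)
      = (LINT x|lebesgue. s *\<^sub>R (indicator (cell h z) x *\<^sub>R f x) + t *\<^sub>R (indicator (cell h z) x *\<^sub>R g x))"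
    unfolding cell_integral_def sm by (simp add: scaleR_add_right mult.commute)
  also have "\<dots> = s *\<^sub>R cell_integral h z f + t *\<^sub>R cell_integral h z g"
    unfolding cell_integral_def using int[OF assms(1)] int[OF assms(2)] by (simp del: scaleR_scaleR)
  finally show ?thesis .
qed

lemma norm_cell_integral_le:
  fixes f :: "real^'n \<Rightarrow> 'b::euclidean_space"
  assumes "square_integrable f" "h > 0"
  shows "(norm (cell_integral h z f))\<^sup>2 \<le> h ^ CARD('n) * L2sq f"
proof -
  let ?i = "indicator (cell h z) :: real^'n \<Rightarrow> real"
  have "norm (cell_integral h z f) \<le> (LINT x|lebesgue. norm (?i x *\<^sub>R f x))"
    unfolding cell_integral_def by (rule integral_norm_bound)
  then have "(norm (cell_integral h z f))\<^sup>2 \<le> (LINT x|lebesgue. norm (?i x) * norm (f x))\<^sup>2"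
    by (intro power_mono) simp_all
  also have "\<dots> \<le> L2sq ?i * L2sq f"
    by (rule Cauchy_Schwarz_L2[OF cell_square_integrable[OF assms(2)] assms(1)])
  also have "L2sq ?i = h ^ CARD('n)"
  proof -
    have "(\<lambda>x. (norm (?i x))\<^sup>2) = ?i"
      by (auto simp: indicator_def)
    then show ?thesis
      using emeasure_cell[OF assms(2), of z] assms(2) by (simp add: L2sq_def measure_def)
  qed
  finally show ?thesis .
qed

context confined_form
begin

text \<open>With the identity as potential the form is the squared form norm, kinetic plus
  confinement plus mass. The norm of the abstract setting is thereby another instance of the same
  locale and inherits all its facts.\<close>

lemma identity_form: "confined_form V \<Phi> (\<lambda>x. mat 1) 1"
proof
  show "0 \<le> V x" for x by (rule V_nonneg)
  show "AE x in lebesgue. \<forall>j k. cmod ((mat 1 :: complex^2^2) $ j $ k) \<le> 1 * (1 + (norm (\<Phi> x))\<^sup>2)"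
    by (rule AE_I2) (simp add: mat_def)
  show "AE x in lebesgue. \<forall>j k. (mat 1 :: complex^2^2) $ j $ k = cnj ((mat 1 :: complex^2^2) $ k $ j)"
    by (rule AE_I2) (simp add: mat_def)
qed (simp_all add: dimension V_measurable V_at_infinity \<Phi>)

lemma Re_identity_form:
  assumes "f \<in> form_domain V"
  shows "Re (schroedinger_form V (\<lambda>x. mat 1) f f) = grad_sq f / 2 + confinement V f + L2sq f"
proof -
  have "(LINT x|lebesgue. (\<Sum>j\<in>UNIV. ((mat 1 :: complex^2^2) *v f x) $ j * cnj (f x $ j))) = of_real (L2sq f)"
    using L2_inner_self[OF form_domain_square_integrable[OF assms]] by (simp add: L2_inner_def)
  then show ?thesis
    using confined_form.Re_form[OF identity_form assms] by simp
qed

text \<open>Where \<^term>\<open>V\<close> is large its form controls the mass, and on the remaining ball averages do.\<close>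

lemma mass_control:
  assumes e: "e > 0"
  obtains Z :: "(real^'n) set" and h K :: real where "finite Z" and "h > 0" and "K \<ge> 0"
    and "\<And>f. f \<in> form_domain V \<Longrightarrow>
      L2sq f \<le> e * (grad_sq f + confinement V f) + K * (\<Sum>z\<in>Z. (norm (cell_integral h z f))\<^sup>2)"
proof -
  have "\<forall>\<^sub>F x in at_infinity. 1 / e \<le> V x"
    using V_at_infinity by (simp add: filterlim_at_top)
  \<comment> \<open>Outside this ball \<open>1 \<le> e * V x\<close>, so there the mass is bounded
    by \<open>e\<close> times the confinement term.\<close>
  then obtain R where R: "\<And>x. R \<le> norm x \<Longrightarrow> 1 / e \<le> V x"
    unfolding eventually_at_infinity by blast
  obtain Z :: "(real^'n) set" and h K where Z: "finite Z" "h > 0" "K \<ge> 0"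
    and comp: "\<And>f :: real^'n \<Rightarrow> complex^2. (\<And>j. (\<lambda>x. f x $ j) \<in> H1) \<Longrightarrow>
      (LINT x|lebesgue. indicator (cball 0 R) x * (norm (f x))\<^sup>2)
        \<le> e * grad_sq f + K * (\<Sum>z\<in>Z. (norm (cell_integral h z f))\<^sup>2)"
    using H1_local_compactness[OF e, where R=R and 'm=2] by blast
  show ?thesis
  proof (rule that[OF Z])
    fix f
    assume f: "f \<in> form_domain V"
    have i: "integrable lebesgue (\<lambda>x. (norm (f x))\<^sup>2)"
      using form_domain_square_integrable[OF f] by (simp add: square_integrable_def)
    have ib: "integrable lebesgue (\<lambda>x. indicator (cball 0 R) x * (norm (f x))\<^sup>2)"
      using integrable_mult_indicator[of "cball 0 R" lebesgue "\<lambda>x. (norm (f x))\<^sup>2"] i by simp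
    have "L2sq f \<le> (LINT x|lebesgue. e * (V x * (norm (f x))\<^sup>2) + indicator (cball 0 R) x * (norm (f x))\<^sup>2)"
      unfolding L2sq_def
    proof (rule integral_mono[OF i])
      show "integrable lebesgue (\<lambda>x. e * (V x * (norm (f x))\<^sup>2) + indicator (cball 0 R) x * (norm (f x))\<^sup>2)"
        by (intro Bochner_Integration.integrable_add integrable_mult_right form_domain_integrable[OF f] ib)
      fix x
      show "(norm (f x))\<^sup>2 \<le> e * (V x * (norm (f x))\<^sup>2) + indicator (cball 0 R) x * (norm (f x))\<^sup>2"
      proof (cases "x \<in> cball 0 R")
        case True
        then show ?thesis
          using e V_nonneg[of x] by simp
      next
        case False
        then have "1 / e \<le> V x"
          by (intro R) simp
        then have "1 \<le> e * V x"
          using e by (simp add: pos_divide_le_eq mult.commute)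
        then have "1 * (norm (f x))\<^sup>2 \<le> e * V x * (norm (f x))\<^sup>2"
          by (rule mult_right_mono) simp
        then show ?thesis
          using False by (simp add: mult.assoc)
      qed
    qed
    also have "\<dots> = e * confinement V f + (LINT x|lebesgue. indicator (cball 0 R) x * (norm (f x))\<^sup>2)"
      using form_domain_integrable[OF f] ib by (simp add: confinement_def)
    also have "\<dots> \<le> e * confinement V f + (e * grad_sq f + K * (\<Sum>z\<in>Z. (norm (cell_integral h z f))\<^sup>2))"
      by (intro add_left_mono comp form_domain_H1[OF f])
    finally show "L2sq f \<le> e * (grad_sq f + confinement V f) + K * (\<Sum>z\<in>Z. (norm (cell_integral h z f))\<^sup>2)"
      by (simp add: algebra_simps)
  qed
qed

text \<open>Passing to the real part and to real scalars loses no information: the imaginary part of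
  a form value is the real part of the value at a vector multiplied by \<open>\<i>\<close>.\<close>

lemma symmetric_form_Re:
  assumes "\<And>f. f \<in> form_domain V \<Longrightarrow> 0 \<le> Re (schroedinger_form V W f f)"
  shows "symmetric_form (form_domain V) (\<lambda>s f t h x. of_real s *s f x + of_real t *s h x)
    (\<lambda>f h. Re (schroedinger_form V W f h))"
proof
  show "Re (schroedinger_form V W f h) = Re (schroedinger_form V W h f)"
    if "f \<in> form_domain V" "h \<in> form_domain V" for f h
    using form_hermitian[OF that] by simp
qed (simp_all add: form_domain_lincomb form_lincomb assms)

text \<open>The relative bound leaves a quarter of the Dirichlet integral and the full confinement,
  up to a multiple of the mass; the mass is in turn bounded by a small part of these and finitely
  many cell integrals. Positive definiteness supplies the definiteness needed to upgrade this
  Garding inequality to coercivity, and Riesz representation then solves the equation.\<close>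

lemma solvable:
  assumes pd: "positive_definite_form V W" and u: "square_integrable u"
  shows "\<exists>f\<in>form_domain V. \<forall>h\<in>form_domain V. schroedinger_form V W f h = L2_inner u h"
proof -
  let ?lin = "\<lambda>s (f :: real^'n \<Rightarrow> complex^2) t h x. complex_of_real s *s f x + complex_of_real t *s h x"
  let ?n = "\<lambda>f h. Re (schroedinger_form V (\<lambda>x. mat 1) f h)" and ?b = "\<lambda>f h. Re (schroedinger_form V W f h)"
  obtain M where M: "M \<ge> 0" and rel: "\<And>f. f \<in> form_domain V \<Longrightarrow>
    cmod (LINT x|lebesgue. (\<Sum>j\<in>UNIV. (W x *v f x) $ j * cnj (f x $ j))) \<le> grad_sq f / 4 + M * L2sq f"
    using potential_relative_bound by blast
  have b_bounds: "grad_sq f / 4 + confinement V f - M * L2sq f \<le> ?b f f"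
    "?b f f \<le> 3 * grad_sq f / 4 + confinement V f + M * L2sq f" if f: "f \<in> form_domain V" for f
    using Re_form[OF f] rel[OF f] abs_Re_le_cmod[of "LINT x|lebesgue. (\<Sum>j\<in>UNIV. (W x *v f x) $ j * cnj (f x $ j))"]
    by linarith+
  have b_nonneg: "0 \<le> ?b f f" if f: "f \<in> form_domain V" for f
    using pd f form_zero[OF f _ f] unfolding positive_definite_form_def
    by (cases "AE x in lebesgue. f x = 0") (auto simp: less_imp_le)
  have n_nonneg: "0 \<le> ?n f f" if f: "f \<in> form_domain V" for f
    using Re_identity_form[OF f] grad_sq_nonneg[of f] confinement_nonneg[of f] L2sq_nonneg[of f] by linarith
  interpret n: symmetric_form "form_domain V" ?lin ?n
    by (rule confined_form.symmetric_form_Re[OF identity_form n_nonneg])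
  interpret b: symmetric_form "form_domain V" ?lin ?b
    by (rule symmetric_form_Re[OF b_nonneg])
  have diff: "?lin 1 f (- 1) h = (\<lambda>x. f x - h x)" for f h
    by (simp add: fun_eq_iff)
  \<comment> \<open>\<open>2 + M\<close> dominates the upper bound of \<open>?b\<close>: its half
    exceeds 3/4 on the gradient, and it exceeds 1 on the confinement and \<open>M\<close> on the
    mass.\<close>
  interpret complete_form_pair "form_domain V" ?lin ?n ?b "2 + M"
  proof
    fix f
    assume f: "f \<in> form_domain V"
    have nn: "0 \<le> M * grad_sq f" "0 \<le> M * confinement V f"
      by (intro mult_nonneg_nonneg M grad_sq_nonneg confinement_nonneg)+
    have "(2 + M) * ?n f f = grad_sq f + 2 * confinement V f + 2 * L2sq f + M * grad_sq f / 2 + M * confinement V f + M * L2sq f"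
      unfolding Re_identity_form[OF f] by (simp add: algebra_simps)
    then show "?b f f \<le> (2 + M) * ?n f f"
      using b_bounds(2)[OF f] grad_sq_nonneg[of f] confinement_nonneg[of f] L2sq_nonneg[of f] nn by linarith
  next
    show "form_domain V \<noteq> {}"
      using \<Phi> by blast
  next
    fix F :: "nat \<Rightarrow> real^'n \<Rightarrow> complex^2"
    assume F: "\<And>k. F k \<in> form_domain V"
      and cauchy: "\<And>e. e > 0 \<Longrightarrow> \<exists>N. \<forall>k\<ge>N. \<forall>l\<ge>N. ?n (?lin 1 (F k) (- 1) (F l)) (?lin 1 (F k) (- 1) (F l)) < e"
    have "\<exists>K. \<forall>k\<ge>K. \<forall>l\<ge>K. grad_sq (\<lambda>x. F k x - F l x) / 2 + confinement V (\<lambda>x. F k x - F l x) + L2sq (\<lambda>x. F k x - F l x) < e"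
      if "e > 0" for e
      using cauchy[OF that] unfolding diff Re_identity_form[OF form_domain_diff[OF F F]] .
    from form_domain_complete[OF F this] obtain f where f: "f \<in> form_domain V"
      and lim: "(\<lambda>k. grad_sq (\<lambda>x. F k x - f x) / 2 + confinement V (\<lambda>x. F k x - f x) + L2sq (\<lambda>x. F k x - f x)) \<longlonglongrightarrow> 0"
      by blast
    have "(\<lambda>k. ?n (?lin 1 (F k) (- 1) f) (?lin 1 (F k) (- 1) f)) \<longlonglongrightarrow> 0"
      using lim unfolding diff Re_identity_form[OF form_domain_diff[OF F f]] .
    with f show "\<exists>f\<in>form_domain V. (\<lambda>k. ?n (?lin 1 (F k) (- 1) f) (?lin 1 (F k) (- 1) f)) \<longlonglongrightarrow> 0"
      by blast
  qed
  \<comment> \<open>With this constant \<open>M + 1\<close> times the mass costs 1/8 of gradient and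
    confinement. There remain 1/8 of the gradient, 7/8 of the confinement and one copy of the mass,
    which together dominate a quarter of the form norm.\<close>
  obtain Z :: "(real^'n) set" and h K where Z: "finite Z" "h > 0" "K \<ge> 0"
    and mass: "\<And>f. f \<in> form_domain V \<Longrightarrow>
      L2sq f \<le> 1 / (8 * (M + 1)) * (grad_sq f + confinement V f) + K * (\<Sum>z\<in>Z. (norm (cell_integral h z f))\<^sup>2)"
    using mass_control[of "1 / (8 * (M + 1))"] M by auto
  have "\<exists>c'>0. \<forall>f\<in>form_domain V. c' * ?n f f \<le> ?b f f"
  proof (rule coercive[where I=Z and l="cell_integral h" and M="h ^ CARD('n)" and c="1/4" and K="(M + 1) * K"])
    fix f
    assume f: "f \<in> form_domain V" and "?b f f = 0"
    then have ae: "AE x in lebesgue. f x = 0"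
      using pd unfolding positive_definite_form_def by force
    show "?n f f = 0"
      using confined_form.form_zero[OF identity_form f ae f] by simp
  next
    fix z f g s t
    assume "f \<in> form_domain V" "g \<in> form_domain V"
    then show "cell_integral h z (?lin s f t g) = s *\<^sub>R cell_integral h z f + t *\<^sub>R cell_integral h z g"
      by (intro cell_integral_lincomb form_domain_square_integrable Z)
  next
    fix z f
    assume f: "f \<in> form_domain V"
    have "L2sq f \<le> ?n f f"
      using Re_identity_form[OF f] grad_sq_nonneg[of f] confinement_nonneg[of f] by linarith
    then have "h ^ CARD('n) * L2sq f \<le> h ^ CARD('n) * ?n f f"
      using Z(2) by (intro mult_left_mono) simp_all
    then show "(norm (cell_integral h z f))\<^sup>2 \<le> h ^ CARD('n) * ?n f f"
      using norm_cell_integral_le[OF form_domain_square_integrable[OF f] Z(2), of z] by linarith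
  next
    fix f
    assume f: "f \<in> form_domain V"
    let ?\<Sigma> = "\<Sum>z\<in>Z. (norm (cell_integral h z f))\<^sup>2"
    have "(M + 1) * L2sq f \<le> (M + 1) * (1 / (8 * (M + 1)) * (grad_sq f + confinement V f) + K * ?\<Sigma>)"
      using M by (intro mult_left_mono mass f) simp
    also have "\<dots> = (grad_sq f + confinement V f) / 8 + (M + 1) * K * ?\<Sigma>"
    proof -
      have "(M + 1) * (1 / (8 * (M + 1)) * X + K * Y) = X / 8 + (M + 1) * K * Y" for X Y :: real
      proof -
        have "(M + 1) * (1 / (8 * (M + 1)) * X) = X / 8"
          using M by (simp add: divide_simps)
        then show ?thesis
          by (simp only: distrib_left mult.assoc)
      qed
      then show ?thesis .
    qed
    finally have "M * L2sq f + L2sq f \<le> (grad_sq f + confinement V f) / 8 + (M + 1) * K * ?\<Sigma>"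
      by (simp add: distrib_right)
    moreover have "1/4 * a \<le> b + k" if "m + s \<le> (g + v) / 8 + k" "g / 4 + v - m \<le> b" "a = g / 2 + v + s"
      "0 \<le> g" "0 \<le> v" "0 \<le> s" for a b k m s g v :: real
      using that by (simp add: field_simps)
    ultimately show "1/4 * ?n f f \<le> ?b f f + (M + 1) * K * ?\<Sigma>"
      using b_bounds(1)[OF f] Re_identity_form[OF f] grad_sq_nonneg[of f] confinement_nonneg[of f] L2sq_nonneg[of f] by blast
  qed (use Z M in simp_all)
  then obtain c where c: "c > 0" "\<And>f. f \<in> form_domain V \<Longrightarrow> c * ?n f f \<le> ?b f f"
    by blast
  have "\<exists>f\<in>form_domain V. \<forall>h\<in>form_domain V. ?b f h = Re (L2_inner h u)"
  \<comment> \<open>The constant is the bound of the functional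
    \<open>h \<mapsto> Re (L2_inner h u)\<close>; the added 1 makes it positive even if
    \<open>u\<close> vanishes almost everywhere.\<close>
  proof (rule riesz_representation[OF c, where M="4 * L2sq u + 1"])
    fix f g :: "real^'n \<Rightarrow> complex^2" and s t
    assume "f \<in> form_domain V" "g \<in> form_domain V"
    then show "Re (L2_inner (?lin s f t g) u) = s * Re (L2_inner f u) + t * Re (L2_inner g u)"
      by (simp add: L2_inner_lincomb form_domain_square_integrable u)
  next
    fix f
    assume f: "f \<in> form_domain V"
    have "(Re (L2_inner f u))\<^sup>2 \<le> (cmod (L2_inner f u))\<^sup>2"
      using power_mono[OF abs_Re_le_cmod[of "L2_inner f u"], of 2] by simp
    also have "\<dots> \<le> 4 * L2sq u * L2sq f"
      using norm_L2_inner_le[OF form_domain_square_integrable[OF f] u] by (simp add: mult.commute)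
    also have "\<dots> \<le> (4 * L2sq u + 1) * ?n f f"
      using Re_identity_form[OF f] grad_sq_nonneg[of f] confinement_nonneg[of f]
      by (intro mult_mono) simp_all
    finally show "(Re (L2_inner f u))\<^sup>2 \<le> (4 * L2sq u + 1) * ?n f f" .
  next
    show "0 < 4 * L2sq u + 1"
      by (intro add_nonneg_pos mult_nonneg_nonneg L2sq_nonneg) simp_all
  qed
  then obtain f where f: "f \<in> form_domain V" and re: "\<And>h. h \<in> form_domain V \<Longrightarrow> ?b f h = Re (L2_inner h u)"
    by blast
  have "schroedinger_form V W f h = L2_inner u h" if h: "h \<in> form_domain V" for h
  proof (rule complex_eqI)
    show "Re (schroedinger_form V W f h) = Re (L2_inner u h)"
      using re[OF h] L2_inner_cnj[of u h] by simp
    \<comment> \<open>The form is antilinear in its second argument, so testing with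
      \<open>\<i>\<close> times \<open>h\<close> turns the imaginary part of the equation into a
      real part already known.\<close>
    have ih: "(\<lambda>x. \<i> *s h x + 0 *s h x) \<in> form_domain V"
      by (rule form_domain_lincomb[OF h h])
    have "schroedinger_form V W f (\<lambda>x. \<i> *s h x + 0 *s h x) = - \<i> * schroedinger_form V W f h"
      using form_hermitian[OF ih f] form_hermitian[OF h f] form_lincomb[OF h h f, of \<i> 0] by simp
    moreover have "L2_inner (\<lambda>x. \<i> *s h x + 0 *s h x) u = \<i> * L2_inner h u"
      using L2_inner_lincomb[OF form_domain_square_integrable[OF h] form_domain_square_integrable[OF h] u, of \<i> 0] by simp
    ultimately show "Im (schroedinger_form V W f h) = Im (L2_inner u h)"
      using re[OF ih] L2_inner_cnj[of u h] by simp
  qed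
  with f show ?thesis by blast
qed

section \<open>Operators of forms: congruence, linearity, symmetry and injectivity\<close>

lemma L2_inner_cong:
  assumes "square_integrable u" "AE x in lebesgue. u x = v x" "square_integrable h"
  shows "L2_inner u h = L2_inner v h"
  unfolding L2_inner_def
proof (rule integral_cong_AE)
  show "AE x in lebesgue. (\<Sum>j\<in>UNIV. u x $ j * cnj (h x $ j)) = (\<Sum>j\<in>UNIV. v x $ j * cnj (h x $ j))"
    using assms(2) by eventually_elim simp
qed (intro borel_measurable_integrable Bochner_Integration.integrable_sum L2_inner_integrable
    assms(1,3) square_integrable_cong[OF assms(1,2)])+

lemma operator_cong:
  assumes fu: "(f, u) \<in> schroedinger_op V W" and "AE x in lebesgue. f x = g x" "AE x in lebesgue. u x = v x"
  shows "(g, v) \<in> schroedinger_op V W"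
proof -
  have f: "f \<in> form_domain V" and u: "square_integrable u"
    and eq: "\<And>h. h \<in> form_domain V \<Longrightarrow> schroedinger_form V W f h = L2_inner u h"
    using fu by (simp_all add: schroedinger_op_def)
  have "schroedinger_form V W g h = L2_inner v h" if h: "h \<in> form_domain V" for h
    using eq[OF h] form_cong[OF f assms(2) h] L2_inner_cong[OF u assms(3) form_domain_square_integrable[OF h]] by simp
  then show ?thesis
    using form_domain_cong[OF f assms(2)] square_integrable_cong[OF u assms(3)] by (simp add: schroedinger_op_def)
qed

lemma square_integrable_vector_smult:
  fixes u :: "real^'n \<Rightarrow> complex^2"
  assumes "square_integrable u"
  shows "square_integrable (\<lambda>x. c *s u x)"
  by (rule square_integrable_vecI) (simp add: square_integrable_cmult square_integrable_nth assms)

lemma operator_lincomb: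
  assumes fu: "(f, u) \<in> schroedinger_op V W" and gv: "(g, v) \<in> schroedinger_op V W"
  shows "(\<lambda>x. c *s f x + d *s g x, \<lambda>x. c *s u x + d *s v x) \<in> schroedinger_op V W"
  using assms unfolding schroedinger_op_def
  by (auto simp: form_domain_lincomb form_lincomb L2_inner_lincomb form_domain_square_integrable
      intro!: square_integrable_add square_integrable_vector_smult)

lemma operator_smult:
  assumes "(f, u) \<in> schroedinger_op V W"
  shows "(\<lambda>x. c *s f x, \<lambda>x. c *s u x) \<in> schroedinger_op V W"
  using operator_lincomb[OF assms assms, of c 0] by simp

lemma operator_symmetric:
  assumes fu: "(f, u) \<in> schroedinger_op V W" and gv: "(g, v) \<in> schroedinger_op V W"
  shows "L2_inner u g = L2_inner f v"
  using assms form_hermitian[of g f] L2_inner_cnj[of f v] by (simp add: schroedinger_op_def)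

lemma operator_injective:
  assumes pd: "positive_definite_form V W"
    and fu: "(f, u) \<in> schroedinger_op V W" and gu: "(g, u) \<in> schroedinger_op V W"
  shows "AE x in lebesgue. f x = g x"
proof -
  let ?d = "\<lambda>x. 1 *s f x + (- 1) *s g x"
  have "(?d, \<lambda>x. 1 *s u x + (- 1) *s u x) \<in> schroedinger_op V W"
    by (rule operator_lincomb[OF fu gu])
  then have d: "?d \<in> form_domain V" and "schroedinger_form V W ?d ?d = L2_inner (\<lambda>x. 0) ?d"
    by (simp_all add: schroedinger_op_def)
  then have "Re (schroedinger_form V W ?d ?d) = 0"
    by (simp add: L2_inner_def)
  with pd d have "AE x in lebesgue. ?d x = 0"
    unfolding positive_definite_form_def by force
  then show ?thesis
    by eventually_elim simp
qed

end

section \<open>The generalised null space\<close>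

lemma nonlinear_term_le:
  fixes p q :: complex and s b :: real
  assumes "cmod p \<le> s" "cmod q \<le> s"
  shows "cmod (of_real b * p * q) \<le> \<bar>b\<bar> * s\<^sup>2"
proof -
  have "0 \<le> s" using assms(1) norm_ge_zero order_trans by blast
  then have "cmod p * cmod q \<le> s * s"
    using assms by (intro mult_mono) simp_all
  then have "\<bar>b\<bar> * (cmod p * cmod q) \<le> \<bar>b\<bar> * (s * s)"
    by (rule mult_left_mono) simp
  then show ?thesis
    by (simp add: norm_mult mult.assoc power2_eq_square)
qed

text \<open>Both linearised operators have potentials of this shape and differ only in the
  coefficients. Real values of \<open>\<Phi>\<close> make the matrix Hermitian, and the sum of the
  absolute values of all coefficients bounds every entry at once.\<close>

lemma confined_form_quadratic_potential:
  fixes V :: "real^'n \<Rightarrow> real" and \<Phi> :: "real^'n \<Rightarrow> complex^2"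
  assumes dim: "CARD('n) \<le> 3" and V: "\<And>x. 0 \<le> V x" "V \<in> borel_measurable lebesgue" "filterlim V at_top at_infinity"
    and \<Phi>: "\<Phi> \<in> form_domain V" and real: "AE x in lebesgue. \<forall>j. \<Phi> x $ j \<in> \<real>"
    and W11: "\<And>x. W x $ 1 $ 1 = of_real c1 + of_real a1 * (\<Phi> x $ 1) * (\<Phi> x $ 1) + of_real b1 * (\<Phi> x $ 2) * (\<Phi> x $ 2)"
    and W22: "\<And>x. W x $ 2 $ 2 = of_real c2 + of_real a2 * (\<Phi> x $ 1) * (\<Phi> x $ 1) + of_real b2 * (\<Phi> x $ 2) * (\<Phi> x $ 2)"
    and W12: "\<And>x. W x $ 1 $ 2 = of_real c0 + of_real b0 * (\<Phi> x $ 1) * (\<Phi> x $ 2)"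
    and W21: "\<And>x. W x $ 2 $ 1 = of_real c0 + of_real b0 * (\<Phi> x $ 1) * (\<Phi> x $ 2)"
  shows "confined_form V \<Phi> W (\<bar>c0\<bar> + \<bar>c1\<bar> + \<bar>c2\<bar> + \<bar>a1\<bar> + \<bar>a2\<bar> + \<bar>b0\<bar> + \<bar>b1\<bar> + \<bar>b2\<bar>)" (is "confined_form V \<Phi> W ?C")
proof
  show "AE x in lebesgue. \<forall>j k. W x $ j $ k = cnj (W x $ k $ j)"
    using real
  proof eventually_elim
    case (elim x)
    then have "cnj (\<Phi> x $ j) = \<Phi> x $ j" for j
      by (simp add: Reals_cnj_iff)
    then show ?case
      by (simp add: forall_2 W11 W22 W12 W21)
  qed
  have "q0 \<le> q0 + q1 + q2 + q3 + q4 + q5 + q6 + q7 \<and> q1 \<le> q0 + q1 + q2 + q3 + q4 + q5 + q6 + q7 \<and>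
      q2 \<le> q0 + q1 + q2 + q3 + q4 + q5 + q6 + q7 \<and> q3 + q6 \<le> q0 + q1 + q2 + q3 + q4 + q5 + q6 + q7 \<and>
      q4 + q7 \<le> q0 + q1 + q2 + q3 + q4 + q5 + q6 + q7 \<and> q5 \<le> q0 + q1 + q2 + q3 + q4 + q5 + q6 + q7"
    if "0 \<le> q0" "0 \<le> q1" "0 \<le> q2" "0 \<le> q3" "0 \<le> q4" "0 \<le> q5" "0 \<le> q6" "0 \<le> q7" for q0 q1 q2 q3 q4 q5 q6 q7 :: real
    using that by linarith
  from this[OF abs_ge_zero abs_ge_zero abs_ge_zero abs_ge_zero abs_ge_zero abs_ge_zero abs_ge_zero abs_ge_zero,
      of c0 c1 c2 a1 a2 b0 b1 b2]
  have C: "\<bar>c0\<bar> \<le> ?C" "\<bar>c1\<bar> \<le> ?C" "\<bar>c2\<bar> \<le> ?C" "\<bar>a1\<bar> + \<bar>b1\<bar> \<le> ?C" "\<bar>a2\<bar> + \<bar>b2\<bar> \<le> ?C" "\<bar>b0\<bar> \<le> ?C"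
    by blast+
  show "AE x in lebesgue. \<forall>j k. cmod (W x $ j $ k) \<le> ?C * (1 + (norm (\<Phi> x))\<^sup>2)"
  proof (rule AE_I2)
    fix x
    let ?s = "norm (\<Phi> x)"
    have le: "cmod (\<Phi> x $ j) \<le> ?s" for j
      by (rule Finite_Cartesian_Product.norm_nth_le)
    have diag: "cmod (of_real c + of_real a * p * p + of_real b * q * q) \<le> ?C * (1 + ?s\<^sup>2)"
      if "cmod p \<le> ?s" "cmod q \<le> ?s" "\<bar>c\<bar> \<le> ?C" "\<bar>a\<bar> + \<bar>b\<bar> \<le> ?C" for a b c :: real and p q :: complex
    proof -
      have "cmod (of_real c + of_real a * p * p + of_real b * q * q)
          \<le> cmod (of_real c) + cmod (of_real a * p * p) + cmod (of_real b * q * q)"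
        by (intro norm_triangle_le add_mono norm_triangle_ineq order_refl)
      also have "\<dots> \<le> \<bar>c\<bar> + \<bar>a\<bar> * ?s\<^sup>2 + \<bar>b\<bar> * ?s\<^sup>2"
        using that by (intro add_mono nonlinear_term_le) simp_all
      also have "\<dots> = \<bar>c\<bar> + (\<bar>a\<bar> + \<bar>b\<bar>) * ?s\<^sup>2"
        by (simp add: distrib_right)
      also have "\<dots> \<le> ?C + ?C * ?s\<^sup>2"
        by (intro add_mono mult_right_mono that) simp
      finally show ?thesis
        by (simp add: distrib_left)
    qed
    have off: "cmod (of_real c0 + of_real b0 * (\<Phi> x $ 1) * (\<Phi> x $ 2)) \<le> ?C * (1 + ?s\<^sup>2)"
    proof -
      have "cmod (of_real c0 + of_real b0 * (\<Phi> x $ 1) * (\<Phi> x $ 2)) \<le> \<bar>c0\<bar> + \<bar>b0\<bar> * ?s\<^sup>2"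
        using nonlinear_term_le[OF le le, of b0 1 2]
        by (intro order_trans[OF norm_triangle_ineq] add_mono) simp_all
      also have "\<dots> \<le> ?C + ?C * ?s\<^sup>2"
        by (intro add_mono mult_right_mono C) simp
      finally show ?thesis
        by (simp add: distrib_left)
    qed
    have "cmod (W x $ 1 $ 1) \<le> ?C * (1 + ?s\<^sup>2)" "cmod (W x $ 2 $ 2) \<le> ?C * (1 + ?s\<^sup>2)"
      unfolding W11 W22 by (intro diag le C)+
    then show "\<forall>j k. cmod (W x $ j $ k) \<le> ?C * (1 + ?s\<^sup>2)"
      using off by (simp only: forall_2 W12 W21 simp_thms)
  qed
  have [measurable]: "(\<lambda>x. \<Phi> x $ j) \<in> borel_measurable lebesgue" for j
    by (rule square_integrable_measurable[OF square_integrable_nth[OF form_domain_square_integrable[OF \<Phi>]]])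
  have "(\<lambda>x. W x $ 1 $ 1) \<in> borel_measurable lebesgue" "(\<lambda>x. W x $ 2 $ 2) \<in> borel_measurable lebesgue"
    "(\<lambda>x. W x $ 1 $ 2) \<in> borel_measurable lebesgue" "(\<lambda>x. W x $ 2 $ 1) \<in> borel_measurable lebesgue"
    unfolding W11 W22 W12 W21 by measurable
  then have "\<forall>j k. (\<lambda>x. W x $ j $ k) \<in> borel_measurable lebesgue"
    by (simp add: forall_2)
  then show "(\<lambda>x. W x $ j $ k) \<in> borel_measurable lebesgue" for j k
    by blast
qed (use dim V \<Phi> in simp_all)

text \<open>\<open>\<Phi>1\<close> stands for the preimage of \<open>\<Phi>\<close> under the
  positive operator. As operators are graphs of functions, it is characterised by saying that the
  solutions of the equation are exactly the functions equal to it almost everywhere.\<close>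

theorem theorem5:
  fixes V :: "real^'n \<Rightarrow> real" and \<beta> :: "real^2^2" and \<delta> \<Omega> \<mu> :: real
    and \<Phi> :: "real^'n \<Rightarrow> complex^2"
  assumes "CARD('n) \<in> {1, 2, 3}"
    and "\<And>x. 0 \<le> V x"
    and "locally_integrable V"
    and "filterlim V at_top at_infinity"
    and "\<beta> $ 1 $ 2 = \<beta> $ 2 $ 1"
    and "\<Omega> \<noteq> 0"
    and "ground_state V \<beta> \<delta> \<Omega> \<Phi>"
    and "AE x in lebesgue. \<forall>j. \<Phi> x $ j \<in> \<real>"
    and "chemical_potential V \<beta> \<delta> \<Omega> \<Phi> \<mu>"
    and "positive_definite_form V (plus_matrix \<beta> \<delta> \<Omega> \<Phi> \<mu>)"
    and "null_space (H_minus V \<beta> \<delta> \<Omega> \<Phi> \<mu>) = span1 \<Phi>"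
  shows "\<exists>\<Phi>1. (\<forall>f. (f, \<Phi>) \<in> H_plus V \<beta> \<delta> \<Omega> \<Phi> \<mu> \<longleftrightarrow> (AE x in lebesgue. f x = \<Phi>1 x)) \<and>
           null_space2 (H_block V \<beta> \<delta> \<Omega> \<Phi> \<mu> ^^ 3) = null_space2 (H_block V \<beta> \<delta> \<Omega> \<Phi> \<mu> ^^ 2) \<and>
           is_direct_sum (null_space2 (H_block V \<beta> \<delta> \<Omega> \<Phi> \<mu> ^^ 2))
             (null_space2 (H_block V \<beta> \<delta> \<Omega> \<Phi> \<mu>)) (span2 (\<Phi>1, \<lambda>x. 0)) \<and>
           null_space2 (H_block V \<beta> \<delta> \<Omega> \<Phi> \<mu>) = span2 (\<lambda>x. 0, \<Phi>)"
proof -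
  let ?P = "plus_matrix \<beta> \<delta> \<Omega> \<Phi> \<mu>" and ?M = "minus_matrix \<beta> \<delta> \<Omega> \<Phi> \<mu>"
  have dim: "CARD('n) \<le> 3"
    using assms(1) by auto
  have Vm: "V \<in> borel_measurable lebesgue"
    using assms(3) by (simp add: locally_integrable_def)
  have \<Phi>: "\<Phi> \<in> form_domain V" and norm1: "(LINT x|lebesgue. (cmod (\<Phi> x $ 1))\<^sup>2 + (cmod (\<Phi> x $ 2))\<^sup>2) = 1"
    using assms(7) by (simp_all add: ground_state_def admissible_def)
  note s\<Phi> = form_domain_square_integrable[OF \<Phi>]
  note matrix_defs = plus_matrix_def minus_matrix_def A_matrix_def B_matrix_def
  \<comment> \<open>Adding the second matrix triples the self-interaction coefficients and doubles
    the off-diagonal product; subtracting it, as in the next interpretation, leaves a single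
    self-interaction and cancels that product.\<close>
  interpret P: confined_form V \<Phi> ?P "\<bar>\<Omega> / 2\<bar> + \<bar>\<delta> / 2 - \<mu>\<bar> + \<bar>- \<delta> / 2 - \<mu>\<bar> + \<bar>3 * \<beta>$1$1\<bar> + \<bar>\<beta>$2$1\<bar> + \<bar>2 * \<beta>$1$2\<bar> + \<bar>\<beta>$1$2\<bar> + \<bar>3 * \<beta>$2$2\<bar>"
    by (rule confined_form_quadratic_potential[OF dim assms(2) Vm assms(4) \<Phi> assms(8)])
      (simp_all add: matrix_defs assms(5) power2_eq_square algebra_simps)
  interpret M: confined_form V \<Phi> ?M "\<bar>\<Omega> / 2\<bar> + \<bar>\<delta> / 2 - \<mu>\<bar> + \<bar>- \<delta> / 2 - \<mu>\<bar> + \<bar>\<beta>$1$1\<bar> + \<bar>\<beta>$2$1\<bar> + \<bar>0\<bar> + \<bar>\<beta>$1$2\<bar> + \<bar>\<beta>$2$2\<bar>"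
    by (rule confined_form_quadratic_potential[OF dim assms(2) Vm assms(4) \<Phi> assms(8)])
      (simp_all add: matrix_defs assms(5) power2_eq_square algebra_simps)
  have Hp: "H_plus V \<beta> \<delta> \<Omega> \<Phi> \<mu> = schroedinger_op V ?P" and Hm: "H_minus V \<beta> \<delta> \<Omega> \<Phi> \<mu> = schroedinger_op V ?M"
    by (simp_all add: H_plus_def H_minus_def)
  note pd = assms(10)
  have minus_null: "(g, \<lambda>x. 0) \<in> schroedinger_op V ?M \<longleftrightarrow> (\<exists>c. AE x in lebesgue. g x = c *s \<Phi> x)" for g
    using assms(11) by (auto simp: null_space_def span1_def Hm set_eq_iff)
  have plus_zero: "((\<lambda>x. 0), (\<lambda>x. 0)) \<in> schroedinger_op V ?P"
    using P.form_lincomb[OF \<Phi> \<Phi>, of _ 0 0] P.form_domain_lincomb[OF \<Phi> \<Phi>, of 0 0]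
    by (simp add: schroedinger_op_def square_integrable_0 L2_inner_def)
  have plus_null: "(f, \<lambda>x. 0) \<in> schroedinger_op V ?P \<longleftrightarrow> (AE x in lebesgue. f x = 0)" for f
  proof
    assume "(f, \<lambda>x. 0) \<in> schroedinger_op V ?P"
    then show "AE x in lebesgue. f x = 0"
      by (rule P.operator_injective[OF pd _ plus_zero])
  next
    assume "AE x in lebesgue. f x = 0"
    then have "AE x in lebesgue. 0 = f x"
      by eventually_elim simp
    then show "(f, \<lambda>x. 0) \<in> schroedinger_op V ?P"
      by (rule P.operator_cong[OF plus_zero]) simp
  qed
  obtain \<Phi>1 where "\<Phi>1 \<in> form_domain V" and "\<forall>h\<in>form_domain V. schroedinger_form V ?P \<Phi>1 h = L2_inner \<Phi> h"
    using P.solvable[OF pd s\<Phi>] by blast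
  then have \<Phi>1: "(\<Phi>1, \<Phi>) \<in> schroedinger_op V ?P"
    using s\<Phi> by (simp add: schroedinger_op_def)
  \<comment> \<open>Stated for every \<open>w\<close> that agrees with \<open>c *s \<Phi> x\<close>
    almost everywhere, since elements of the kernel of the minus operator are known only up to null
    sets.\<close>
  have plus_range: "(f, w) \<in> schroedinger_op V ?P \<longleftrightarrow> (AE x in lebesgue. f x = c *s \<Phi>1 x)"
    if w: "AE x in lebesgue. w x = c *s \<Phi> x" for f w c
  proof
    have w': "AE x in lebesgue. c *s \<Phi> x = w x"
      using w by eventually_elim simp
    have c: "(\<lambda>x. c *s \<Phi>1 x, w) \<in> schroedinger_op V ?P"
      by (rule P.operator_cong[OF P.operator_smult[OF \<Phi>1] _ w']) simp
    show "AE x in lebesgue. f x = c *s \<Phi>1 x" if "(f, w) \<in> schroedinger_op V ?P"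
      by (rule P.operator_injective[OF pd that c])
    show "(f, w) \<in> schroedinger_op V ?P" if "AE x in lebesgue. f x = c *s \<Phi>1 x"
    proof -
      have "AE x in lebesgue. c *s \<Phi>1 x = f x"
        using that by eventually_elim simp
      then show ?thesis
        by (rule P.operator_cong[OF c]) simp
    qed
  qed
  have not_\<Phi>_zero: "\<not> (AE x in lebesgue. \<Phi> x = 0)"
  proof
    assume "AE x in lebesgue. \<Phi> x = 0"
    then have "AE x in lebesgue. (cmod (\<Phi> x $ 1))\<^sup>2 + (cmod (\<Phi> x $ 2))\<^sup>2 = 0"
      by eventually_elim simp
    then show False
      using norm1 integral_eq_zero_AE by fastforce
  qed
  \<comment> \<open>This number is conjugate to the value of the positive form at
    \<open>\<Phi>1\<close>. If it vanished, \<open>\<Phi>1\<close> and hence its image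
    \<open>\<Phi>\<close> would be null, against the normalisation of the ground state.\<close>
  have inner_pos: "L2_inner \<Phi>1 \<Phi> \<noteq> 0"
  proof
    assume "L2_inner \<Phi>1 \<Phi> = 0"
    then have "L2_inner \<Phi> \<Phi>1 = 0"
      using L2_inner_cnj[of \<Phi> \<Phi>1] by simp
    then have "Re (schroedinger_form V ?P \<Phi>1 \<Phi>1) = 0"
      using \<Phi>1 by (simp add: schroedinger_op_def)
    then have "AE x in lebesgue. \<Phi>1 x = 0"
      using pd \<Phi>1 unfolding positive_definite_form_def schroedinger_op_def by force
    then have zero: "(\<Phi>1, \<lambda>x. 0) \<in> schroedinger_op V ?P"
      by (simp add: plus_null)
    have "L2_inner \<Phi> \<Phi> = L2_inner (\<lambda>x. 0) \<Phi>"
      using \<Phi>1 zero \<Phi> by (simp add: schroedinger_op_def)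
    then have "L2sq \<Phi> = 0"
      using L2_inner_self[OF s\<Phi>] by (simp add: L2_inner_def)
    then show False
      using not_\<Phi>_zero by (simp add: L2sq_eq_0_iff[OF s\<Phi>])
  qed
  text \<open>\<^term>\<open>\<Phi>1\<close> is not orthogonal to the kernel of the symmetric operator \<open>H\<^sub>-\<close>, hence not in its range.\<close>
  have no_preimage: "d = 0" if g: "(g, v) \<in> schroedinger_op V ?M" and v: "AE x in lebesgue. v x = d *s \<Phi>1 x" for g v d
  proof -
    have "AE x in lebesgue. \<Phi> x = 1 *s \<Phi> x"
      by simp
    then have "(\<Phi>, \<lambda>x. 0) \<in> schroedinger_op V ?M"
      unfolding minus_null by blast
    then have "L2_inner v \<Phi> = L2_inner g (\<lambda>x. 0)"
      by (rule M.operator_symmetric[OF g])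
    then have "L2_inner v \<Phi> = 0"
      by (simp add: L2_inner_def)
    moreover have "square_integrable v"
      using g by (simp add: schroedinger_op_def)
    then have "L2_inner v \<Phi> = L2_inner (\<lambda>x. d *s \<Phi>1 x) \<Phi>"
      by (rule M.L2_inner_cong[OF _ v s\<Phi>])
    moreover have "square_integrable \<Phi>1"
      using \<Phi>1 by (auto simp: schroedinger_op_def form_domain_square_integrable)
    then have "L2_inner (\<lambda>x. d *s \<Phi>1 x) \<Phi> = d * L2_inner \<Phi>1 \<Phi>"
      using L2_inner_lincomb[of \<Phi>1 \<Phi>1 \<Phi> d 0] s\<Phi> by simp
    ultimately show "d = 0"
      using inner_pos by simp
  qed
  let ?H = "H_block V \<beta> \<delta> \<Omega> \<Phi> \<mu>"
  have mem_H: "((f, g), (u, w)) \<in> ?H \<longleftrightarrow> (g, u) \<in> schroedinger_op V ?M \<and> (f, w) \<in> schroedinger_op V ?P" for f g u w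
    by (simp add: H_block_def Hp Hm)
  have null1: "(f, g) \<in> null_space2 ?H \<longleftrightarrow> (AE x in lebesgue. f x = 0) \<and> (\<exists>c. AE x in lebesgue. g x = c *s \<Phi> x)" for f g
    by (auto simp: null_space2_def mem_H minus_null plus_null)
  have null2: "(f, g) \<in> null_space2 (?H ^^ 2) \<longleftrightarrow>
    (\<exists>c. AE x in lebesgue. f x = c *s \<Phi>1 x) \<and> (\<exists>c. AE x in lebesgue. g x = c *s \<Phi> x)" for f g
  proof -
    have "(f, g) \<in> null_space2 (?H ^^ 2) \<longleftrightarrow> (\<exists>u w. ((f, g), (u, w)) \<in> ?H \<and> (u, w) \<in> null_space2 ?H)"
      by (auto simp: null_space2_def numeral_2_eq_2 relcomp_unfold)
    also have "\<dots> \<longleftrightarrow> (\<exists>c. AE x in lebesgue. f x = c *s \<Phi>1 x) \<and> (\<exists>c. AE x in lebesgue. g x = c *s \<Phi> x)"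
    proof
      assume "\<exists>u w. ((f, g), (u, w)) \<in> ?H \<and> (u, w) \<in> null_space2 ?H"
      then obtain u w c where gu: "(g, u) \<in> schroedinger_op V ?M" and fw: "(f, w) \<in> schroedinger_op V ?P"
        and u: "AE x in lebesgue. u x = 0" and w: "AE x in lebesgue. w x = c *s \<Phi> x"
        by (auto simp: mem_H null1)
      have "(g, \<lambda>x. 0) \<in> schroedinger_op V ?M"
        by (rule M.operator_cong[OF gu _ u]) simp
      then show "(\<exists>c. AE x in lebesgue. f x = c *s \<Phi>1 x) \<and> (\<exists>c. AE x in lebesgue. g x = c *s \<Phi> x)"
        using fw unfolding plus_range[OF w] minus_null by blast
    next
      assume "(\<exists>c. AE x in lebesgue. f x = c *s \<Phi>1 x) \<and> (\<exists>c. AE x in lebesgue. g x = c *s \<Phi> x)"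
      then obtain c where f: "AE x in lebesgue. f x = c *s \<Phi>1 x" and g: "(g, \<lambda>x. 0) \<in> schroedinger_op V ?M"
        unfolding minus_null by blast
      have w: "AE x in lebesgue. c *s \<Phi> x = c *s \<Phi> x"
        by simp
      \<comment> \<open>For a pair of the stated form this is its image under \<open>?H\<close>, the
        witness for the intermediate value.\<close>
      then have "(\<lambda>x. 0, \<lambda>x. c *s \<Phi> x) \<in> null_space2 ?H"
        unfolding null1 by auto
      moreover have "((f, g), (\<lambda>x. 0, \<lambda>x. c *s \<Phi> x)) \<in> ?H"
        using f g unfolding mem_H plus_range[OF w] by blast
      ultimately show "\<exists>u w. ((f, g), (u, w)) \<in> ?H \<and> (u, w) \<in> null_space2 ?H"
        by blast
    qed
    finally show ?thesis .
  qed
  have null3: "(f, g) \<in> null_space2 (?H ^^ 3) \<longleftrightarrow> (f, g) \<in> null_space2 (?H ^^ 2)" for f g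
  proof -
    have "(f, g) \<in> null_space2 (?H ^^ 3) \<longleftrightarrow> (\<exists>u w. ((f, g), (u, w)) \<in> ?H \<and> (u, w) \<in> null_space2 (?H ^^ 2))"
      \<comment> \<open>A relational power splits off its last factor; commuting it to the front
        lets \<open>?H\<close> act once before membership in the null space of the square is
        asked.\<close>
      unfolding null_space2_def numeral_3_eq_3 relpow.simps(2)[of "Suc (Suc 0)"] relpow_commute
      by (auto simp: numeral_2_eq_2 relcomp_unfold)
    also have "\<dots> \<longleftrightarrow> (f, g) \<in> null_space2 (?H ^^ 2)"
    proof
      assume "\<exists>u w. ((f, g), (u, w)) \<in> ?H \<and> (u, w) \<in> null_space2 (?H ^^ 2)"
      then obtain u w c d where gu: "(g, u) \<in> schroedinger_op V ?M" and fw: "(f, w) \<in> schroedinger_op V ?P"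
        and u: "AE x in lebesgue. u x = d *s \<Phi>1 x" and w: "AE x in lebesgue. w x = c *s \<Phi> x"
        by (auto simp: mem_H null2)
      have "d = 0"
        by (rule no_preimage[OF gu u])
      then have u0: "AE x in lebesgue. u x = 0"
        using u by simp
      have "(g, \<lambda>x. 0) \<in> schroedinger_op V ?M"
        by (rule M.operator_cong[OF gu _ u0]) simp
      then show "(f, g) \<in> null_space2 (?H ^^ 2)"
        using fw unfolding null2 plus_range[OF w] minus_null by blast
    next
      assume "(f, g) \<in> null_space2 (?H ^^ 2)"
      then obtain u w where uw: "((f, g), (u, w)) \<in> ?H" "(u, w) \<in> null_space2 ?H"
        by (auto simp: null_space2_def numeral_2_eq_2 relcomp_unfold)
      \<comment> \<open>The null space of \<open>?H\<close> lies in that of its square: the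
        coefficient of \<open>\<Phi>1\<close> is taken to be 0.\<close>
      then have "(u, w) \<in> null_space2 (?H ^^ 2)"
        unfolding null1 null2 by (auto intro!: exI[of _ "0::complex"])
      with uw(1) show "\<exists>u w. ((f, g), (u, w)) \<in> ?H \<and> (u, w) \<in> null_space2 (?H ^^ 2)"
        by blast
    qed
    finally show ?thesis .
  qed
  have N1: "null_space2 ?H = span2 (\<lambda>x. 0, \<Phi>)"
    by (auto simp: set_eq_iff null1 span2_def)
  have "is_direct_sum (null_space2 (?H ^^ 2)) (null_space2 ?H) (span2 (\<Phi>1, \<lambda>x. 0))"
    unfolding is_direct_sum_def
  proof
    show "null_space2 (?H ^^ 2) = {(\<lambda>x. f x + f' x, \<lambda>x. g x + g' x) | f g f' g'. (f, g) \<in> null_space2 ?H \<and> (f', g') \<in> span2 (\<Phi>1, \<lambda>x. 0)}"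
      (is "_ = ?S")
    proof (intro set_eqI iffI)
      fix p
      assume "p \<in> null_space2 (?H ^^ 2)"
      then obtain f g where p: "p = (f, g)" and f: "\<exists>c. AE x in lebesgue. f x = c *s \<Phi>1 x"
        and g: "\<exists>c. AE x in lebesgue. g x = c *s \<Phi> x"
        using null2 by (cases p) blast
      \<comment> \<open>The splitting separates the two components: the second belongs to the kernel
        of \<open>?H\<close>, the first to the span of \<open>\<Phi>1\<close>.\<close>
      have "(\<lambda>x. 0, g) \<in> null_space2 ?H" "(f, \<lambda>x. 0) \<in> span2 (\<Phi>1, \<lambda>x. 0)"
        using f g by (simp_all add: null1 span2_def)
      moreover have "p = (\<lambda>x. 0 + f x, \<lambda>x. g x + 0)"
        by (simp add: p)
      ultimately show "p \<in> ?S"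
        unfolding mem_Collect_eq
        by (intro exI[of _ "\<lambda>x. 0"] exI[of _ g] exI[of _ f] conjI)
    next
      fix p
      assume "p \<in> ?S"
      then obtain f g f' g' where p: "p = (\<lambda>x. f x + f' x, \<lambda>x. g x + g' x)"
        and fg: "(f, g) \<in> null_space2 ?H" and fg': "(f', g') \<in> span2 (\<Phi>1, \<lambda>x. 0)"
        by blast
      obtain c d where f: "AE x in lebesgue. f x = 0" and g: "AE x in lebesgue. g x = c *s \<Phi> x"
        and f': "AE x in lebesgue. f' x = d *s \<Phi>1 x" and g': "AE x in lebesgue. g' x = 0"
        using fg fg' by (auto simp: null1 span2_def)
      have "AE x in lebesgue. f x + f' x = d *s \<Phi>1 x"
        using f f' by eventually_elim simp
      moreover have "AE x in lebesgue. g x + g' x = c *s \<Phi> x"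
        using g g' by eventually_elim simp
      ultimately show "p \<in> null_space2 (?H ^^ 2)"
        unfolding p null2 by blast
    qed
    show "null_space2 ?H \<inter> span2 (\<Phi>1, \<lambda>x. 0) = {(f, g). (AE x in lebesgue. f x = 0) \<and> (AE x in lebesgue. g x = 0)}"
      by (auto simp: set_eq_iff null1 span2_def intro!: exI[of _ "0::complex"])
  qed
  moreover have "(f, \<Phi>) \<in> H_plus V \<beta> \<delta> \<Omega> \<Phi> \<mu> \<longleftrightarrow> (AE x in lebesgue. f x = \<Phi>1 x)" for f
    unfolding Hp using plus_range[of \<Phi> 1 f] by simp
  moreover have "null_space2 (?H ^^ 3) = null_space2 (?H ^^ 2)"
    using null3 by (simp add: set_eq_iff)
  ultimately show ?thesis
    using N1 by blast
qed

end
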